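(* For $\mathcal T\in\mathbb T$ let $\mathcal T_*\succ\mathcal T$ be a uniform red-refinement, and define $\psi_\nu=\psi_{\mathcal T,\nu}:=2^{d+1}\mathbb 1_{\omega_{\mathcal T_*,\nu}}-\mathbb 1_{\omega_{\mathcal T,\nu}}$ ($\nu\in N^0_{\mathcal T}$), $\Psi_{\mathcal T}:=\{\psi_\nu:\nu\in N^0_{\mathcal T}\}$ and $\mathscr W_{\mathcal T}:=\operatorname{span}\Psi_{\mathcal T}$. Let $\mathscr U_{\mathcal T}:=\{u\in L_2(\Omega):u|_T\in\mathcal P_0\ (T\in\mathcal T)\}$, let $Q_{\mathcal T}$ be the $L_2(\Omega)$-orthogonal projector onto $\mathscr U_{\mathcal T}$, let $\Theta_{\mathcal T}:=(\mathrm{Id}-Q_{\mathcal T})\Psi_{\mathcal T}=\{\theta_\nu:=(\mathrm{Id}-Q_{\mathcal T})\psi_\nu:\nu\in N^0_{\mathcal T}\}$ and $\mathscr B_{\mathcal T}:=\operatorname{span}\Theta_{\mathcal T}$. Then $\mathscr W_{\mathcal T}\subset\mathscr Z_{\mathcal T}:=\mathscr U_{\mathcal T}+\mathscr B_{\mathcal T}$ and, with all constants independent of $\mathcal T\in\mathbb T$: (a) $Q_{\mathcal T}\in\mathcal L(L_2(\Omega),H^1_{0,\gamma}(\Omega)')$ is a projector with $\mathscr U_{\mathcal T}\subseteq\operatorname{ran}Q_{\mathcal T}$ and $\mathscr B_{\mathcal T}\subseteq\operatorname{ran}(\mathrm{Id}-Q_{\mathcal T})$, both subspaces of $L_2(\Omega)$,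 and (1) $\|h_{\mathcal T}^{-1}(\mathrm{Id}-Q_{\mathcal T}')\|_{\mathcal L(H^1_{0,\gamma}(\Omega),L_2(\Omega))}\lesssim1$; (2) $\sup_{\mathcal T\in\mathbb T}\|Q_{\mathcal T}|_{\mathscr Z_{\mathcal T}}\|_{\mathcal L((\mathscr Z_{\mathcal T},\|\cdot\|_{L_2(\Omega)}),L_2(\Omega))}\lesssim1$; (3) $\|h_{\mathcal T}z\|_{L_2(\Omega)}\lesssim\|z\|_{H^1_{0,\gamma}(\Omega)'}$ for all $z\in\mathscr Z_{\mathcal T}$; (b) in particular, $Q_{\mathcal T}\psi_\nu=\mathbb 1_{\omega_{\mathcal T,\nu}}$ for $\nu\in N^0_{\mathcal T}$; (c) $\Theta_{\mathcal T}$ is a uniformly $\|h_{\mathcal T}^s\cdot\|_{L_2(\Omega)}$-stable basis for $\mathscr B_{\mathcal T}$, i.e. $\mathscr B_{\mathcal T}=\operatorname{span}\Theta_{\mathcal T}$ and for all real coefficients $(c_\nu)_{\nu\in N^0_{\mathcal T}}$, $$\Big\|h_{\mathcal T}^s\sum_{\nu\in N^0_{\mathcal T}}c_\nu\theta_\nu\Big\|_{L_2(\Omega)}^2\eqsim\sum_{\nu\in N^0_{\mathcal T}}|c_\nu|^2\|h_{\mathcal T}^s\theta_\nu\|_{L_2(\Omega)}^2 .$$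
   Context: $\Omega\subset\mathbb R^d$ is a bounded polytopal domain, $\gamma\subset\partial\Omega$ is measurable, closed and possibly empty, and $s\in[0,1]$. $H^1_{0,\gamma}(\Omega)$ is the space of $H^1(\Omega)$-functions vanishing on $\gamma$; $L_2(\Omega)\simeq L_2(\Omega)'$ is embedded in its dual $H^1_{0,\gamma}(\Omega)'$. $\mathbb T$ is a family of conforming partitions $\mathcal T$ of $\Omega$ into closed uniformly shape regular $d$-simplices. For $d>1$ it follows that neighbouring simplices ($T\cap T'\neq\emptyset$) have uniformly comparable sizes; for $d=1$ this uniform "$K$-mesh property" is imposed explicitly. For every $\mathcal T$, $\gamma$ is the (possibly empty) union of $(d-1)$-faces of simplices $T\in\mathcal T$. $N^0_{\mathcal T}$ is the set of vertices of $\mathcal T$ not on $\gamma$; $h_T:=|T|^{1/d}$ and $h_{\mathcal T}$ is the piecewise constant function with $h_{\mathcal T}|_T=h_T$. For a partition $\mathcal S$ and a vertex $\nu$, $\omega_{\mathcal S,\nu}:=\bigcup\{T\in\mathcal S:\nu\in T\}$. $\mathbb 1_K$ is the indicator function of $K$. $\mathcal P_0$ denotes the constants. $Q_{\mathcal T}':H^1_{0,\gamma}(\Omega)\to L_2(\Omega)$ is the adjoint of $Q_{\mathcal T}$. Uniform red-refinement: every $T\in\mathcal T$ is subdivided into $2^d$ subsimplices of equal volume, uniformly shape regular and forming a partition $\mathcal T_*$; for each vertex $\nu$ of $T$ exactly one of them contains $\nu$, and it is the image of $T$ under the homothety with centre $\nu$ and ratio $1/2$. (For $d\ge3$ red-refinement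 is not uniquely defined, but these corner subsimplices are uniquely determined.) $\lambda\lesssim\mu$ means that $\lambda\le C\mu$ with $C$ independent of $\mathcal T\in\mathbb T$ (and of functions and coefficients), but possibly dependent on $d$; $\lambda\eqsim\mu$ means $\lambda\lesssim\mu$ and $\mu\lesssim\lambda$.
   Formalization: In (c), the lower bound (sum of |c_ν|²‖h^sθ_ν‖² ≲ ‖h^sΣc_νθ_ν‖²) and linear independence of Θ are claimed only for d ≥ 2; for d = 1 they fail, e.g. Ω=(0,1), γ empty, one interval, where θ_1 = −θ_0. *)

theory Defs
  imports "HOL-Analysis.Analysis"
begin

section \<open>Lebesgue and Sobolev spaces\<close>

text \<open>
  The ambient space is a Euclidean space \<^typ>\<open>'a::euclidean_space\<close>, so the dimension is
  \<open>d = DIM('a) \<ge> 1\<close>.  Elements of \<open>L\<^sub>2(\<Omega>)\<close> are represented by functions on the whole type; only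
  their values almost everywhere on \<open>\<Omega>\<close> matter.  All sets of \<open>L\<^sub>2\<close>-functions below (spans, sums,
  ranges) are saturated with respect to almost everywhere equality on \<open>\<Omega>\<close>, so that inclusions and
  equalities of these sets are those of the corresponding sets of equivalence classes.
\<close>

abbreviation ae_eq :: "'a::euclidean_space set \<Rightarrow> ('a \<Rightarrow> real) \<Rightarrow> ('a \<Rightarrow> real) \<Rightarrow> bool" where
  "ae_eq \<Omega> f g \<equiv> AE x in lebesgue_on \<Omega>. f x = g x"

definition L2 :: "'a::euclidean_space set \<Rightarrow> ('a \<Rightarrow> real) set" where
  "L2 \<Omega> = {f \<in> borel_measurable (lebesgue_on \<Omega>). integrable (lebesgue_on \<Omega>) (\<lambda>x. (f x)\<^sup>2)}"

definition l2_inner :: "'a::euclidean_space set \<Rightarrow> ('a \<Rightarrow> real) \<Rightarrow> ('a \<Rightarrow> real) \<Rightarrow> real" where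
  "l2_inner \<Omega> f g = (LINT x|lebesgue_on \<Omega>. f x * g x)"

definition l2_norm :: "'a::euclidean_space set \<Rightarrow> ('a \<Rightarrow> real) \<Rightarrow> real" where
  "l2_norm \<Omega> f = sqrt (l2_inner \<Omega> f f)"

definition l2_subspace :: "'a::euclidean_space set \<Rightarrow> ('a \<Rightarrow> real) set \<Rightarrow> bool" where
  "l2_subspace \<Omega> V \<longleftrightarrow> V \<subseteq> L2 \<Omega> \<and> (\<lambda>x. 0) \<in> V \<and>
     (\<forall>f\<in>V. \<forall>g\<in>V. (\<lambda>x. f x + g x) \<in> V) \<and> (\<forall>a. \<forall>f\<in>V. (\<lambda>x. a * f x) \<in> V)"

definition l2_span ::
  "'a::euclidean_space set \<Rightarrow> 'i set \<Rightarrow> ('i \<Rightarrow> 'a \<Rightarrow> real) \<Rightarrow> ('a \<Rightarrow> real) set" where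
  "l2_span \<Omega> N F = {f \<in> L2 \<Omega>. \<exists>c. ae_eq \<Omega> f (\<lambda>x. \<Sum>i\<in>N. c i * F i x)}"

definition l2_sum ::
  "'a::euclidean_space set \<Rightarrow> ('a \<Rightarrow> real) set \<Rightarrow> ('a \<Rightarrow> real) set \<Rightarrow> ('a \<Rightarrow> real) set" where
  "l2_sum \<Omega> V W = {f \<in> L2 \<Omega>. \<exists>v\<in>V. \<exists>w\<in>W. ae_eq \<Omega> f (\<lambda>x. v x + w x)}"

definition l2_ran :: "'a::euclidean_space set \<Rightarrow> (('a \<Rightarrow> real) \<Rightarrow> 'a \<Rightarrow> real) \<Rightarrow> ('a \<Rightarrow> real) set" where
  "l2_ran \<Omega> A = {f \<in> L2 \<Omega>. \<exists>g\<in>L2 \<Omega>. ae_eq \<Omega> f (A g)}"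

fun C_k :: "nat \<Rightarrow> ('a::euclidean_space \<Rightarrow> real) \<Rightarrow> bool" where
  "C_k 0 f \<longleftrightarrow> continuous_on UNIV f"
| "C_k (Suc k) f \<longleftrightarrow> (\<forall>x. f differentiable (at x)) \<and>
     (\<forall>b\<in>Basis. C_k k (\<lambda>x. frechet_derivative f (at x) b))"

definition test_function :: "'a::euclidean_space set \<Rightarrow> ('a \<Rightarrow> real) \<Rightarrow> bool" where
  "test_function \<Omega> \<phi> \<longleftrightarrow> (\<forall>k. C_k k \<phi>) \<and>
     compact (closure {x. \<phi> x \<noteq> 0}) \<and> closure {x. \<phi> x \<noteq> 0} \<subseteq> \<Omega>"

definition has_weak_grad ::
  "'a::euclidean_space set \<Rightarrow> ('a \<Rightarrow> real) \<Rightarrow> ('a \<Rightarrow> 'a) \<Rightarrow> bool" where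
  "has_weak_grad \<Omega> u g \<longleftrightarrow> (\<forall>b\<in>Basis. (\<lambda>x. g x \<bullet> b) \<in> L2 \<Omega> \<and>
     (\<forall>\<phi>. test_function \<Omega> \<phi> \<longrightarrow>
        l2_inner \<Omega> u (\<lambda>x. frechet_derivative \<phi> (at x) b) = - l2_inner \<Omega> (\<lambda>x. g x \<bullet> b) \<phi>))"

definition H1 :: "'a::euclidean_space set \<Rightarrow> ('a \<Rightarrow> real) set" where
  "H1 \<Omega> = {u \<in> L2 \<Omega>. \<exists>g. has_weak_grad \<Omega> u g}"

definition weak_grad :: "'a::euclidean_space set \<Rightarrow> ('a \<Rightarrow> real) \<Rightarrow> 'a \<Rightarrow> 'a" where
  "weak_grad \<Omega> u = (SOME g. has_weak_grad \<Omega> u g)"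

definition h1_norm :: "'a::euclidean_space set \<Rightarrow> ('a \<Rightarrow> real) \<Rightarrow> real" where
  "h1_norm \<Omega> u = sqrt ((l2_norm \<Omega> u)\<^sup>2 + (\<Sum>b\<in>Basis. (l2_norm \<Omega> (\<lambda>x. weak_grad \<Omega> u x \<bullet> b))\<^sup>2))"

text \<open>
  \<open>H\<^sup>1\<^sub>0\<^sub>,\<^sub>\<gamma>(\<Omega>)\<close>: vanishing on \<open>\<gamma>\<close> is understood in the usual sense, as membership of the
  \<open>H\<^sup>1(\<Omega>)\<close>-closure of the functions in \<open>H\<^sup>1(\<Omega>)\<close> that vanish in a neighbourhood of \<open>\<gamma>\<close>.
  For \<open>\<gamma> = {}\<close> this is \<open>H\<^sup>1(\<Omega>)\<close>.
\<close>

definition H1_0 :: "'a::euclidean_space set \<Rightarrow> 'a set \<Rightarrow> ('a \<Rightarrow> real) set" where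
  "H1_0 \<Omega> \<gamma> = {u \<in> H1 \<Omega>. \<forall>\<epsilon>>0. \<exists>v\<in>H1 \<Omega>.
     (\<exists>V. open V \<and> \<gamma> \<subseteq> V \<and> (AE x in lebesgue_on \<Omega>. x \<in> V \<longrightarrow> v x = 0)) \<and>
     h1_norm \<Omega> (\<lambda>x. u x - v x) < \<epsilon>}"

text \<open>
  The norm of \<open>f \<in> L\<^sub>2(\<Omega>)\<close> in \<open>H\<^sup>1\<^sub>0\<^sub>,\<^sub>\<gamma>(\<Omega>)'\<close>, where \<open>f\<close> is identified with the functional
  \<open>w \<mapsto> \<langle>f, w\<rangle>\<close>.  The set is nonempty and, by the Cauchy-Schwarz inequality, bounded by
  the \<open>L\<^sub>2\<close>-norm of \<open>f\<close>, so that the real-valued supremum is the operator norm.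
\<close>

definition dual_norm :: "'a::euclidean_space set \<Rightarrow> 'a set \<Rightarrow> ('a \<Rightarrow> real) \<Rightarrow> real" where
  "dual_norm \<Omega> \<gamma> f = (SUP w\<in>{w \<in> H1_0 \<Omega> \<gamma>. h1_norm \<Omega> w \<le> 1}. \<bar>l2_inner \<Omega> f w\<bar>)"

text \<open>
  \<open>A\<close> is a linear map on \<open>L\<^sub>2(\<Omega>)\<close>, with values in \<open>L\<^sub>2(\<Omega>) \<subseteq> H\<^sup>1\<^sub>0\<^sub>,\<^sub>\<gamma>(\<Omega>)'\<close>, whose norm in
  \<open>\<L>(L\<^sub>2(\<Omega>), H\<^sup>1\<^sub>0\<^sub>,\<^sub>\<gamma>(\<Omega>)')\<close> is at most \<open>C\<close>.  The first clause says that \<open>A\<close> is well defined on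
  equivalence classes.
\<close>

definition l2_to_dual_bounded ::
  "'a::euclidean_space set \<Rightarrow> 'a set \<Rightarrow> real \<Rightarrow> (('a \<Rightarrow> real) \<Rightarrow> 'a \<Rightarrow> real) \<Rightarrow> bool" where
  "l2_to_dual_bounded \<Omega> \<gamma> C A \<longleftrightarrow>
     (\<forall>f\<in>L2 \<Omega>. \<forall>g\<in>L2 \<Omega>. ae_eq \<Omega> f g \<longrightarrow> ae_eq \<Omega> (A f) (A g)) \<and>
     (\<forall>f\<in>L2 \<Omega>. \<forall>g\<in>L2 \<Omega>. \<forall>a b.
        ae_eq \<Omega> (A (\<lambda>x. a * f x + b * g x)) (\<lambda>x. a * A f x + b * A g x)) \<and>
     (\<forall>f\<in>L2 \<Omega>. A f \<in> L2 \<Omega> \<and> dual_norm \<Omega> \<gamma> (A f) \<le> C * l2_norm \<Omega> f)"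

text \<open>
  The adjoint of a map \<open>A\<close> from \<open>L\<^sub>2(\<Omega>)\<close> to \<open>H\<^sup>1\<^sub>0\<^sub>,\<^sub>\<gamma>(\<Omega>)'\<close> with values in \<open>L\<^sub>2(\<Omega>)\<close>, as a map from
  \<open>H\<^sup>1\<^sub>0\<^sub>,\<^sub>\<gamma>(\<Omega>)\<close> to \<open>L\<^sub>2(\<Omega>) \<simeq> L\<^sub>2(\<Omega>)'\<close>; \<open>l2_inner \<Omega> (A f) w\<close> is the duality pairing of \<open>A f\<close> with \<open>w\<close>.
\<close>

definition dual_adjoint ::
  "'a::euclidean_space set \<Rightarrow> (('a \<Rightarrow> real) \<Rightarrow> 'a \<Rightarrow> real) \<Rightarrow> ('a \<Rightarrow> real) \<Rightarrow> 'a \<Rightarrow> real" where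
  "dual_adjoint \<Omega> A w = (SOME g. g \<in> L2 \<Omega> \<and> (\<forall>f\<in>L2 \<Omega>. l2_inner \<Omega> g f = l2_inner \<Omega> (A f) w))"

definition l2_proj ::
  "'a::euclidean_space set \<Rightarrow> ('a \<Rightarrow> real) set \<Rightarrow> ('a \<Rightarrow> real) \<Rightarrow> 'a \<Rightarrow> real" where
  "l2_proj \<Omega> V f = (SOME q. q \<in> V \<and> (\<forall>v\<in>V. l2_inner \<Omega> (\<lambda>x. f x - q x) v = 0))"

section \<open>Domains, partitions and red-refinement\<close>

text \<open>The boundary pieces are flat of dimension \<open>d - 1\<close>; slit domains are not excluded.\<close>

definition polytopal_domain :: "'a::euclidean_space set \<Rightarrow> bool" where
  "polytopal_domain \<Omega> \<longleftrightarrow> \<Omega> \<noteq> {} \<and> open \<Omega> \<and> connected \<Omega> \<and>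
     (\<exists>P. finite P \<and> (\<forall>p\<in>P. polytope p \<and> aff_dim p = int DIM('a) - 1) \<and> frontier \<Omega> = \<Union>P)"

definition simplicial_partition :: "'a::euclidean_space set \<Rightarrow> 'a set set \<Rightarrow> bool" where
  "simplicial_partition \<Omega> \<T> \<longleftrightarrow> finite \<T> \<and> (\<forall>T\<in>\<T>. int DIM('a) simplex T) \<and>
     \<Union>\<T> = closure \<Omega> \<and> (\<forall>T\<in>\<T>. interior T \<subseteq> \<Omega>) \<and>
     (\<forall>T\<in>\<T>. \<forall>T'\<in>\<T>. T \<noteq> T' \<longrightarrow> interior T \<inter> interior T' = {})"

text \<open>The empty set counts as a face.\<close>

definition conforming :: "'a::euclidean_space set set \<Rightarrow> bool" where
  "conforming \<T> \<longleftrightarrow> (\<forall>T\<in>\<T>. \<forall>T'\<in>\<T>. T \<inter> T' face_of T \<and> T \<inter> T' face_of T')"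

definition uniformly_shape_regular :: "'a::euclidean_space set set set \<Rightarrow> bool" where
  "uniformly_shape_regular \<TT> \<longleftrightarrow>
     (\<exists>\<kappa>. \<forall>\<T>\<in>\<TT>. \<forall>T\<in>\<T>. \<exists>c r. 0 < r \<and> cball c r \<subseteq> T \<and> diameter T \<le> \<kappa> * r)"

definition simplex_size :: "'a::euclidean_space set \<Rightarrow> real" where
  "simplex_size T = root DIM('a) (measure lebesgue T)"

definition K_mesh :: "'a::euclidean_space set set set \<Rightarrow> bool" where
  "K_mesh \<TT> \<longleftrightarrow> (\<exists>K. \<forall>\<T>\<in>\<TT>. \<forall>T\<in>\<T>. \<forall>T'\<in>\<T>. T \<inter> T' \<noteq> {} \<longrightarrow> simplex_size T \<le> K * simplex_size T')"

definition union_of_facets :: "'a::euclidean_space set set \<Rightarrow> 'a set \<Rightarrow> bool" where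
  "union_of_facets \<T> \<gamma> \<longleftrightarrow>
     (\<exists>F. (\<forall>f\<in>F. \<exists>T\<in>\<T>. f face_of T \<and> aff_dim f = int DIM('a) - 1) \<and> \<gamma> = \<Union>F)"

definition red_refinement ::
  "'a::euclidean_space set \<Rightarrow> 'a set set \<Rightarrow> 'a set set \<Rightarrow> bool" where
  "red_refinement \<Omega> \<T> \<S> \<longleftrightarrow> simplicial_partition \<Omega> \<S> \<and> (\<forall>S\<in>\<S>. \<exists>T\<in>\<T>. S \<subseteq> T) \<and>
     (\<forall>T\<in>\<T>. let \<C> = {S\<in>\<S>. S \<subseteq> T} in
        \<Union>\<C> = T \<and> card \<C> = 2 ^ DIM('a) \<and>
        (\<forall>S\<in>\<C>. measure lebesgue S = measure lebesgue T / 2 ^ DIM('a)) \<and>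
        (\<forall>\<nu>. \<nu> extreme_point_of T \<longrightarrow>
           {S\<in>\<C>. \<nu> \<in> S} = {(\<lambda>x. \<nu> + (1/2) *\<^sub>R (x - \<nu>)) ` T}))"

section \<open>The functions and spaces attached to a partition\<close>

text \<open>\<open>h\<^sub>\<T>\<close>, given the value \<open>0\<close> on the null set where no interior of a simplex is met.\<close>

definition mesh_size :: "'a::euclidean_space set set \<Rightarrow> 'a \<Rightarrow> real" where
  "mesh_size \<T> x = (\<Sum>T\<in>\<T>. simplex_size T * indicator (interior T) x)"

definition free_vertices :: "'a::euclidean_space set \<Rightarrow> 'a set set \<Rightarrow> 'a set" where
  "free_vertices \<gamma> \<T> = {\<nu>. \<exists>T\<in>\<T>. \<nu> extreme_point_of T} - \<gamma>"

definition patch :: "'a::euclidean_space set set \<Rightarrow> 'a \<Rightarrow> 'a set" where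
  "patch \<S> \<nu> = \<Union>{T\<in>\<S>. \<nu> \<in> T}"

definition psi :: "'a::euclidean_space set set \<Rightarrow> 'a set set \<Rightarrow> 'a \<Rightarrow> 'a \<Rightarrow> real" where
  "psi \<T> \<S> \<nu> x = 2 ^ (DIM('a) + 1) * indicator (patch \<S> \<nu>) x - indicator (patch \<T> \<nu>) x"

definition U_space :: "'a::euclidean_space set \<Rightarrow> 'a set set \<Rightarrow> ('a \<Rightarrow> real) set" where
  "U_space \<Omega> \<T> = {u \<in> L2 \<Omega>. \<forall>T\<in>\<T>. \<exists>c. AE x in lebesgue_on \<Omega>. x \<in> T \<longrightarrow> u x = c}"

definition Q :: "'a::euclidean_space set \<Rightarrow> 'a set set \<Rightarrow> ('a \<Rightarrow> real) \<Rightarrow> 'a \<Rightarrow> real" where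
  "Q \<Omega> \<T> = l2_proj \<Omega> (U_space \<Omega> \<T>)"

definition theta ::
  "'a::euclidean_space set \<Rightarrow> 'a set set \<Rightarrow> 'a set set \<Rightarrow> 'a \<Rightarrow> 'a \<Rightarrow> real" where
  "theta \<Omega> \<T> \<S> \<nu> x = psi \<T> \<S> \<nu> x - Q \<Omega> \<T> (psi \<T> \<S> \<nu>) x"

definition W_space ::
  "'a::euclidean_space set \<Rightarrow> 'a set \<Rightarrow> 'a set set \<Rightarrow> 'a set set \<Rightarrow> ('a \<Rightarrow> real) set" where
  "W_space \<Omega> \<gamma> \<T> \<S> = l2_span \<Omega> (free_vertices \<gamma> \<T>) (psi \<T> \<S>)"

definition B_space ::
  "'a::euclidean_space set \<Rightarrow> 'a set \<Rightarrow> 'a set set \<Rightarrow> 'a set set \<Rightarrow> ('a \<Rightarrow> real) set" where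
  "B_space \<Omega> \<gamma> \<T> \<S> = l2_span \<Omega> (free_vertices \<gamma> \<T>) (theta \<Omega> \<T> \<S>)"

definition Z_space ::
  "'a::euclidean_space set \<Rightarrow> 'a set \<Rightarrow> 'a set set \<Rightarrow> 'a set set \<Rightarrow> ('a \<Rightarrow> real) set" where
  "Z_space \<Omega> \<gamma> \<T> \<S> = l2_sum \<Omega> (U_space \<Omega> \<T>) (B_space \<Omega> \<gamma> \<T> \<S>)"

end

theory Submission
  imports Defs
begin

text \<open>
  On a simplex \<open>T\<close> with \<open>n = 2\<^sup>d\<close> children, \<open>\<theta>\<^sub>\<nu>\<close> is \<open>2n - 2\<close> on the child at the corner \<open>\<nu>\<close> and \<open>-2\<close> on
  the other children, whence
  \<open>\<parallel>\<Sum> c\<^sub>\<nu> \<theta>\<^sub>\<nu>\<parallel>\<^sup>2 = 4 |T| (n \<Sum> c\<^sub>\<nu>\<^sup>2 - (\<Sum> c\<^sub>\<nu>)\<^sup>2)\<close> on \<open>T\<close>.  As \<open>T\<close> has at most \<open>d + 1\<close> vertices and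
  \<open>d + 1 < n\<close> for \<open>d \<ge> 2\<close>, the Cauchy-Schwarz inequality gives the stability of the basis, element by
  element.

  The estimate (1) is the Poincare inequality on simplices.  For a fixed shift \<open>h\<close>, the map
  \<open>t \<mapsto> \<integral> w(x) \<phi>(x - t h) dx\<close> has a derivative expressed by the weak gradient, so by duality with test
  functions the \<open>L\<^sub>2\<close>-norm of \<open>w(\<cdot> + h) - w\<close> is at most \<open>|h|\<close> times that of the gradient; integrating over
  \<open>h\<close> bounds \<open>\<integral>\<integral> |w(x) - w(y)|\<^sup>2\<close>, with no smoothing of \<open>w\<close>.

  For (3), \<open>z\<close> is piecewise constant on the red-refinement, and is tested with the sum of bumps of height
  \<open>z|\<^sub>S q\<^sub>S\<^sup>2\<close>, supported in balls of radius \<open>q\<^sub>S\<close> inside the subsimplices \<open>S\<close>.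
\<close>

section \<open>Square integrable functions\<close>

text \<open>The factor \<open>2 ^ (d + 1)\<close> gives \<open>\<psi>\<^sub>\<nu>\<close> mean 1 on
  each simplex at a free vertex \<open>\<nu>\<close>: one child in \<open>n = 2 ^ d\<close> has the
  value \<open>2n - 1\<close>, the others -1. For d = 1 the quadratic form on an interval with two
  free vertices is \<open>2 (a\<^sup>2 + b\<^sup>2) - (a + b)\<^sup>2 = (a - b)\<^sup>2\<close>,
  which vanishes for a = b; hence the lower bound of (c) and the independence are asserted for d
  \<ge> 2 only. Projector, adjoint and weak gradient are choices determined up to null sets.
  Functions on a partition are therefore replaced almost everywhere by coefficient functions
  \<open>pc\<close>, after which every identity is one between finite sums. Slit domains are
  allowed, so no extension of \<open>w\<close> across the boundary is used: in the translation
  argument it is the test function that moves, and convexity of the simplex keeps its support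
  inside. In (3) the height \<open>q\<^sub>S\<^sup>2\<close> balances two scalings: the pairing with
  \<open>z\<close> is bounded below, and the squared H^1 norm of the test function bounded above, by
  multiples of the same squared norm of \<open>h z\<close>. The bumps sit inside open simplices, so
  they vanish near \<gamma>.\<close>

lemma L2_I: "f \<in> borel_measurable (lebesgue_on X) \<Longrightarrow> integrable (lebesgue_on X) (\<lambda>x. (f x)\<^sup>2) \<Longrightarrow> f \<in> L2 X"
  by (simp add: L2_def)

lemma L2_measurable [measurable_dest]: "f \<in> L2 X \<Longrightarrow> f \<in> borel_measurable (lebesgue_on X)"
  by (simp add: L2_def)

lemma L2_square_integrable: "f \<in> L2 X \<Longrightarrow> integrable (lebesgue_on X) (\<lambda>x. (f x)\<^sup>2)"
  by (simp add: L2_def)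

lemma L2_integrable_mult:
  assumes "f \<in> L2 X" "g \<in> L2 X"
  shows "integrable (lebesgue_on X) (\<lambda>x. f x * g x)"
proof (rule Bochner_Integration.integrable_bound)
  show "integrable (lebesgue_on X) (\<lambda>x. (f x)\<^sup>2 + (g x)\<^sup>2)"
    using assms by (intro Bochner_Integration.integrable_add L2_square_integrable)
  show "(\<lambda>x. f x * g x) \<in> borel_measurable (lebesgue_on X)"
    using assms[THEN L2_measurable] by simp
  have "\<bar>f x * g x\<bar> \<le> \<bar>(f x)\<^sup>2 + (g x)\<^sup>2\<bar>" for x
  proof -
    have "0 \<le> \<bar>f x\<bar> * \<bar>g x\<bar>" by simp
    then have "\<bar>f x\<bar> * \<bar>g x\<bar> \<le> (f x)\<^sup>2 + (g x)\<^sup>2"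
      using sum_squares_bound[of "\<bar>f x\<bar>" "\<bar>g x\<bar>"] unfolding power2_abs by linarith
    then show ?thesis by (simp add: abs_mult)
  qed
  then show "AE x in lebesgue_on X. norm (f x * g x) \<le> norm ((f x)\<^sup>2 + (g x)\<^sup>2)"
    by simp
qed

lemma L2_add: assumes "f \<in> L2 X" "g \<in> L2 X" shows "(\<lambda>x. f x + g x) \<in> L2 X"
proof (rule L2_I)
  show "(\<lambda>x. f x + g x) \<in> borel_measurable (lebesgue_on X)"
    using assms[THEN L2_measurable] by simp
  have "integrable (lebesgue_on X) (\<lambda>x. (f x)\<^sup>2 + (g x)\<^sup>2 + 2 * (f x * g x))"
    using assms by (intro Bochner_Integration.integrable_add L2_square_integrable integrable_mult_right L2_integrable_mult)
  then show "integrable (lebesgue_on X) (\<lambda>x. (f x + g x)\<^sup>2)"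
    by (simp add: power2_sum mult.assoc)
qed

lemma L2_cmult: assumes "f \<in> L2 X" shows "(\<lambda>x. a * f x) \<in> L2 X"
proof (rule L2_I)
  show "(\<lambda>x. a * f x) \<in> borel_measurable (lebesgue_on X)"
    using assms[THEN L2_measurable] by simp
  show "integrable (lebesgue_on X) (\<lambda>x. (a * f x)\<^sup>2)"
    using assms by (auto simp: power_mult_distrib intro: L2_square_integrable)
qed

lemma L2_zero [simp]: "(\<lambda>x. 0) \<in> L2 X"
  by (simp add: L2_def)

lemma L2_diff: assumes "f \<in> L2 X" "g \<in> L2 X" shows "(\<lambda>x. f x - g x) \<in> L2 X"
  using L2_add[OF assms(1) L2_cmult[OF assms(2), of "-1"]] by simp

lemma L2_sum: "(\<And>i. i \<in> I \<Longrightarrow> f i \<in> L2 X) \<Longrightarrow> (\<lambda>x. \<Sum>i\<in>I. f i x) \<in> L2 X"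
  by (induction I rule: infinite_finite_induct) (auto intro: L2_add)

text \<open>For the reciprocal of the mesh size, which on a single partition is a bounded
  multiplier.\<close>

lemma L2_bounded_mult:
  assumes "f \<in> L2 X" and m: "g \<in> borel_measurable (lebesgue_on X)"
    and "\<And>x. \<bar>g x\<bar> \<le> B"
  shows "(\<lambda>x. g x * f x) \<in> L2 X"
proof (rule L2_I)
  show "(\<lambda>x. g x * f x) \<in> borel_measurable (lebesgue_on X)"
    using assms(1)[THEN L2_measurable] m by simp
  show "integrable (lebesgue_on X) (\<lambda>x. (g x * f x)\<^sup>2)"
  proof (rule Bochner_Integration.integrable_bound)
    show "integrable (lebesgue_on X) (\<lambda>x. B\<^sup>2 * (f x)\<^sup>2)"
      using assms(1) by (intro integrable_mult_right L2_square_integrable)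
    show "(\<lambda>x. (g x * f x)\<^sup>2) \<in> borel_measurable (lebesgue_on X)"
      using assms(1)[THEN L2_measurable] m by simp
    have "(g x)\<^sup>2 \<le> B\<^sup>2" for x
      using power_mono[OF assms(3)[of x], of 2] by simp
    then show "AE x in lebesgue_on X. norm ((g x * f x)\<^sup>2) \<le> norm (B\<^sup>2 * (f x)\<^sup>2)"
      by (auto simp: power_mult_distrib intro!: mult_right_mono)
  qed
qed

lemma finite_measure_lebesgue_on:
  "X \<in> lmeasurable \<Longrightarrow> finite_measure (lebesgue_on X)"
  by (auto intro!: finite_measureI simp: emeasure_restrict_space fmeasurable_def space_restrict_space)

lemma L2_bounded:
  assumes "X \<in> lmeasurable" and m: "g \<in> borel_measurable (lebesgue_on X)"
    and "\<And>x. x \<in> X \<Longrightarrow> \<bar>g x\<bar> \<le> B"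
  shows "g \<in> L2 X"
proof (rule L2_I[OF m])
  interpret finite_measure "lebesgue_on X" using assms(1) by (rule finite_measure_lebesgue_on)
  have "(g x)\<^sup>2 \<le> B\<^sup>2" if "x \<in> X" for x
    using power_mono[OF assms(3)[of x], of 2] that by simp
  then show "integrable (lebesgue_on X) (\<lambda>x. (g x)\<^sup>2)"
    using m by (intro integrable_const_bound[where B="B\<^sup>2"] AE_I2) auto
qed

lemma L2_integrable:
  assumes "X \<in> lmeasurable" "f \<in> L2 X"
  shows "integrable (lebesgue_on X) f"
  using L2_integrable_mult[OF assms(2) L2_bounded[OF assms(1), of "\<lambda>x. 1" 1]] by simp

lemma L2_ae_cong:
  assumes "f \<in> L2 X" "ae_eq X f g" "g \<in> borel_measurable (lebesgue_on X)"
  shows "g \<in> L2 X"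
proof (rule L2_I[OF assms(3)])
  have "integrable (lebesgue_on X) (\<lambda>x. (f x)\<^sup>2) = integrable (lebesgue_on X) (\<lambda>x. (g x)\<^sup>2)"
    by (rule integrable_cong_AE) (use assms in \<open>auto dest: L2_measurable\<close>)
  then show "integrable (lebesgue_on X) (\<lambda>x. (g x)\<^sup>2)"
    using assms(1) by (simp add: L2_square_integrable)
qed

section \<open>Inner product and norm of L_2\<close>

lemma l2_inner_commute: "l2_inner X f g = l2_inner X g f"
  by (simp add: l2_inner_def mult.commute)

lemma l2_inner_add_left:
  "f \<in> L2 X \<Longrightarrow> g \<in> L2 X \<Longrightarrow> h \<in> L2 X \<Longrightarrow>
    l2_inner X (\<lambda>x. f x + g x) h = l2_inner X f h + l2_inner X g h"
  unfolding l2_inner_def by (simp add: distrib_right L2_integrable_mult)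

lemma l2_inner_diff_left:
  "f \<in> L2 X \<Longrightarrow> g \<in> L2 X \<Longrightarrow> h \<in> L2 X \<Longrightarrow>
    l2_inner X (\<lambda>x. f x - g x) h = l2_inner X f h - l2_inner X g h"
  unfolding l2_inner_def by (simp add: left_diff_distrib L2_integrable_mult)

lemma l2_inner_add_right:
  "f \<in> L2 X \<Longrightarrow> g \<in> L2 X \<Longrightarrow> h \<in> L2 X \<Longrightarrow>
    l2_inner X h (\<lambda>x. f x + g x) = l2_inner X h f + l2_inner X h g"
  unfolding l2_inner_def by (simp add: distrib_left L2_integrable_mult)

lemma l2_inner_diff_right:
  "f \<in> L2 X \<Longrightarrow> g \<in> L2 X \<Longrightarrow> h \<in> L2 X \<Longrightarrow>
    l2_inner X h (\<lambda>x. f x - g x) = l2_inner X h f - l2_inner X h g"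
  unfolding l2_inner_def by (simp add: right_diff_distrib L2_integrable_mult)

lemma l2_inner_cmult_left:
  "l2_inner X (\<lambda>x. a * f x) h = a * l2_inner X f h"
  unfolding l2_inner_def by (simp add: mult.assoc)

lemma l2_inner_cmult_right:
  "l2_inner X h (\<lambda>x. a * f x) = a * l2_inner X h f"
  using l2_inner_cmult_left[of X a f h] by (simp add: l2_inner_commute[of X h])

lemma l2_inner_sum_left:
  assumes "\<And>i. i \<in> I \<Longrightarrow> f i \<in> L2 X" "h \<in> L2 X"
  shows "l2_inner X (\<lambda>x. \<Sum>i\<in>I. f i x) h = (\<Sum>i\<in>I. l2_inner X (f i) h)"
  unfolding l2_inner_def sum_distrib_right
  by (rule Bochner_Integration.integral_sum) (use assms in \<open>auto intro: L2_integrable_mult\<close>)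

lemma l2_inner_ae_cong:
  assumes "ae_eq X f f'" "ae_eq X g g'"
    "f \<in> borel_measurable (lebesgue_on X)" "f' \<in> borel_measurable (lebesgue_on X)"
    "g \<in> borel_measurable (lebesgue_on X)" "g' \<in> borel_measurable (lebesgue_on X)"
  shows "l2_inner X f g = l2_inner X f' g'"
  unfolding l2_inner_def
proof (rule integral_cong_AE)
  show "AE x in lebesgue_on X. f x * g x = f' x * g' x"
    using assms(1,2) by eventually_elim simp
qed (use assms in auto)

lemma l2_norm_ae_cong:
  assumes "ae_eq X f f'" "f \<in> borel_measurable (lebesgue_on X)" "f' \<in> borel_measurable (lebesgue_on X)"
  shows "l2_norm X f = l2_norm X f'"
  unfolding l2_norm_def using assms by (simp add: l2_inner_ae_cong[OF assms(1,1)])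

lemma l2_inner_self_nonneg: "0 \<le> l2_inner X f f"
  by (simp add: l2_inner_def)

lemma l2_norm_nonneg [simp]: "0 \<le> l2_norm X f"
  by (simp add: l2_norm_def l2_inner_self_nonneg)

lemma l2_norm_square: "(l2_norm X f)\<^sup>2 = l2_inner X f f"
  by (simp add: l2_norm_def l2_inner_self_nonneg)

lemma l2_norm_square_integral: "(l2_norm X f)\<^sup>2 = (LINT x|lebesgue_on X. (f x)\<^sup>2)"
  by (subst l2_norm_square) (simp add: l2_inner_def power2_eq_square)

lemma l2_norm_cmult: "l2_norm X (\<lambda>x. a * f x) = \<bar>a\<bar> * l2_norm X f"
  by (simp add: l2_norm_def l2_inner_cmult_left l2_inner_cmult_right real_sqrt_mult flip: mult.assoc)

lemma l2_norm_zero [simp]: "l2_norm X (\<lambda>x. 0) = 0"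
  by (simp add: l2_norm_def l2_inner_def)

lemma l2_norm_eq_0_imp_ae:
  assumes "f \<in> L2 X" "l2_norm X f = 0"
  shows "ae_eq X f (\<lambda>x. 0)"
proof -
  have "(LINT x|lebesgue_on X. (f x)\<^sup>2) = 0"
    using assms(2) by (simp flip: l2_norm_square_integral)
  then have "AE x in lebesgue_on X. (f x)\<^sup>2 = 0"
    using integral_nonneg_eq_0_iff_AE[OF L2_square_integrable[OF assms(1)]] by simp
  then show ?thesis by simp
qed

lemma l2_cauchy_schwarz:
  assumes "f \<in> L2 X" "g \<in> L2 X"
  shows "\<bar>l2_inner X f g\<bar> \<le> l2_norm X f * l2_norm X g"
proof (cases "l2_norm X g = 0")
  case True
  then have "ae_eq X g (\<lambda>x. 0)" using assms by (simp add: l2_norm_eq_0_imp_ae)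
  then have "l2_inner X f g = l2_inner X f (\<lambda>x. 0)"
    using assms by (intro l2_inner_ae_cong) (auto dest: L2_measurable)
  with True show ?thesis by (simp add: l2_inner_def)
next
  case False
  define B where "B = l2_inner X g g"
  define I where "I = l2_inner X f g"
  define A where "A = l2_inner X f f"
  have B: "B > 0" using False l2_norm_square[of X g] unfolding B_def
    by (metis less_le l2_inner_self_nonneg l2_norm_def real_sqrt_zero)
  \<comment> \<open>The minimiser of the squared norm of \<open>f - t g\<close> over real
    \<open>t\<close>.\<close>
  define t where "t = I / B"
  have tg: "(\<lambda>x. t * g x) \<in> L2 X" using assms by (simp add: L2_cmult)
  have "0 \<le> l2_inner X (\<lambda>x. f x - t * g x) (\<lambda>x. f x - t * g x)"
    by (rule l2_inner_self_nonneg)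
  also have "\<dots> = l2_inner X f (\<lambda>x. f x - t * g x) - l2_inner X (\<lambda>x. t * g x) (\<lambda>x. f x - t * g x)"
    using assms tg by (intro l2_inner_diff_left L2_diff)
  also have "\<dots> = A - t * I - t * (I - t * B)"
    using assms tg unfolding A_def B_def I_def
    by (simp add: l2_inner_diff_right l2_inner_cmult_left l2_inner_cmult_right L2_diff l2_inner_commute[of _ g f])
  also have "\<dots> = A - I\<^sup>2 / B"
    using B by (simp add: t_def field_simps power2_eq_square)
  finally have "I\<^sup>2 \<le> A * B" using B by (simp add: field_simps)
  then have "I\<^sup>2 \<le> (l2_norm X f * l2_norm X g)\<^sup>2"
    by (simp add: A_def B_def power_mult_distrib l2_norm_square)
  then show ?thesis unfolding I_def
    by (simp add: abs_le_square_iff[symmetric] abs_mult)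
qed

lemma l2_norm_pythagoras:
  assumes "f \<in> L2 X" "g \<in> L2 X" "l2_inner X f g = 0"
  shows "(l2_norm X (\<lambda>x. f x + g x))\<^sup>2 = (l2_norm X f)\<^sup>2 + (l2_norm X g)\<^sup>2"
  using assms unfolding l2_norm_square
  by (simp add: l2_inner_add_left l2_inner_add_right L2_add l2_inner_commute[of _ g f])

lemma ae_eq_trans: "ae_eq X f g \<Longrightarrow> ae_eq X g h \<Longrightarrow> ae_eq X f h"
  by (erule (1) AE_mp[OF _ AE_mp]) auto

lemma ae_eq_sym: "ae_eq X f g \<Longrightarrow> ae_eq X g f"
  by auto

section \<open>Test functions\<close>

text \<open>By uniqueness of derivatives an explicit \<open>D\<close> may replace
  \<open>frechet_derivative\<close>. Each closure property below is then an induction on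
  \<open>k\<close> that applies one differentiation rule.\<close>

lemma C_k_Suc_I:
  assumes "\<And>x. (f has_derivative D x) (at x)" "\<And>b. b \<in> Basis \<Longrightarrow> C_k k (\<lambda>x. D x b)"
  shows "C_k (Suc k) f"
proof -
  have "frechet_derivative f (at x) = D x" for x
    using frechet_derivative_at[OF assms(1)] by simp
  then show ?thesis using assms by (auto simp: differentiable_def)
qed

lemma C_k_Suc_has_derivative:
  "C_k (Suc k) f \<Longrightarrow> (f has_derivative frechet_derivative f (at x)) (at x)"
  by (simp flip: frechet_derivative_works)

lemma C_k_Suc_partial: "C_k (Suc k) f \<Longrightarrow> b \<in> Basis \<Longrightarrow> C_k k (\<lambda>x. frechet_derivative f (at x) b)"
  by simp

lemma C_k_Suc_D: "C_k (Suc k) f \<Longrightarrow> C_k k f"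
proof (induction k arbitrary: f)
  case 0
  then show ?case
    by (auto intro!: differentiable_imp_continuous_on simp: differentiable_on_def intro: differentiable_at_withinI)
next
  case (Suc k)
  show ?case
    by (rule C_k_Suc_I[OF C_k_Suc_has_derivative[OF Suc.prems]])
       (rule Suc.IH[OF C_k_Suc_partial[OF Suc.prems]])
qed

lemma C_k_continuous: "C_k k f \<Longrightarrow> continuous_on UNIV f"
  by (induction k) (auto dest: C_k_Suc_D simp del: C_k.simps(2))

lemma C_k_const: "C_k k (\<lambda>x. c)"
proof (induction k arbitrary: c)
  case (Suc k)
  show ?case by (rule C_k_Suc_I[where D="\<lambda>x h. 0"]) (auto intro: Suc)
qed simp

lemma C_k_add: "C_k k f \<Longrightarrow> C_k k g \<Longrightarrow> C_k k (\<lambda>x. f x + g x)"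
proof (induction k arbitrary: f g)
  case 0 then show ?case by (auto intro: continuous_intros)
next
  case (Suc k)
  show ?case
    by (rule C_k_Suc_I[OF has_derivative_add[OF Suc.prems[THEN C_k_Suc_has_derivative]]])
       (rule Suc.IH[OF Suc.prems[THEN C_k_Suc_partial]])
qed

lemma C_k_mult: "C_k k f \<Longrightarrow> C_k k g \<Longrightarrow> C_k k (\<lambda>x. f x * g x :: real)"
proof (induction k arbitrary: f g)
  case 0 then show ?case by (auto intro: continuous_intros)
next
  case (Suc k)
  show ?case
    by (rule C_k_Suc_I[OF has_derivative_mult[OF Suc.prems[THEN C_k_Suc_has_derivative]]])
       (intro C_k_add Suc.IH Suc.prems[THEN C_k_Suc_partial] Suc.prems[THEN C_k_Suc_D])
qed

lemma C_k_sum: "(\<And>i. i \<in> I \<Longrightarrow> C_k k (f i)) \<Longrightarrow> C_k k (\<lambda>x. \<Sum>i\<in>I. f i x)"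
  by (induction I rule: infinite_finite_induct) (auto intro: C_k_add C_k_const simp del: C_k.simps)

lemma C_k_prod: "(\<And>i. i \<in> I \<Longrightarrow> C_k k (f i)) \<Longrightarrow> C_k k (\<lambda>x. \<Prod>i\<in>I. f i x)"
  by (induction I rule: infinite_finite_induct) (auto intro: C_k_mult C_k_const simp del: C_k.simps)

lemma C_k_exp: "C_k k f \<Longrightarrow> C_k k (\<lambda>x. exp (f x))"
proof (induction k arbitrary: f)
  case 0 then show ?case by (auto intro: continuous_intros)
next
  case (Suc k)
  have d: "((\<lambda>x. exp (f x)) has_derivative (\<lambda>h. exp (f x) * frechet_derivative f (at x) h)) (at x)" for x
    using has_derivative_exp[OF C_k_Suc_has_derivative[OF Suc.prems]] by (simp add: mult.commute)
  show ?case
    by (rule C_k_Suc_I[OF d])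
       (intro C_k_mult Suc.IH Suc.prems[THEN C_k_Suc_partial] Suc.prems[THEN C_k_Suc_D])
qed

lemma C_k_bounded_linear: assumes "bounded_linear f" shows "C_k k f"
proof (cases k)
  case 0 then show ?thesis using assms by (simp add: linear_continuous_on)
next
  case (Suc m)
  then show ?thesis using C_k_Suc_I[OF bounded_linear_imp_has_derivative[OF assms] C_k_const] by simp
qed

lemma C_k_real_polynomial_function: "real_polynomial_function p \<Longrightarrow> C_k k p"
  by (induction p rule: real_polynomial_function.induct)
     (auto intro: C_k_bounded_linear C_k_const C_k_add C_k_mult simp del: C_k.simps)

text \<open>The extra powers in the denominator make the family closed under differentiation.\<close>

definition flat_exp :: "nat \<Rightarrow> real \<Rightarrow> real" where
  "flat_exp n t = (if 0 < t then exp (- inverse t) * inverse t ^ n else 0)"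

lemma flat_exp_tendsto_0: "(flat_exp n \<longlongrightarrow> 0) (at 0)"
proof -
  have "((\<lambda>t. inverse t ^ n / exp (inverse t)) \<longlongrightarrow> (0::real)) (at_right 0)"
    by (rule filterlim_compose[OF tendsto_power_div_exp_0 filterlim_inverse_at_top_right])
  then have r: "(flat_exp n \<longlongrightarrow> 0) (at_right 0)"
    by (rule Lim_transform_eventually)
       (auto simp: eventually_at_filter flat_exp_def exp_minus field_simps)
  have l: "(flat_exp n \<longlongrightarrow> 0) (at_left 0)"
    by (rule Lim_transform_eventually[OF tendsto_const])
       (auto simp: eventually_at_filter flat_exp_def)
  show ?thesis using l r by (simp add: filterlim_split_at)
qed

lemma flat_exp_has_derivative:
  "(flat_exp n has_real_derivative flat_exp (n + 2) t - real n * flat_exp (n + 1) t) (at t)"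
proof -
  consider "t < 0" | "t = 0" | "t > 0" by linarith
  then show ?thesis
  proof cases
    case 1
    have "((\<lambda>t. 0) has_real_derivative 0) (at t)" by simp
    then have "(flat_exp n has_real_derivative 0) (at t)"
      by (rule has_field_derivative_transform_within_open[where S="{..<0}"])
         (use 1 in \<open>auto simp: flat_exp_def\<close>)
    then show ?thesis using 1 by (simp add: flat_exp_def)
  next
    case 2
    \<comment> \<open>Away from 0 the difference quotient at 0 is \<open>flat_exp (n + 1)\<close>
      itself.\<close>
    have "((\<lambda>h. (flat_exp n (0 + h) - flat_exp n 0) / h) \<longlongrightarrow> 0) (at 0)"
      by (rule Lim_transform_eventually[OF flat_exp_tendsto_0[of "n+1"]])
         (auto simp: flat_exp_def eventually_at_filter field_simps)
    then show ?thesis unfolding 2 by (simp add: DERIV_def flat_exp_def)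
  next
    case 3
    have e: "((\<lambda>t. exp (- inverse t)) has_real_derivative exp (- inverse t) * inverse t ^ 2) (at t)"
      using 3 by (auto intro!: derivative_eq_intros simp: power2_eq_square)
    have i: "((\<lambda>t. inverse t ^ n) has_real_derivative - real n * inverse t ^ (n + 1)) (at t)"
    proof (cases n)
      case (Suc m)
      show ?thesis
        using DERIV_power[OF DERIV_inverse[of t], of n] 3 unfolding Suc
        by (simp add: algebra_simps flip: power_Suc power_add)
    qed simp
    have "((\<lambda>t. exp (- inverse t) * inverse t ^ n) has_real_derivative
        flat_exp (n + 2) t - real n * flat_exp (n + 1) t) (at t)"
      using DERIV_mult[OF e i] 3 by (simp add: flat_exp_def power2_eq_square algebra_simps)
    then show ?thesis
      by (rule has_field_derivative_transform_within_open[where S="{0<..}"])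
         (use 3 in \<open>auto simp: flat_exp_def\<close>)
  qed
qed

text \<open>The induction keeps \<open>n\<close> arbitrary because each derivative raises it by 1
  and by 2.\<close>

lemma C_k_flat_exp: "C_k k (\<lambda>x. flat_exp n (x \<bullet> v + c))"
proof -
  have d: "((\<lambda>x. flat_exp n (x \<bullet> v + c)) has_derivative
      (\<lambda>h. (flat_exp (n + 2) (x \<bullet> v + c) + (- real n) * flat_exp (n + 1) (x \<bullet> v + c)) * (h \<bullet> v))) (at x)" for n x
  proof -
    have "((\<lambda>x. x \<bullet> v + c) has_derivative (\<lambda>h. h \<bullet> v)) (at x)"
      by (auto intro!: derivative_eq_intros)
    from has_derivative_compose[OF this flat_exp_has_derivative[of n "x \<bullet> v + c", unfolded has_field_derivative_def]]
    show ?thesis by simp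
  qed
  show ?thesis
  proof (induction k arbitrary: n)
    case 0
    show ?case using has_derivative_continuous_on[OF has_derivative_at_withinI[OF d]] by simp
  next
    case (Suc k)
    show ?case by (rule C_k_Suc_I[OF d]) (intro C_k_mult C_k_add C_k_const Suc)
  qed
qed

text \<open>Smooth, positive on the open box and zero off the closed one. The sums with negated
  terms bring each factor to the affine form \<open>x \<bullet> v + c\<close> of
  \<open>C_k_flat_exp\<close>.\<close>

definition box_bump :: "'a::euclidean_space \<Rightarrow> 'a \<Rightarrow> 'a \<Rightarrow> real" where
  "box_bump a b x = (\<Prod>i\<in>Basis. flat_exp 0 (x \<bullet> i + - (a \<bullet> i)) * flat_exp 0 (x \<bullet> (- i) + b \<bullet> i))"

lemma C_k_box_bump: "C_k k (box_bump a b)"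
  unfolding box_bump_def by (intro C_k_prod C_k_mult C_k_flat_exp)

lemma box_bump_nonneg: "0 \<le> box_bump a b x"
  unfolding box_bump_def by (intro prod_nonneg) (auto simp: flat_exp_def)

lemma box_bump_pos: "x \<in> box a b \<Longrightarrow> 0 < box_bump a b x"
  unfolding box_bump_def by (intro prod_pos) (auto simp: flat_exp_def mem_box)

lemma box_bump_eq_0: "x \<notin> cbox a b \<Longrightarrow> box_bump a b x = 0"
proof -
  assume "x \<notin> cbox a b"
  then obtain i where "i \<in> Basis" "x \<bullet> i < a \<bullet> i \<or> b \<bullet> i < x \<bullet> i"
    by (auto simp: mem_box not_le)
  then show ?thesis
    unfolding box_bump_def by (intro prod_zero bexI[of _ i]) (auto simp: flat_exp_def)
qed

lemma test_functionI:
  assumes "\<And>k. C_k k \<phi>" "compact K" "K \<subseteq> U" "\<And>x. x \<notin> K \<Longrightarrow> \<phi> x = 0"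
  shows "test_function U \<phi>"
proof -
  have "closure {x. \<phi> x \<noteq> 0} \<subseteq> K"
    by (rule closure_minimal) (use assms in \<open>auto intro: compact_imp_closed\<close>)
  moreover from this have "compact (closure {x. \<phi> x \<noteq> 0})"
    using assms(2) compact_Int_closed[of K "closure {x. \<phi> x \<noteq> 0}"] by (simp add: Int_absorb1)
  ultimately show ?thesis using assms unfolding test_function_def by auto
qed

lemma test_functionE:
  assumes "test_function U \<phi>"
  obtains K where "\<And>k. C_k k \<phi>" "compact K" "K \<subseteq> U" "\<And>x. x \<notin> K \<Longrightarrow> \<phi> x = 0"
proof (rule that[of "closure {x. \<phi> x \<noteq> 0}"])
  show "\<phi> x = 0" if "x \<notin> closure {x. \<phi> x \<noteq> 0}" for x
    using that closure_subset[of "{x. \<phi> x \<noteq> 0}"] by auto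
qed (use assms in \<open>auto simp: test_function_def\<close>)

section \<open>Smooth cutoffs of an open set\<close>

lemma open_covered_by_cboxes:
  fixes U :: "'a::euclidean_space set"
  assumes "open U"
  obtains a b :: "nat \<Rightarrow> 'a" where "\<And>n. cbox (a n) (b n) \<subseteq> U" "U \<subseteq> (\<Union>n. cbox (a n) (b n))"
proof -
  obtain D where D: "countable D" "D \<subseteq> Pow U" "\<And>X. X \<in> D \<Longrightarrow> \<exists>a b. X = cbox a b" "\<Union>D = U"
    by (rule open_countable_Union_open_cbox[OF assms]) (rule that)
  show thesis
  proof (cases "D = {}")
    case True
    then have "U = {}" using D by auto
    \<comment> \<open>There is no box to enumerate; the interval from \<open>One\<close> to 0 is an
      empty one.\<close>
    then show thesis using that[of "\<lambda>_. One" "\<lambda>_. 0"] by (auto simp: box_eq_empty ex_in_conv)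
  next
    case False
    have "\<exists>a b. from_nat_into D n = cbox a b" for n
      using D(3)[OF from_nat_into[OF False]] .
    then have "\<forall>n. \<exists>a b. from_nat_into D n = cbox a b" by blast
    then obtain a b where ab: "\<And>n. from_nat_into D n = cbox (a n) (b n)"
      unfolding choice_iff by blast
    show thesis
    proof (rule that[of a b])
      show "cbox (a n) (b n) \<subseteq> U" for n
        using from_nat_into[OF False, of n] D(2) ab by auto
      have "range (from_nat_into D) = D" using False D(1) by (rule range_from_nat_into)
      then show "U \<subseteq> (\<Union>n. cbox (a n) (b n))" using D(4) ab by auto
    qed
  qed
qed

text \<open>With \<open>\<sigma> n\<close> the sum of the first \<open>n\<close> bumps,
  \<open>1 - exp (- n \<sigma> n)\<close> vanishes where all these bumps do, stays between 0 and 1,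
  and tends to 1 wherever some bump of the sequence is positive. Only points on the faces of the
  boxes can escape this, whence the almost everywhere.\<close>

lemma exists_cutoffs:
  fixes U :: "'a::euclidean_space set"
  assumes "open U"
  obtains \<zeta> :: "nat \<Rightarrow> 'a \<Rightarrow> real" where "\<And>n. test_function U (\<zeta> n)" "\<And>n x. 0 \<le> \<zeta> n x" "\<And>n x. \<zeta> n x \<le> 1"
    "AE x in lebesgue. x \<in> U \<longrightarrow> (\<lambda>n. \<zeta> n x) \<longlonglongrightarrow> 1"
proof -
  obtain a b :: "nat \<Rightarrow> 'a" where ab: "\<And>n. cbox (a n) (b n) \<subseteq> U" "U \<subseteq> (\<Union>n. cbox (a n) (b n))"
    by (rule open_covered_by_cboxes[OF assms]) (rule that)
  define \<sigma> where "\<sigma> n x = (\<Sum>i<n. box_bump (a i) (b i) x)" for n :: nat and x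
  define \<zeta> where "\<zeta> n x = 1 + (- 1) * exp ((- real n) * \<sigma> n x)" for n x
  have \<sigma>: "0 \<le> \<sigma> n x" for n x unfolding \<sigma>_def by (intro sum_nonneg box_bump_nonneg)
  show thesis
  proof (rule that[of \<zeta>])
    fix n
    show "test_function U (\<zeta> n)"
    proof (rule test_functionI)
      show "C_k k (\<zeta> n)" for k unfolding \<zeta>_def \<sigma>_def
        by (intro C_k_add C_k_mult C_k_const C_k_exp C_k_sum C_k_box_bump)
      show "compact (\<Union>i<n. cbox (a i) (b i))" by (intro compact_UN) auto
      show "(\<Union>i<n. cbox (a i) (b i)) \<subseteq> U" using ab by auto
      show "\<zeta> n x = 0" if "x \<notin> (\<Union>i<n. cbox (a i) (b i))" for x
        using that by (simp add: \<zeta>_def \<sigma>_def box_bump_eq_0)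
    qed
    show "0 \<le> \<zeta> n x" "\<zeta> n x \<le> 1" for x
      using \<sigma>[of n x] by (auto simp: \<zeta>_def)
  next
    have "negligible (\<Union>n. cbox (a n) (b n) - box (a n) (b n))"
      by (intro negligible_Union_nat negligible_frontier_interval)
    then have "AE x in lebesgue. x \<notin> (\<Union>n. cbox (a n) (b n) - box (a n) (b n))"
      by (intro AE_not_in) (simp add: negligible_iff_null_sets)
    then show "AE x in lebesgue. x \<in> U \<longrightarrow> (\<lambda>n. \<zeta> n x) \<longlonglongrightarrow> 1"
    proof eventually_elim
      case (elim x)
      show ?case
      proof
        assume "x \<in> U"
        then obtain j where "x \<in> box (a j) (b j)" using ab(2) elim by blast
        then have p: "0 < box_bump (a j) (b j) x" by (rule box_bump_pos)
        let ?p = "box_bump (a j) (b j) x"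
        have le: "?p \<le> \<sigma> n x" if "j < n" for n
          unfolding \<sigma>_def using that by (intro member_le_sum box_bump_nonneg) auto
        \<comment> \<open>From index \<open>j\<close> on, \<open>\<sigma> n x\<close> is at least
          the fixed positive number \<open>?p\<close>, so a geometric sequence dominates.\<close>
        have "(\<lambda>n. exp ((- ?p) * real n)) \<longlonglongrightarrow> 0"
          unfolding exp_of_nat2_mult using p by (intro LIMSEQ_realpow_zero) auto
        then have "(\<lambda>n. exp ((- real n) * \<sigma> n x)) \<longlonglongrightarrow> 0"
        proof (rule tendsto_sandwich[OF _ _ tendsto_const, rotated 2])
          show "\<forall>\<^sub>F n in sequentially. exp ((- real n) * \<sigma> n x) \<le> exp ((- ?p) * real n)"
            using eventually_gt_at_top[of j] by eventually_elim (use le in \<open>auto simp: mult.commute mult_left_mono\<close>)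
        qed auto
        then show "(\<lambda>n. \<zeta> n x) \<longlonglongrightarrow> 1"
          unfolding \<zeta>_def using tendsto_diff[OF tendsto_const, of "\<lambda>n. exp ((- real n) * \<sigma> n x)" 0 _ 1] by simp
      qed
    qed
  qed
qed

section \<open>Approximation by test functions and duality\<close>

lemma continuous_imp_lebesgue_measurable:
  "continuous_on UNIV f \<Longrightarrow> f \<in> borel_measurable lebesgue"
  for f :: "'a::euclidean_space \<Rightarrow> real"
  by (rule measurable_completion) (simp add: borel_measurable_continuous_onI)

lemma test_function_continuous: "test_function U \<phi> \<Longrightarrow> continuous_on UNIV \<phi>"
  by (erule test_functionE) (rule C_k_continuous)

lemma AE_lebesgue_onI: "S \<in> sets lebesgue \<Longrightarrow> AE x in lebesgue. x \<in> S \<longrightarrow> P x \<Longrightarrow> AE x in lebesgue_on S. P x"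
  by (simp add: AE_restrict_space_iff)

lemma test_function_L2:
  assumes "test_function U \<phi>" "X \<in> sets lebesgue"
  shows "\<phi> \<in> L2 X"
proof -
  obtain K where K: "compact K" "\<And>x. x \<notin> K \<Longrightarrow> \<phi> x = 0" by (rule test_functionE[OF assms(1)]) (rule that)
  have c: "continuous_on UNIV \<phi>" using assms(1) by (rule test_function_continuous)
  have "integrable lborel (\<lambda>x. indicator K x *\<^sub>R (\<phi> x)\<^sup>2)"
    using K(1) by (intro borel_integrable_compact continuous_intros continuous_on_subset[OF c]) auto
  then have "integrable lebesgue (\<lambda>x. indicator K x *\<^sub>R (\<phi> x)\<^sup>2)"
    using integrable_completion[OF borel_measurable_integrable] by blast
  moreover have "(\<lambda>x. indicator K x *\<^sub>R (\<phi> x)\<^sup>2) = (\<lambda>x. (\<phi> x)\<^sup>2)"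
    using K(2) by (auto simp: indicator_def fun_eq_iff)
  ultimately have i: "integrable lebesgue (\<lambda>x. (\<phi> x)\<^sup>2)" by simp
  show ?thesis
  proof (rule L2_I)
    show "\<phi> \<in> borel_measurable (lebesgue_on X)"
      using continuous_imp_lebesgue_measurable[OF c] by (rule measurable_restrict_space1)
    show "integrable (lebesgue_on X) (\<lambda>x. (\<phi> x)\<^sup>2)"
      using integrable_mult_indicator[OF assms(2) i] assms(2) by (simp add: integrable_restrict_space)
  qed
qed

lemma lmeasurable_open_bounded: "open U \<Longrightarrow> bounded U \<Longrightarrow> U \<in> lmeasurable"
  by (intro bounded_set_imp_lmeasurable lmeasurable_open) auto

text \<open>The approximants are polynomials close to continuous functions, multiplied by cutoffs.\<close>

lemma test_function_approximation:
  fixes U :: "'a::euclidean_space set"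
  assumes U: "open U" "bounded U" and f: "f \<in> borel_measurable (lebesgue_on U)"
    and B: "\<And>x. x \<in> U \<Longrightarrow> \<bar>f x\<bar> \<le> B" "0 \<le> B"
  obtains \<phi> where "\<And>n. test_function U (\<phi> n)" "\<And>n x. x \<in> U \<Longrightarrow> \<bar>\<phi> n x\<bar> \<le> B + 1"
    "AE x in lebesgue_on U. (\<lambda>n. \<phi> n x) \<longlonglongrightarrow> f x"
proof -
  have sU: "U \<in> sets lebesgue" using U(1) by (simp add: borel_open)
  have "f measurable_on U" using f sU by (simp add: measurable_on_iff_borel_measurable)
  then obtain N g where N: "negligible N" and g: "\<And>n::nat. continuous_on UNIV (g n)"
    and lim: "\<And>x. x \<notin> N \<Longrightarrow> (\<lambda>n. g n x) \<longlonglongrightarrow> (if x \<in> U then f x else 0)"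
    unfolding measurable_on_def by blast
  \<comment> \<open>Clamping to the range of \<open>f\<close> keeps the limit and bounds the
    continuous approximants uniformly in \<open>n\<close>. The error of the polynomials, at most 1,
    raises the bound to \<open>B + 1\<close>.\<close>
  define h where "h n x = max (- B) (min B (g n x))" for n x
  have h: "continuous_on (closure U) (h n)" for n
    unfolding h_def by (intro continuous_intros continuous_on_subset[OF g]) auto
  have hB: "\<bar>h n x\<bar> \<le> B" for n x using B(2) by (auto simp: h_def)
  have "\<exists>p. real_polynomial_function p \<and> (\<forall>x\<in>closure U. \<bar>h n x - p x\<bar> < 1 / real (Suc n))" for n
  proof -
    obtain p where "real_polynomial_function p" "\<And>x. x \<in> closure U \<Longrightarrow> \<bar>h n x - p x\<bar> < 1 / real (Suc n)"
      by (rule Stone_Weierstrass_real_polynomial_function[OF _ h, where e = "1 / real (Suc n)"])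
        (use U in \<open>auto simp: compact_closure\<close>)
    then show ?thesis by blast
  qed
  then obtain p where p: "\<And>n. real_polynomial_function (p n)"
    and ph: "\<And>n x. x \<in> closure U \<Longrightarrow> \<bar>h n x - p n x\<bar> < 1 / real (Suc n)"
    by metis
  obtain \<zeta> :: "nat \<Rightarrow> 'a \<Rightarrow> real" where \<zeta>: "\<And>n. test_function U (\<zeta> n)" "\<And>n x. 0 \<le> \<zeta> n x" "\<And>n x. \<zeta> n x \<le> 1"
    "AE x in lebesgue. x \<in> U \<longrightarrow> (\<lambda>n. \<zeta> n x) \<longlonglongrightarrow> 1"
    by (rule exists_cutoffs[OF U(1)]) (rule that)
  define \<phi> where "\<phi> n x = \<zeta> n x * p n x" for n x
  show thesis
  proof (rule that[of \<phi>])
    fix n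
    obtain K where K: "\<And>k. C_k k (\<zeta> n)" "compact K" "K \<subseteq> U" "\<And>x. x \<notin> K \<Longrightarrow> \<zeta> n x = 0"
      by (rule test_functionE[OF \<zeta>(1)[of n]]) (rule that)
    show "test_function U (\<phi> n)"
      by (rule test_functionI[OF _ K(2,3)])
         (auto simp: \<phi>_def[abs_def] K(4) intro: C_k_mult[OF K(1) C_k_real_polynomial_function[OF p]])
    show "\<bar>\<phi> n x\<bar> \<le> B + 1" if "x \<in> U" for x
    proof -
      have "x \<in> closure U" using that closure_subset by auto
      moreover have "1 / real (Suc n) \<le> 1" by simp
      ultimately have "\<bar>p n x\<bar> \<le> B + 1" using ph[of x n] hB[of n x] by linarith
      moreover have "\<bar>\<zeta> n x\<bar> \<le> 1" using \<zeta>(2,3)[of n x] by simp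
      ultimately show ?thesis unfolding \<phi>_def abs_mult
        using mult_mono[of "\<bar>\<zeta> n x\<bar>" 1 "\<bar>p n x\<bar>" "B + 1"] by simp
    qed
  next
    have "AE x in lebesgue. x \<notin> N" using N by (intro AE_not_in) (simp add: negligible_iff_null_sets)
    with \<zeta>(4) have "AE x in lebesgue. x \<in> U \<longrightarrow> (\<lambda>n. \<phi> n x) \<longlonglongrightarrow> f x"
    proof eventually_elim
      case (elim x)
      show ?case
      proof
        assume x: "x \<in> U"
        have g: "(\<lambda>n. g n x) \<longlonglongrightarrow> f x" using lim[OF elim(2)] x by simp
        have "(\<lambda>n. h n x) \<longlonglongrightarrow> max (- B) (min B (f x))"
          unfolding h_def by (intro tendsto_intros g)
        also have "max (- B) (min B (f x)) = f x" using B(1)[OF x] by (auto simp: abs_le_iff)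
        finally have h: "(\<lambda>n. h n x) \<longlonglongrightarrow> f x" .
        have "(\<lambda>n. h n x - p n x) \<longlonglongrightarrow> 0"
        proof (rule Lim_null_comparison)
          show "\<forall>\<^sub>F n in sequentially. norm (h n x - p n x) \<le> 1 / real (Suc n)"
            using ph[of x] x closure_subset[of U] by (auto intro!: always_eventually less_imp_le)
          show "(\<lambda>n. 1 / real (Suc n)) \<longlonglongrightarrow> 0" using LIMSEQ_inverse_real_of_nat by (simp add: inverse_eq_divide)
        qed
        from tendsto_diff[OF h this] have "(\<lambda>n. p n x) \<longlonglongrightarrow> f x" by simp
        with tendsto_mult[of "\<lambda>n. \<zeta> n x" 1 _ "\<lambda>n. p n x" "f x"] elim(1) x
        show "(\<lambda>n. \<phi> n x) \<longlonglongrightarrow> f x" by (simp add: \<phi>_def)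
      qed
    qed
    with sU show "AE x in lebesgue_on U. (\<lambda>n. \<phi> n x) \<longlonglongrightarrow> f x" by (rule AE_lebesgue_onI)
  qed
qed

text \<open>Taking \<phi> = g would give the claim at once. Approximation reaches only bounded
  functions, so the truncations of \<open>g\<close> are used in its place and the truncation level
  then tends to infinity.\<close>

lemma l2_norm_le_of_test_functions:
  fixes U :: "'a::euclidean_space set"
  assumes U: "open U" "bounded U" and g: "g \<in> L2 U"
    and M: "\<And>\<phi>. test_function U \<phi> \<Longrightarrow> \<bar>l2_inner U g \<phi>\<bar> \<le> M * l2_norm U \<phi>" "0 \<le> M"
  shows "l2_norm U g \<le> M"
proof -
  have sU: "U \<in> sets lebesgue" using U(1) by (simp add: borel_open)
  have lU: "U \<in> lmeasurable" using U by (rule lmeasurable_open_bounded)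
  interpret finite_measure "lebesgue_on U" using lU by (rule finite_measure_lebesgue_on)
  note [measurable] = L2_measurable[OF g]
  \<comment> \<open>Dominated convergence with the majorants \<open>(B + 1) \<bar>g\<bar>\<close>
    for the pairing and a constant for the norm; both are integrable since \<open>U\<close> has
    finite measure.\<close>
  have bounded: "\<bar>l2_inner U g f\<bar> \<le> M * l2_norm U f"
    if f[measurable]: "f \<in> borel_measurable (lebesgue_on U)" and B: "\<And>x. x \<in> U \<Longrightarrow> \<bar>f x\<bar> \<le> B" "0 \<le> B" for f B
  proof -
    obtain \<phi> where \<phi>: "\<And>n. test_function U (\<phi> n)" "\<And>n x. x \<in> U \<Longrightarrow> \<bar>\<phi> n x\<bar> \<le> B + 1"
      and lim: "AE x in lebesgue_on U. (\<lambda>n. \<phi> n x) \<longlonglongrightarrow> f x"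
      by (rule test_function_approximation[OF U f B(1) B(2)]) (assumption, rule that)
    have [measurable]: "\<phi> n \<in> borel_measurable (lebesgue_on U)" for n
      using test_function_L2[OF \<phi>(1) sU] by (rule L2_measurable)
    have "(\<lambda>n. l2_inner U g (\<phi> n)) \<longlonglongrightarrow> l2_inner U g f"
      unfolding l2_inner_def
    proof (rule integral_dominated_convergence[where w = "\<lambda>x. (B + 1) * \<bar>g x\<bar>"])
      show "integrable (lebesgue_on U) (\<lambda>x. (B + 1) * \<bar>g x\<bar>)"
        using L2_integrable[OF lU g] by simp
      show "AE x in lebesgue_on U. (\<lambda>n. g x * \<phi> n x) \<longlonglongrightarrow> g x * f x"
        using lim by eventually_elim (rule tendsto_mult_left)
      show "AE x in lebesgue_on U. norm (g x * \<phi> n x) \<le> (B + 1) * \<bar>g x\<bar>" for n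
        using \<phi>(2) by (intro AE_I2) (auto simp: abs_mult mult.commute intro!: mult_left_mono)
    qed measurable
    moreover have "(\<lambda>n. l2_inner U (\<phi> n) (\<phi> n)) \<longlonglongrightarrow> l2_inner U f f"
      unfolding l2_inner_def
    proof (rule integral_dominated_convergence[where w = "\<lambda>x. (B + 1) * (B + 1)"])
      show "AE x in lebesgue_on U. (\<lambda>n. \<phi> n x * \<phi> n x) \<longlonglongrightarrow> f x * f x"
        using lim by eventually_elim (intro tendsto_mult)
      show "AE x in lebesgue_on U. norm (\<phi> n x * \<phi> n x) \<le> (B + 1) * (B + 1)" for n
        using \<phi>(2) B(2) unfolding real_norm_def abs_mult by (intro AE_I2 mult_mono) auto
    qed simp_all
    then have "(\<lambda>n. l2_norm U (\<phi> n)) \<longlonglongrightarrow> l2_norm U f"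
      unfolding l2_norm_def by (rule tendsto_real_sqrt)
    ultimately show ?thesis
      by (intro LIMSEQ_le[OF tendsto_rabs tendsto_mult_left]) (auto intro!: exI[of _ 0] M \<phi>(1))
  qed
  \<comment> \<open>Cut off to 0 rather than to \<open>n\<close>, so that \<open>g * f n\<close>
    equals the square of \<open>f n\<close>.\<close>
  define f where "f n x = (if \<bar>g x\<bar> \<le> real n then g x else 0)" for n x
  have fm[measurable]: "f n \<in> borel_measurable (lebesgue_on U)" for n
    unfolding f_def by measurable
  have fL: "l2_norm U (f n) \<le> M" for n
  proof -
    have "l2_inner U g (f n) = (l2_norm U (f n))\<^sup>2"
      unfolding l2_norm_square l2_inner_def f_def by (intro Bochner_Integration.integral_cong) auto
    then have "l2_norm U (f n) * l2_norm U (f n) \<le> M * l2_norm U (f n)"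
      using bounded[of "f n" "real n"] by (auto simp: f_def power2_eq_square)
    then show ?thesis
      using M(2) l2_norm_nonneg[of U "f n"] by (cases "l2_norm U (f n) = 0") (auto simp: mult_le_cancel_right)
  qed
  have "(\<lambda>n. l2_inner U (f n) (f n)) \<longlonglongrightarrow> l2_inner U g g"
    unfolding l2_inner_def
  proof (rule integral_dominated_convergence[where w = "\<lambda>x. g x * g x"])
    show "integrable (lebesgue_on U) (\<lambda>x. g x * g x)" using g by (intro L2_integrable_mult)
    have "(\<lambda>n. f n x) \<longlonglongrightarrow> g x" for x
    proof (rule tendsto_eventually)
      obtain m where "\<bar>g x\<bar> \<le> real m" using real_arch_simple by blast
      then show "\<forall>\<^sub>F n in sequentially. f n x = g x"
        unfolding eventually_sequentially f_def by (intro exI[of _ m]) auto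
    qed
    then show "AE x in lebesgue_on U. (\<lambda>n. f n x * f n x) \<longlonglongrightarrow> g x * g x"
      by (intro AE_I2 tendsto_mult)
    show "AE x in lebesgue_on U. norm (f n x * f n x) \<le> g x * g x" for n
      by (intro AE_I2) (auto simp: f_def)
  qed measurable
  then have "(\<lambda>n. l2_norm U (f n)) \<longlonglongrightarrow> l2_norm U g"
    unfolding l2_norm_def by (rule tendsto_real_sqrt)
  then show ?thesis by (rule LIMSEQ_le_const2) (use fL in auto)
qed

section \<open>Weak gradients\<close>

text \<open>The duality bound with \<open>M = 0\<close>: two weak derivatives have the same pairing
  with every test function.\<close>

lemma has_weak_grad_unique:
  assumes X: "open X" "bounded X" and g: "has_weak_grad X u g" "has_weak_grad X u g'" and b: "b \<in> Basis"
  shows "ae_eq X (\<lambda>x. g x \<bullet> b) (\<lambda>x. g' x \<bullet> b)"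
proof -
  have s: "X \<in> sets lebesgue" using X(1) by (simp add: borel_open)
  have L: "(\<lambda>x. g x \<bullet> b) \<in> L2 X" "(\<lambda>x. g' x \<bullet> b) \<in> L2 X"
    using g b unfolding has_weak_grad_def by auto
  have D: "(\<lambda>x. g x \<bullet> b - g' x \<bullet> b) \<in> L2 X" using L by (rule L2_diff)
  have "l2_norm X (\<lambda>x. g x \<bullet> b - g' x \<bullet> b) \<le> 0"
  proof (rule l2_norm_le_of_test_functions[OF X D])
    fix \<phi> assume \<phi>: "test_function X \<phi>"
    have "l2_inner X (\<lambda>x. g x \<bullet> b) \<phi> = l2_inner X (\<lambda>x. g' x \<bullet> b) \<phi>"
      using g b \<phi> unfolding has_weak_grad_def by fastforce
    then show "\<bar>l2_inner X (\<lambda>x. g x \<bullet> b - g' x \<bullet> b) \<phi>\<bar> \<le> 0 * l2_norm X \<phi>"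
      using test_function_L2[OF \<phi> s] L by (simp add: l2_inner_diff_left)
  qed simp
  then have "l2_norm X (\<lambda>x. g x \<bullet> b - g' x \<bullet> b) = 0"
    using l2_norm_nonneg by (rule order_antisym)
  from l2_norm_eq_0_imp_ae[OF D this] show ?thesis by simp
qed

lemma H1_weak_grad: "u \<in> H1 X \<Longrightarrow> has_weak_grad X u (weak_grad X u)"
  unfolding H1_def weak_grad_def by (auto intro: someI[of "has_weak_grad X u"])

text \<open>\<open>h1_norm\<close> is defined through the chosen \<open>weak_grad\<close>. Since the
  components of any two weak gradients agree almost everywhere, the norm can be computed from an
  explicit one.\<close>

lemma h1_norm_eq:
  assumes X: "open X" "bounded X" and u: "u \<in> L2 X" and g: "has_weak_grad X u g"
  shows "h1_norm X u = sqrt ((l2_norm X u)\<^sup>2 + (\<Sum>b\<in>Basis. (l2_norm X (\<lambda>x. g x \<bullet> b))\<^sup>2))"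
proof -
  have w: "has_weak_grad X u (weak_grad X u)" using u g by (intro H1_weak_grad) (auto simp: H1_def)
  have "l2_norm X (\<lambda>x. weak_grad X u x \<bullet> b) = l2_norm X (\<lambda>x. g x \<bullet> b)" if b: "b \<in> Basis" for b
    by (rule l2_norm_ae_cong[OF has_weak_grad_unique[OF X w g b]])
       (use w g b in \<open>auto simp: has_weak_grad_def intro: L2_measurable\<close>)
  then show ?thesis unfolding h1_norm_def by simp
qed

lemma l2_norm_le_h1_norm: "l2_norm X u \<le> h1_norm X u"
  unfolding h1_norm_def by (intro real_le_rsqrt) (simp add: sum_nonneg)

lemma has_weak_grad_zero: "has_weak_grad X (\<lambda>x. 0) (\<lambda>x. 0)"
  by (simp add: has_weak_grad_def l2_inner_def)

lemma h1_norm_zero: "open X \<Longrightarrow> bounded X \<Longrightarrow> h1_norm X (\<lambda>x. 0) = 0"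
  by (subst h1_norm_eq[OF _ _ _ has_weak_grad_zero]) auto

text \<open>Such a function is its own approximant in the closure that defines
  \<open>H1_0\<close>.\<close>

lemma H1_0_I:
  assumes X: "open X" "bounded X" and u: "u \<in> H1 X"
    and V: "open V" "\<gamma> \<subseteq> V" "\<And>x. x \<in> X \<Longrightarrow> x \<in> V \<Longrightarrow> u x = 0"
  shows "u \<in> H1_0 X \<gamma>"
proof -
  have "AE x in lebesgue_on X. x \<in> V \<longrightarrow> u x = 0" using V(3) by (intro AE_I2) auto
  then show ?thesis unfolding H1_0_def using u V(1,2) h1_norm_zero[OF X] by (auto intro!: bexI[of _ u])
qed

section \<open>The dual norm\<close>

lemma zero_H1_0: "open X \<Longrightarrow> bounded X \<Longrightarrow> (\<lambda>x. 0) \<in> H1_0 X \<gamma>"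
  by (rule H1_0_I[where V = UNIV]) (auto simp: H1_def intro: has_weak_grad_zero)

lemma H1_0_L2: "w \<in> H1_0 X \<gamma> \<Longrightarrow> w \<in> L2 X"
  by (simp add: H1_0_def H1_def)

lemma l2_inner_le_of_h1_norm_le_1:
  assumes "f \<in> L2 X" "w \<in> H1_0 X \<gamma>" "h1_norm X w \<le> 1"
  shows "\<bar>l2_inner X f w\<bar> \<le> l2_norm X f"
proof -
  have "\<bar>l2_inner X f w\<bar> \<le> l2_norm X f * l2_norm X w"
    using assms(1) H1_0_L2[OF assms(2)] by (rule l2_cauchy_schwarz)
  also have "\<dots> \<le> l2_norm X f * 1"
    using l2_norm_le_h1_norm[of X w] assms(3) by (intro mult_left_mono) auto
  finally show ?thesis by simp
qed

lemma dual_norm_le_l2_norm: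
  assumes X: "open X" "bounded X" and f: "f \<in> L2 X"
  shows "dual_norm X \<gamma> f \<le> l2_norm X f"
  unfolding dual_norm_def
proof (rule cSUP_least)
  show "{w \<in> H1_0 X \<gamma>. h1_norm X w \<le> 1} \<noteq> {}"
    using zero_H1_0[OF X] h1_norm_zero[OF X] by force
qed (use f l2_inner_le_of_h1_norm_le_1 in auto)

lemma l2_inner_le_dual_norm:
  assumes "f \<in> L2 X" "w \<in> H1_0 X \<gamma>" "h1_norm X w \<le> 1"
  shows "\<bar>l2_inner X f w\<bar> \<le> dual_norm X \<gamma> f"
  unfolding dual_norm_def
proof (rule cSUP_upper)
  show "bdd_above ((\<lambda>w. \<bar>l2_inner X f w\<bar>) ` {w \<in> H1_0 X \<gamma>. h1_norm X w \<le> 1})"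
    using assms(1) by (auto intro!: bdd_aboveI2[where M = "l2_norm X f"] l2_inner_le_of_h1_norm_le_1)
qed (use assms in auto)

lemma has_weak_grad_cmult:
  "has_weak_grad X u g \<Longrightarrow> has_weak_grad X (\<lambda>x. a * u x) (\<lambda>x. a *\<^sub>R g x)"
  unfolding has_weak_grad_def by (auto simp: l2_inner_cmult_left intro: L2_cmult)

text \<open>Dividing by \<open>E\<close> puts \<open>w\<close> into the unit ball over which the
  dual norm is a supremum. An upper bound \<open>E\<close> of the norm suffices, which is what one
  has for a sum of bumps.\<close>

lemma l2_inner_le_dual_norm_mult:
  assumes X: "open X" "bounded X" and f: "f \<in> L2 X"
    and w: "w \<in> L2 X" "has_weak_grad X w g"
    and V: "open V" "\<gamma> \<subseteq> V" "\<And>x. x \<in> X \<Longrightarrow> x \<in> V \<Longrightarrow> w x = 0"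
    and E: "0 < E" "(l2_norm X w)\<^sup>2 + (\<Sum>b\<in>Basis. (l2_norm X (\<lambda>x. g x \<bullet> b))\<^sup>2) \<le> E\<^sup>2"
  shows "\<bar>l2_inner X f w\<bar> \<le> E * dual_norm X \<gamma> f"
proof -
  let ?w = "\<lambda>x. (1 / E) * w x"
  have W: "?w \<in> L2 X" "has_weak_grad X ?w (\<lambda>x. (1 / E) *\<^sub>R g x)"
    using w by (auto intro: L2_cmult has_weak_grad_cmult simp del: times_divide_eq_left mult_1)
  have "(h1_norm X ?w)\<^sup>2 = (1/E)\<^sup>2 * ((l2_norm X w)\<^sup>2 + (\<Sum>b\<in>Basis. (l2_norm X (\<lambda>x. g x \<bullet> b))\<^sup>2))"
    unfolding h1_norm_eq[OF X W] inner_scaleR_left l2_norm_cmult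
    by (simp add: sum_nonneg power_mult_distrib sum_distrib_left distrib_left power_divide)
  also have "\<dots> \<le> (1/E)\<^sup>2 * E\<^sup>2" by (rule mult_left_mono[OF E(2)]) simp
  also have "\<dots> = 1\<^sup>2" using E(1) by (simp add: power_divide)
  finally have n: "h1_norm X ?w \<le> 1" by (rule power2_le_imp_le) simp
  have "?w \<in> H1_0 X \<gamma>"
    using W V(3) by (intro H1_0_I[OF X _ V(1,2)]) (auto simp: H1_def)
  from l2_inner_le_dual_norm[OF f this n] show ?thesis
    using E(1) unfolding l2_inner_cmult_right by (simp add: abs_mult field_simps)
qed

section \<open>Differentiation of translates under the integral\<close>

lemma C_k_translate: "C_k k f \<Longrightarrow> C_k k (\<lambda>x. f (x + c))"
proof (induction k arbitrary: f)
  case 0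
  then show ?case by (auto intro!: continuous_on_compose2[of UNIV f] continuous_intros)
next
  case (Suc k)
  have d: "((\<lambda>x. f (x + c)) has_derivative frechet_derivative f (at (x + c))) (at x)" for x
  proof -
    have "((\<lambda>x. x + c) has_derivative (\<lambda>h. h)) (at x)" by (auto intro!: derivative_eq_intros)
    from has_derivative_compose[OF this C_k_Suc_has_derivative[OF Suc.prems]] show ?thesis .
  qed
  show ?case
    by (rule C_k_Suc_I[OF d]) (rule Suc.IH[OF C_k_Suc_partial[OF Suc.prems]])
qed

section \<open>Compactly supported functions of class C^1\<close>

lemma linear_Basis_sum:
  fixes f :: "'a::euclidean_space \<Rightarrow> real"
  assumes "linear f"
  shows "f v = (\<Sum>b\<in>Basis. (v \<bullet> b) * f b)"
  using Linear_Algebra.linear_componentwise[OF assms, of v 1] by simp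

lemma frechet_derivative_Basis_sum:
  fixes f :: "'a::euclidean_space \<Rightarrow> real"
  assumes "(f has_derivative D) (at x)"
  shows "D v = (\<Sum>b\<in>Basis. (v \<bullet> b) * D b)"
  using assms by (intro linear_Basis_sum has_derivative_linear)

text \<open>A common home for the test functions and for the quadratic bumps below, which are not
  twice differentiable; one continuous derivative is enough for integration by parts.\<close>

definition C1c :: "('a::euclidean_space \<Rightarrow> real) \<Rightarrow> bool" where
  "C1c f \<longleftrightarrow> C_k 1 f \<and> (\<exists>K. compact K \<and> (\<forall>x. x \<notin> K \<longrightarrow> f x = 0))"

lemma C1c_has_derivative: "C1c f \<Longrightarrow> (f has_derivative frechet_derivative f (at x)) (at x)"
  unfolding C1c_def using C_k_Suc_has_derivative[of 0 f] by simp

lemma C1c_continuous: "C1c f \<Longrightarrow> continuous_on UNIV f"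
  unfolding C1c_def using C_k_continuous by blast

text \<open>\<open>C_k\<close> speaks of basis directions; linearity of the derivative covers the
  others.\<close>

lemma C1c_derivative_continuous: assumes "C1c f" shows "continuous_on UNIV (\<lambda>x. frechet_derivative f (at x) v)"
proof -
  have "continuous_on UNIV (\<lambda>x. frechet_derivative f (at x) b)" if "b \<in> Basis" for b
    using C_k_Suc_partial[of 0 f b] that assms unfolding C1c_def by (simp add: numeral_nat)
  then have "continuous_on UNIV (\<lambda>x. \<Sum>b\<in>Basis. (v \<bullet> b) * frechet_derivative f (at x) b)"
    by (intro continuous_intros)
  also have "(\<lambda>x. \<Sum>b\<in>Basis. (v \<bullet> b) * frechet_derivative f (at x) b) = (\<lambda>x. frechet_derivative f (at x) v)"
    by (intro ext) (rule frechet_derivative_Basis_sum[OF C1c_has_derivative[OF assms], symmetric])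
  finally show ?thesis .
qed

lemma derivative_eq_0_outside_closed:
  fixes f :: "'a::euclidean_space \<Rightarrow> real"
  assumes "closed K" "\<And>x. x \<notin> K \<Longrightarrow> f x = 0" "x \<notin> K"
  shows "frechet_derivative f (at x) = (\<lambda>h. 0)"
proof -
  have "(f has_derivative (\<lambda>h. 0)) (at x)"
    by (rule has_derivative_transform_within_open[where s = "- K" and f = "\<lambda>x. 0"])
       (use assms in auto)
  then show ?thesis by (rule frechet_derivative_at[symmetric])
qed

lemma compactly_supported_bounded:
  fixes f :: "'a::euclidean_space \<Rightarrow> real"
  assumes "continuous_on UNIV f" "compact K" "\<And>x. x \<notin> K \<Longrightarrow> f x = 0"
  obtains B where "\<And>x. \<bar>f x\<bar> \<le> B"
proof -
  have "bounded (f ` K)"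
    using assms(2) by (intro compact_imp_bounded compact_continuous_image continuous_on_subset[OF assms(1)]) auto
  then obtain B where "\<And>x. x \<in> K \<Longrightarrow> \<bar>f x\<bar> \<le> B" unfolding bounded_iff by auto
  then have "\<bar>f x\<bar> \<le> max B 0" for x using assms(3)[of x] by (cases "x \<in> K") (auto simp: le_max_iff_disj)
  then show thesis by (rule that)
qed

lemma compactly_supported_integrable:
  fixes f :: "'a::euclidean_space \<Rightarrow> real"
  assumes "continuous_on UNIV f" "compact K" "\<And>x. x \<notin> K \<Longrightarrow> f x = 0"
  shows "integrable lebesgue f"
proof -
  have "integrable lborel (\<lambda>x. indicator K x *\<^sub>R f x)"
    using assms(2) by (intro borel_integrable_compact continuous_on_subset[OF assms(1)]) auto
  then have "integrable lebesgue (\<lambda>x. indicator K x *\<^sub>R f x)"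
    using integrable_completion[OF borel_measurable_integrable] by blast
  moreover have "(\<lambda>x. indicator K x *\<^sub>R f x) = f"
    using assms(3) by (auto simp: indicator_def fun_eq_iff)
  ultimately show ?thesis by simp
qed

lemma C1c_support:
  assumes "C1c f" obtains K where "compact K" "\<And>x. x \<notin> K \<Longrightarrow> f x = 0"
  using assms unfolding C1c_def by blast

lemma C1c_bounded: assumes "C1c f" obtains B where "\<And>x. \<bar>f x\<bar> \<le> B"
  by (rule C1c_support[OF assms], rule compactly_supported_bounded[OF C1c_continuous[OF assms]]) (assumption+, rule that)

lemma C1c_derivative_bounded: assumes "C1c f" obtains B where "\<And>x. \<bar>frechet_derivative f (at x) v\<bar> \<le> B"
proof -
  obtain K where K: "compact K" "\<And>x. x \<notin> K \<Longrightarrow> f x = 0" by (rule C1c_support[OF assms]) (rule that)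
  show thesis
    by (rule compactly_supported_bounded[OF C1c_derivative_continuous[OF assms] K(1)])
       (use K derivative_eq_0_outside_closed[of K f] in \<open>auto simp: compact_imp_closed intro: that\<close>)
qed

lemma C1c_integrable: assumes "C1c f" shows "integrable lebesgue f"
  by (rule C1c_support[OF assms]) (rule compactly_supported_integrable[OF C1c_continuous[OF assms]])

lemma test_function_C1c: "test_function U \<phi> \<Longrightarrow> C1c \<phi>"
  by (erule test_functionE) (auto simp: C1c_def)

lemma continuous_on_translated:
  "continuous_on UNIV f \<Longrightarrow> continuous_on UNIV (\<lambda>x. f (x + c))" for f :: "'a::euclidean_space \<Rightarrow> real"
  by (auto intro!: continuous_on_compose2[of UNIV f] continuous_intros)

text \<open>The translation acts on \<phi>, so \<open>w\<close> need only be integrable. By the mean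
  value theorem the difference quotients of \<phi> are bounded by a bound \<open>L\<close> of its
  directional derivative, and \<open>L \<bar>w\<bar>\<close> is the majorant for dominated
  convergence.\<close>

lemma has_real_derivative_integral_translate:
  fixes w \<phi> :: "'a::euclidean_space \<Rightarrow> real"
  assumes w: "integrable lebesgue w" and \<phi>: "C1c \<phi>"
  shows "((\<lambda>t. LINT x|lebesgue. w x * \<phi> (x + t *\<^sub>R v)) has_real_derivative
           (LINT x|lebesgue. w x * frechet_derivative \<phi> (at (x + t *\<^sub>R v)) v)) (at t)"
proof -
  have [measurable]: "w \<in> borel_measurable lebesgue" using w by simp
  have [measurable]: "(\<lambda>x. \<phi> (x + c)) \<in> borel_measurable lebesgue" for c
    by (intro continuous_imp_lebesgue_measurable continuous_on_translated C1c_continuous \<phi>)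
  have [measurable]: "(\<lambda>x. frechet_derivative \<phi> (at (x + c)) v) \<in> borel_measurable lebesgue" for c
    using continuous_on_translated[OF C1c_derivative_continuous[OF \<phi>]]
    by (intro continuous_imp_lebesgue_measurable) simp
  obtain B where B: "\<And>x. \<bar>\<phi> x\<bar> \<le> B" by (rule C1c_bounded[OF \<phi>]) (rule that)
  obtain L where L: "\<And>x. \<bar>frechet_derivative \<phi> (at x) v\<bar> \<le> L" by (rule C1c_derivative_bounded[OF \<phi>]) (rule that)
  have i: "integrable lebesgue (\<lambda>x. w x * \<phi> (x + c))" for c
  proof (rule Bochner_Integration.integrable_bound)
    show "integrable lebesgue (\<lambda>x. B * \<bar>w x\<bar>)" using w by simp
    have "norm (w x * \<phi> (x + c)) \<le> norm (B * \<bar>w x\<bar>)" for x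
      using abs_ge_zero[THEN order_trans, OF B[of 0]] mult_right_mono[OF B[of "x + c"], of "\<bar>w x\<bar>"] by (simp add: abs_mult mult.commute)
    then show "AE x in lebesgue. norm (w x * \<phi> (x + c)) \<le> norm (B * \<bar>w x\<bar>)" by simp
  qed measurable
  have D: "((\<lambda>s. \<phi> (x + s *\<^sub>R v)) has_real_derivative frechet_derivative \<phi> (at (x + s *\<^sub>R v)) v) (at s)" for x s
  proof -
    have "((\<lambda>s. x + s *\<^sub>R v) has_derivative (\<lambda>h. h *\<^sub>R v)) (at s)" by (auto intro!: derivative_eq_intros)
    from has_derivative_compose[OF this C1c_has_derivative[OF \<phi>]]
    show ?thesis
      unfolding has_field_derivative_def
      using linear_cmul[OF has_derivative_linear[OF C1c_has_derivative[OF \<phi>]]] by (simp add: mult_commute_abs)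
  qed
  have lip: "\<bar>\<phi> (x + s *\<^sub>R v) - \<phi> (x + t *\<^sub>R v)\<bar> \<le> L * \<bar>s - t\<bar>" for x s
    using field_differentiable_bound[of UNIV "\<lambda>s. \<phi> (x + s *\<^sub>R v)" "\<lambda>s. frechet_derivative \<phi> (at (x + s *\<^sub>R v)) v" L s t]
      D L by simp
  define F where "F s = (LINT x|lebesgue. w x * \<phi> (x + s *\<^sub>R v))" for s
  have "((\<lambda>h. (F (t + h) - F t) / h) \<longlongrightarrow> (LINT x|lebesgue. w x * frechet_derivative \<phi> (at (x + t *\<^sub>R v)) v)) (at 0)"
    unfolding tendsto_at_iff_sequentially comp_def
  proof (intro allI impI)
    fix X :: "nat \<Rightarrow> real" assume X: "\<forall>i. X i \<in> UNIV - {0}" "X \<longlonglongrightarrow> 0"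
    have eq: "(F (t + X i) - F t) / X i =
        (LINT x|lebesgue. w x * ((\<phi> (x + (t + X i) *\<^sub>R v) - \<phi> (x + t *\<^sub>R v)) / X i))" for i
      unfolding F_def Bochner_Integration.integral_diff[OF i i, symmetric]
        Bochner_Integration.integral_divide_zero[symmetric]
      by (simp add: algebra_simps)
    show "(\<lambda>i. (F (t + X i) - F t) / X i) \<longlonglongrightarrow> (LINT x|lebesgue. w x * frechet_derivative \<phi> (at (x + t *\<^sub>R v)) v)"
      unfolding eq
    proof (rule integral_dominated_convergence[where w = "\<lambda>x. L * \<bar>w x\<bar>"])
      show "integrable lebesgue (\<lambda>x. L * \<bar>w x\<bar>)" using w by simp
      show "AE x in lebesgue. norm (w x * ((\<phi> (x + (t + X i) *\<^sub>R v) - \<phi> (x + t *\<^sub>R v)) / X i)) \<le> L * \<bar>w x\<bar>" for i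
      proof (intro AE_I2)
        fix x :: 'a
        have "\<bar>(\<phi> (x + (t + X i) *\<^sub>R v) - \<phi> (x + t *\<^sub>R v)) / X i\<bar> \<le> L"
          using lip[of x "t + X i"] X(1) by (simp add: abs_divide divide_le_eq)
        then show "norm (w x * ((\<phi> (x + (t + X i) *\<^sub>R v) - \<phi> (x + t *\<^sub>R v)) / X i)) \<le> L * \<bar>w x\<bar>"
          unfolding real_norm_def abs_mult[of "w x"] mult.commute[of "\<bar>w x\<bar>"]
          by (rule mult_right_mono) simp
      qed
      show "AE x in lebesgue. (\<lambda>i. w x * ((\<phi> (x + (t + X i) *\<^sub>R v) - \<phi> (x + t *\<^sub>R v)) / X i))
          \<longlonglongrightarrow> w x * frechet_derivative \<phi> (at (x + t *\<^sub>R v)) v"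
      proof (intro AE_I2 tendsto_mult_left)
        fix x :: 'a
        have "((\<lambda>h. (\<phi> (x + (t + h) *\<^sub>R v) - \<phi> (x + t *\<^sub>R v)) / h) \<longlongrightarrow> frechet_derivative \<phi> (at (x + t *\<^sub>R v)) v) (at 0)"
          using D[of x t] unfolding DERIV_def .
        then show "(\<lambda>i. (\<phi> (x + (t + X i) *\<^sub>R v) - \<phi> (x + t *\<^sub>R v)) / X i) \<longlonglongrightarrow> frechet_derivative \<phi> (at (x + t *\<^sub>R v)) v"
          unfolding tendsto_at_iff_sequentially comp_def using X by blast
      qed
    qed measurable
  qed
  then show ?thesis unfolding DERIV_def F_def .
qed

section \<open>Translation invariance and integration by parts\<close>

lemma lborel_integrable_translate:
  fixes f :: "'a::euclidean_space \<Rightarrow> real"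
  assumes "integrable lborel f"
  shows "integrable lborel (\<lambda>x. f (x + c))"
proof -
  have "integrable (distr lborel borel ((+) c)) f" using assms by (simp add: lborel_distr_plus)
  then show ?thesis using assms by (subst (asm) integrable_distr_eq) (auto simp: add.commute)
qed

lemma lborel_integral_translate:
  fixes f :: "'a::euclidean_space \<Rightarrow> real"
  assumes [measurable]: "f \<in> borel_measurable borel"
  shows "(LINT x|lborel. f (x + c)) = (LINT x|lborel. f x)"
proof -
  have "(LINT x|lborel. f x) = (LINT x|distr lborel borel ((+) c). f x)" by (simp add: lborel_distr_plus)
  also have "\<dots> = (LINT x|lborel. f (c + x))" by (subst integral_distr) auto
  finally show ?thesis by (simp add: add.commute)
qed

lemma lebesgue_integral_translate:
  fixes f :: "'a::euclidean_space \<Rightarrow> real"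
  assumes [measurable]: "f \<in> borel_measurable borel"
  shows "(LINT x|lebesgue. f (x + c)) = (LINT x|lebesgue. f x)"
  using lborel_integral_translate[OF assms, of c] by (simp add: integral_completion)

text \<open>By translation invariance the integral of \<open>f(x) g(x + t b)\<close> equals that of
  \<open>g(x) f(x - t b)\<close>. Differentiating both expressions at t = 0 gives the
  formula.\<close>

lemma integration_by_parts_C1c:
  fixes f g :: "'a::euclidean_space \<Rightarrow> real"
  assumes f: "C1c f" and g: "C1c g"
  shows "(LINT x|lebesgue. f x * frechet_derivative g (at x) b) = - (LINT x|lebesgue. frechet_derivative f (at x) b * g x)"
proof -
  have [measurable]: "f \<in> borel_measurable borel" "g \<in> borel_measurable borel"
    using f g by (auto intro: borel_measurable_continuous_onI C1c_continuous)
  have eq: "(\<lambda>t. LINT x|lebesgue. f x * g (x + t *\<^sub>R b)) = (\<lambda>t. LINT x|lebesgue. g x * f (x + t *\<^sub>R (- b)))"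
  proof
    fix t
    have "(LINT x|lebesgue. g x * f (x + t *\<^sub>R (- b))) = (LINT x|lebesgue. g (x + t *\<^sub>R b) * f ((x + t *\<^sub>R b) + t *\<^sub>R (- b)))"
      by (rule lebesgue_integral_translate[symmetric]) measurable
    then show "(LINT x|lebesgue. f x * g (x + t *\<^sub>R b)) = (LINT x|lebesgue. g x * f (x + t *\<^sub>R (- b)))"
      by (simp add: mult.commute)
  qed
  have "(LINT x|lebesgue. f x * frechet_derivative g (at x) b) = (LINT x|lebesgue. g x * frechet_derivative f (at x) (- b))"
    using DERIV_unique[OF has_real_derivative_integral_translate[OF C1c_integrable[OF f] g, of b 0]]
      has_real_derivative_integral_translate[OF C1c_integrable[OF g] f, of "- b" 0]
    unfolding eq by simp
  also have "\<dots> = - (LINT x|lebesgue. frechet_derivative f (at x) b * g x)"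
    using linear_neg[OF has_derivative_linear[OF C1c_has_derivative[OF f]]]
    by (simp add: mult.commute)
  finally show ?thesis .
qed

lemma l2_inner_lebesgue:
  "X \<in> sets lebesgue \<Longrightarrow> l2_inner X f g = (LINT x|lebesgue. indicator X x * (f x * g x))"
  unfolding l2_inner_def by (subst integral_restrict_space) auto

lemma l2_inner_eq_of_support:
  assumes "X \<in> sets lebesgue" "U \<in> sets lebesgue" "\<And>x. x \<notin> X \<inter> U \<Longrightarrow> f x = 0 \<or> g x = 0"
  shows "l2_inner X f g = l2_inner U f g"
  unfolding l2_inner_lebesgue[OF assms(1)] l2_inner_lebesgue[OF assms(2)]
  using assms(3) by (intro Bochner_Integration.integral_cong) (auto simp: indicator_def)

lemma l2_inner_eq_lebesgue_of_support:
  assumes "X \<in> sets lebesgue" "\<And>x. x \<notin> X \<Longrightarrow> f x = 0 \<or> g x = 0"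
  shows "l2_inner X f g = (LINT x|lebesgue. f x * g x)"
  unfolding l2_inner_lebesgue[OF assms(1)]
  using assms(2) by (intro Bochner_Integration.integral_cong) (auto simp: indicator_def)

lemma C1c_derivative_L2:
  assumes f: "C1c f" and s: "X \<in> lmeasurable"
  shows "(\<lambda>x. frechet_derivative f (at x) v) \<in> L2 X"
proof -
  obtain L where L: "\<And>x. \<bar>frechet_derivative f (at x) v\<bar> \<le> L" by (rule C1c_derivative_bounded[OF f]) (rule that)
  show ?thesis
    by (rule L2_bounded[OF s _ L])
       (intro measurable_restrict_space1 continuous_imp_lebesgue_measurable C1c_derivative_continuous f)
qed

lemma C1c_L2:
  assumes f: "C1c f" and s: "X \<in> lmeasurable"
  shows "f \<in> L2 X"
proof -
  obtain L where L: "\<And>x. \<bar>f x\<bar> \<le> L" by (rule C1c_bounded[OF f]) (rule that)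
  show ?thesis
    by (rule L2_bounded[OF s _ L])
       (intro measurable_restrict_space1 continuous_imp_lebesgue_measurable C1c_continuous f)
qed

text \<open>Although \<open>f\<close> need not vanish on the boundary of \<open>X\<close>, the test
  function and its derivative vanish off \<open>X\<close>. Both pairings are thus integrals over the
  whole space, where there is no boundary term.\<close>

lemma has_weak_grad_C1c:
  assumes X: "open X" "bounded X" and f: "C1c f"
  shows "has_weak_grad X f (\<lambda>x. \<Sum>b\<in>Basis. frechet_derivative f (at x) b *\<^sub>R b)"
  unfolding has_weak_grad_def
proof (intro ballI conjI allI impI)
  fix b :: 'a assume b: "b \<in> Basis"
  have s: "X \<in> sets lebesgue" using X(1) by (simp add: borel_open)
  have eq: "(\<lambda>x. (\<Sum>b\<in>Basis. frechet_derivative f (at x) b *\<^sub>R b) \<bullet> b) = (\<lambda>x. frechet_derivative f (at x) b)"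
    using b by (simp add: inner_sum_left_Basis)
  show "(\<lambda>x. (\<Sum>b\<in>Basis. frechet_derivative f (at x) b *\<^sub>R b) \<bullet> b) \<in> L2 X"
    unfolding eq by (rule C1c_derivative_L2[OF f lmeasurable_open_bounded[OF X]])
  fix \<phi> assume \<phi>: "test_function X \<phi>"
  obtain K where K: "compact K" "K \<subseteq> X" "\<And>x. x \<notin> K \<Longrightarrow> \<phi> x = 0"
    by (rule test_functionE[OF \<phi>]) (rule that)
  have D0: "frechet_derivative \<phi> (at x) b = 0" if "x \<notin> X" for x
  proof -
    have "x \<notin> K" using K(2) that by blast
    then have "frechet_derivative \<phi> (at x) = (\<lambda>h. 0)"
      using K(1,3) by (intro derivative_eq_0_outside_closed[of K] compact_imp_closed)
    then show ?thesis by simp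
  qed
  show "l2_inner X f (\<lambda>x. frechet_derivative \<phi> (at x) b) =
      - l2_inner X (\<lambda>x. (\<Sum>b\<in>Basis. frechet_derivative f (at x) b *\<^sub>R b) \<bullet> b) \<phi>"
    unfolding eq using K(2,3) D0
    by (subst (1 2) l2_inner_eq_lebesgue_of_support[OF s])
       (auto simp: integration_by_parts_C1c[OF f test_function_C1c[OF \<phi>]])
qed


section \<open>The Poincare inequality\<close>

lemma L2_subset:
  assumes f: "f \<in> L2 X" and s: "X \<in> sets lebesgue" "I \<in> sets lebesgue" "I \<subseteq> X"
  shows "f \<in> L2 I"
proof (rule L2_I)
  show "f \<in> borel_measurable (lebesgue_on I)"
    using L2_measurable[OF f] s(3) by (rule measurable_restrict_mono)
  have "integrable lebesgue (\<lambda>x. indicator X x *\<^sub>R (f x)\<^sup>2)"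
    using L2_square_integrable[OF f] s by (simp add: integrable_restrict_space)
  from integrable_mult_indicator[OF s(2) this]
  have "integrable lebesgue (\<lambda>x. indicator I x *\<^sub>R (f x)\<^sup>2)"
    by (rule Bochner_Integration.integrable_cong[THEN iffD1, rotated -1])
       (use s(3) in \<open>auto simp: indicator_def\<close>)
  then show "integrable (lebesgue_on I) (\<lambda>x. (f x)\<^sup>2)"
    using s by (simp add: integrable_restrict_space)
qed

lemma test_function_translate:
  assumes \<phi>: "test_function U \<phi>" and "\<And>x. x \<in> U \<Longrightarrow> x - c \<in> V"
  shows "test_function V (\<lambda>x. \<phi> (x + c))"
proof -
  obtain K where K: "\<And>k. C_k k \<phi>" "compact K" "K \<subseteq> U" "\<And>x. x \<notin> K \<Longrightarrow> \<phi> x = 0"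
    by (rule test_functionE[OF \<phi>]) (rule that)
  show ?thesis
  proof (rule test_functionI)
    show "compact ((\<lambda>x. - c + x) ` K)" using K(2) by (rule compact_translation)
    show "(\<lambda>x. - c + x) ` K \<subseteq> V" using assms(2) K(3) by fastforce
    show "\<phi> (x + c) = 0" if "x \<notin> (\<lambda>x. - c + x) ` K" for x
      using that by (intro K(4)) (auto simp: image_iff algebra_simps)
  qed (intro C_k_translate K(1))
qed

lemma weak_grad_directional:
  assumes g: "has_weak_grad X u g" and u: "u \<in> L2 X"
    and lm: "X \<in> lmeasurable" and \<phi>: "test_function X \<phi>"
  shows "l2_inner X u (\<lambda>x. frechet_derivative \<phi> (at x) v) = - (\<Sum>b\<in>Basis. (v \<bullet> b) * l2_inner X (\<lambda>x. g x \<bullet> b) \<phi>)"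
proof -
  have d: "(\<lambda>x. frechet_derivative \<phi> (at x) v) = (\<lambda>x. \<Sum>b\<in>Basis. (v \<bullet> b) * frechet_derivative \<phi> (at x) b)"
    by (intro ext) (rule frechet_derivative_Basis_sum[OF C1c_has_derivative[OF test_function_C1c[OF \<phi>]]])
  have "l2_inner X u (\<lambda>x. frechet_derivative \<phi> (at x) v)
      = (\<Sum>b\<in>Basis. (v \<bullet> b) * l2_inner X u (\<lambda>x. frechet_derivative \<phi> (at x) b))"
    unfolding d l2_inner_commute[of X u]
    by (subst l2_inner_sum_left)
       (auto intro!: L2_cmult C1c_derivative_L2[OF test_function_C1c[OF \<phi>] lm] u simp: l2_inner_cmult_left)
  also have "\<dots> = (\<Sum>b\<in>Basis. (v \<bullet> b) * - l2_inner X (\<lambda>x. g x \<bullet> b) \<phi>)"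
    using g \<phi> unfolding has_weak_grad_def by (intro sum.cong) auto
  finally show ?thesis by (simp add: sum_negf)
qed

text \<open>Test the difference with \<phi> supported in \<open>U\<close>. For t in [0, 1] the
  translate of \<phi> by \<open>t h\<close> is supported in \<open>I\<close>, hence is a test
  function of \<open>X\<close>, so the definition of the weak gradient applies to \<open>w\<close>
  along the whole path and bounds the derivative in t.\<close>

lemma translation_estimate:
  fixes w :: "'a::euclidean_space \<Rightarrow> real" and h :: 'a
  assumes X: "open X" "bounded X" and I: "open I" "convex I" "I \<subseteq> X"
    and wm[measurable]: "w \<in> borel_measurable borel" and w: "w \<in> L2 X" and g: "has_weak_grad X w g"
  defines "U \<equiv> {x \<in> I. x + h \<in> I}"
  shows "(\<lambda>x. w (x + h) - w x) \<in> L2 U"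
    and "(l2_norm U (\<lambda>x. w (x + h) - w x))\<^sup>2 \<le> (norm h)\<^sup>2 * (\<Sum>b\<in>Basis. (l2_norm I (\<lambda>x. g x \<bullet> b))\<^sup>2)"
proof -
  have U: "open U"
  proof -
    have "U = I \<inter> (\<lambda>x. x + h) -` I" unfolding U_def by auto
    then show ?thesis using I(1) by (auto intro!: open_Int open_vimage continuous_intros)
  qed
  have UI: "U \<subseteq> I" "U \<subseteq> X" using I(3) unfolding U_def by auto
  have bU: "bounded U" using UI X(2) by (rule_tac bounded_subset)
  have s[simp]: "X \<in> sets lebesgue" "I \<in> sets lebesgue" "U \<in> sets lebesgue"
    using X(1) I(1) U by (auto simp: borel_open)
  have sb[measurable]: "I \<in> sets borel" "U \<in> sets borel" using I(1) U by auto
  have lm: "X \<in> lmeasurable" using X by (rule lmeasurable_open_bounded)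
  have gb: "(\<lambda>x. g x \<bullet> b) \<in> L2 X" if "b \<in> Basis" for b using g that unfolding has_weak_grad_def by auto
  have wh: "(\<lambda>x. w (x + h)) \<in> L2 U"
  proof (rule L2_I)
    show "(\<lambda>x. w (x + h)) \<in> borel_measurable (lebesgue_on U)"
      by (intro measurable_restrict_space1 measurable_completion) simp
    have "integrable lebesgue (\<lambda>x. indicator I x * (w x)\<^sup>2)"
      using L2_square_integrable[OF L2_subset[OF w s(1,2) I(3)]] by (simp add: integrable_restrict_space)
    then have "integrable lborel (\<lambda>x. indicator I x * (w x)\<^sup>2)"
      by (subst (asm) integrable_completion) auto
    from lborel_integrable_translate[OF this, of h]
    have "integrable lebesgue (\<lambda>x. indicator I (x + h) * (w (x + h))\<^sup>2)"
      by (subst integrable_completion) auto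
    from integrable_mult_indicator[OF s(3) this]
    have "integrable lebesgue (\<lambda>x. indicator U x *\<^sub>R (w (x + h))\<^sup>2)"
      by (rule Bochner_Integration.integrable_cong[THEN iffD1, rotated -1])
         (auto simp: U_def indicator_def)
    then show "integrable (lebesgue_on U) (\<lambda>x. (w (x + h))\<^sup>2)" by (simp add: integrable_restrict_space)
  qed
  have wU: "w \<in> L2 U" using w s(1,3) UI(2) by (rule L2_subset)
  show G: "(\<lambda>x. w (x + h) - w x) \<in> L2 U" using wh wU by (rule L2_diff)
  define A where "A = sqrt (\<Sum>b\<in>Basis. (l2_norm I (\<lambda>x. g x \<bullet> b))\<^sup>2)"
  have wi: "integrable lebesgue (\<lambda>x. indicator X x * w x)"
    using L2_integrable[OF lm w] by (simp add: integrable_restrict_space)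
  have "l2_norm U (\<lambda>x. w (x + h) - w x) \<le> norm h * A"
  proof (rule l2_norm_le_of_test_functions[OF U bU G])
    show "0 \<le> norm h * A" unfolding A_def by (simp add: sum_nonneg)
    fix \<phi> assume \<phi>: "test_function U \<phi>"
    have \<phi>1: "C1c \<phi>" using \<phi> by (rule test_function_C1c)
    have \<phi>m[measurable]: "\<phi> \<in> borel_measurable borel"
      using \<phi>1 by (intro borel_measurable_continuous_onI C1c_continuous)
    obtain K where K: "compact K" "K \<subseteq> U" "\<And>x. x \<notin> K \<Longrightarrow> \<phi> x = 0"
      by (rule test_functionE[OF \<phi>]) (rule that)
    \<comment> \<open>The path from the pairing of \<phi> with \<open>w\<close> at t = 0 to its
      pairing with \<open>w (x + h)\<close> at t = 1.\<close>
    define F where "F t = (LINT x|lebesgue. (indicator X x * w x) * \<phi> (x + t *\<^sub>R (- h)))" for t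
    define F' where "F' t = (LINT x|lebesgue. (indicator X x * w x) * frechet_derivative \<phi> (at (x + t *\<^sub>R (- h))) (- h))" for t
    have F: "(F has_real_derivative F' t) (at t)" for t
      unfolding F_def F'_def by (rule has_real_derivative_integral_translate[OF wi \<phi>1])
    have F': "\<bar>F' t\<bar> \<le> norm h * A * l2_norm U \<phi>" if t: "t \<in> {0..1}" for t
    proof -
      define \<psi> where "\<psi> x = \<phi> (x + t *\<^sub>R (- h))" for x
      \<comment> \<open>The point lies on the segment from \<open>x\<close> to \<open>x + h\<close>;
        this is where convexity of \<open>I\<close> enters.\<close>
      have tI: "x - t *\<^sub>R (- h) \<in> I" if "x \<in> U" for x
      proof -
        have "(1 - t) *\<^sub>R x + t *\<^sub>R (x + h) \<in> I"
          using that t I(2) unfolding U_def by (intro convexD) auto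
        then show ?thesis by (simp add: algebra_simps)
      qed
      have \<psi>I: "test_function I \<psi>" unfolding \<psi>_def using \<phi> tI by (rule test_function_translate)
      then have \<psi>X: "test_function X \<psi>" using I(3) unfolding test_function_def by auto
      have \<psi>0: "\<psi> x = 0" if "x \<notin> I" for x
        by (rule test_functionE[OF \<psi>I]) (use that in blast)
      have d: "frechet_derivative \<psi> (at x) = frechet_derivative \<phi> (at (x + t *\<^sub>R (- h)))" for x
      proof -
        have "((\<lambda>x. x + t *\<^sub>R (- h)) has_derivative (\<lambda>h. h)) (at x)" by (auto intro!: derivative_eq_intros)
        from has_derivative_compose[OF this C1c_has_derivative[OF \<phi>1]] show ?thesis
          unfolding \<psi>_def by (rule frechet_derivative_at[symmetric])
      qed
      have gI: "(\<lambda>x. g x \<bullet> b) \<in> L2 I" if "b \<in> Basis" for b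
        using gb[OF that] s(1,2) I(3) by (rule L2_subset)
      have "F' t = l2_inner X w (\<lambda>x. frechet_derivative \<psi> (at x) (- h))"
        unfolding F'_def d l2_inner_lebesgue[OF s(1)] by (simp add: mult.assoc)
      also have "\<dots> = (\<Sum>b\<in>Basis. (h \<bullet> b) * l2_inner X (\<lambda>x. g x \<bullet> b) \<psi>)"
        by (subst weak_grad_directional[OF g w lm \<psi>X]) (simp add: sum_negf)
      also have "\<dots> = (\<Sum>b\<in>Basis. (h \<bullet> b) * l2_inner I (\<lambda>x. g x \<bullet> b) \<psi>)"
        using \<psi>0 I(3) by (intro sum.cong arg_cong2[where f="(*)"] l2_inner_eq_of_support) auto
      finally have eq: "F' t = (\<Sum>b\<in>Basis. (h \<bullet> b) * l2_inner I (\<lambda>x. g x \<bullet> b) \<psi>)" .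
      have n: "l2_norm I \<psi> = l2_norm U \<phi>"
      proof -
        have "l2_inner I \<psi> \<psi> = (LINT x|lebesgue. \<psi> x * \<psi> x)"
          using \<psi>0 by (intro l2_inner_eq_lebesgue_of_support) auto
        also have "\<dots> = (LINT x|lebesgue. \<phi> x * \<phi> x)"
          unfolding \<psi>_def by (rule lebesgue_integral_translate) measurable
        also have "\<dots> = l2_inner U \<phi> \<phi>"
          using K by (intro l2_inner_eq_lebesgue_of_support[symmetric]) auto
        finally show ?thesis unfolding l2_norm_def by simp
      qed
      have "\<bar>F' t\<bar> \<le> (\<Sum>b\<in>Basis. \<bar>h \<bullet> b\<bar> * (l2_norm I (\<lambda>x. g x \<bullet> b) * l2_norm U \<phi>))"
        unfolding eq
        by (rule order_trans[OF sum_abs])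
           (auto simp: abs_mult simp flip: n intro!: sum_mono mult_left_mono l2_cauchy_schwarz gI test_function_L2[OF \<psi>I])
      also have "\<dots> = (\<Sum>b\<in>Basis. \<bar>h \<bullet> b\<bar> * l2_norm I (\<lambda>x. g x \<bullet> b)) * l2_norm U \<phi>"
        by (simp add: sum_distrib_right mult.assoc)
      also have "(\<Sum>b\<in>Basis. \<bar>h \<bullet> b\<bar> * l2_norm I (\<lambda>x. g x \<bullet> b)) \<le> norm h * A"
      proof (rule power2_le_imp_le)
        have "(\<Sum>b\<in>Basis. \<bar>h \<bullet> b\<bar>\<^sup>2) = (norm h)\<^sup>2"
          by (subst power2_norm_eq_inner, subst euclidean_inner) (simp add: power2_eq_square)
        then show "(\<Sum>b\<in>Basis. \<bar>h \<bullet> b\<bar> * l2_norm I (\<lambda>x. g x \<bullet> b))\<^sup>2 \<le> (norm h * A)\<^sup>2"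
          using Cauchy_Schwarz_ineq_sum[of "\<lambda>b. \<bar>h \<bullet> b\<bar>" "\<lambda>b. l2_norm I (\<lambda>x. g x \<bullet> b)" Basis]
          unfolding A_def power_mult_distrib by (simp add: sum_nonneg)
        show "0 \<le> norm h * A" unfolding A_def by (simp add: sum_nonneg)
      qed
      finally show ?thesis by (simp add: mult_right_mono)
    qed
    have "norm (F 1 - F 0) \<le> (norm h * A * l2_norm U \<phi>) * norm (1 - 0 :: real)"
      by (rule field_differentiable_bound[of "{0..1}" F F'])
         (use F' in \<open>auto intro: has_field_derivative_at_within F\<close>)
    moreover have "F 1 = l2_inner U (\<lambda>x. w (x + h)) \<phi>"
    proof -
      have "F 1 = (LINT x|lebesgue. (indicator X (x + h) * w (x + h)) * \<phi> (x + h + 1 *\<^sub>R (- h)))"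
        unfolding F_def using X(1) by (intro lebesgue_integral_translate[symmetric]) measurable
      also have "\<dots> = l2_inner U (\<lambda>x. w (x + h)) \<phi>"
        unfolding l2_inner_lebesgue[OF s(3)]
        using K(2,3) I(3) by (intro Bochner_Integration.integral_cong) (auto simp: indicator_def U_def)
      finally show ?thesis .
    qed
    moreover have "F 0 = l2_inner U w \<phi>"
      unfolding F_def l2_inner_lebesgue[OF s(3)]
      using K(2,3) UI(2) by (intro Bochner_Integration.integral_cong) (auto simp: indicator_def)
    ultimately show "\<bar>l2_inner U (\<lambda>x. w (x + h) - w x) \<phi>\<bar> \<le> norm h * A * l2_norm U \<phi>"
      using test_function_L2[OF \<phi> s(3)] wh wU by (simp add: l2_inner_diff_left)
  qed
  then have "(l2_norm U (\<lambda>x. w (x + h) - w x))\<^sup>2 \<le> (norm h * A)\<^sup>2" by (intro power_mono) auto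
  also have "\<dots> = (norm h)\<^sup>2 * (\<Sum>b\<in>Basis. (l2_norm I (\<lambda>x. g x \<bullet> b))\<^sup>2)"
    by (simp add: A_def power_mult_distrib sum_nonneg)
  finally show "(l2_norm U (\<lambda>x. w (x + h) - w x))\<^sup>2 \<le> (norm h)\<^sup>2 * (\<Sum>b\<in>Basis. (l2_norm I (\<lambda>x. g x \<bullet> b))\<^sup>2)" .
qed

lemma lebesgue_on_borel:
  fixes f :: "'a::euclidean_space \<Rightarrow> real"
  assumes [measurable]: "I \<in> sets borel" "f \<in> borel_measurable borel"
  shows "integrable (lebesgue_on I) f \<longleftrightarrow> integrable lborel (\<lambda>x. indicator I x * f x)"
    and "integral\<^sup>L (lebesgue_on I) f = (LINT x|lborel. indicator I x * f x)"
  by (simp_all add: integrable_restrict_space integral_restrict_space integrable_completion integral_completion)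

text \<open>The left-hand side is the double integral of \<open>(w x - w y)\<^sup>2\<close> over
  \<open>I \<times> I\<close>, multiplied out. The substitution \<open>y = x + h\<close> and an
  exchange of the integrals leave, for each shift \<open>h\<close>, the quantity of
  \<open>translation_estimate\<close>. Only shifts in the ball of radius \<open>D\<close>
  contribute, whence the factors \<open>D\<^sup>2\<close> and the volume of that ball.\<close>

lemma poincare_borel:
  fixes w :: "'a::euclidean_space \<Rightarrow> real"
  assumes X: "open X" "bounded X" and I: "open I" "convex I" "I \<subseteq> X"
    and D: "\<And>x y. x \<in> I \<Longrightarrow> y \<in> I \<Longrightarrow> dist x y \<le> D" "0 \<le> D"
    and wm[measurable]: "w \<in> borel_measurable borel" and w: "w \<in> L2 X" and g: "has_weak_grad X w g"
  defines "S \<equiv> (LINT x|lebesgue_on I. w x)" and "E \<equiv> (LINT x|lebesgue_on I. (w x)\<^sup>2)" and "m \<equiv> measure lebesgue I"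
  shows "2 * m * E - 2 * S\<^sup>2 \<le> measure lebesgue (cball 0 D :: 'a set) * D\<^sup>2 * (\<Sum>b\<in>Basis. (l2_norm I (\<lambda>x. g x \<bullet> b))\<^sup>2)"
proof -
  have [measurable]: "I \<in> sets borel" using I(1) by simp
  have sI: "X \<in> sets lebesgue" "I \<in> sets lebesgue" using X(1) I(1) by (auto simp: borel_open)
  have lI: "I \<in> lmeasurable" using I(1) bounded_subset[OF X(2) I(3)] by (rule lmeasurable_open_bounded)
  have wI: "w \<in> L2 I" using w sI I(3) by (rule L2_subset)
  have i1: "integrable lborel (\<lambda>x. indicator I x * w x)"
    using L2_integrable[OF lI wI] by (simp add: lebesgue_on_borel)
  have i2: "integrable lborel (\<lambda>x. indicator I x * (w x)\<^sup>2)"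
    using L2_square_integrable[OF wI] by (simp add: lebesgue_on_borel)
  have i0: "integrable lborel (indicator I :: 'a \<Rightarrow> real)"
    using lI by (simp add: fmeasurable_def emeasure_completion less_top)
  have S: "S = (LINT x|lborel. indicator I x * w x)" unfolding S_def by (simp add: lebesgue_on_borel)
  have E: "E = (LINT x|lborel. indicator I x * (w x)\<^sup>2)" unfolding E_def by (simp add: lebesgue_on_borel)
  have m: "m = (LINT x|lborel. indicator I x)" unfolding m_def by simp
  define A where "A = (\<Sum>b\<in>Basis. (l2_norm I (\<lambda>x. g x \<bullet> b))\<^sup>2)"
  have A: "0 \<le> A" unfolding A_def by (simp add: sum_nonneg)
  define f where "f x y = indicator I x * (indicator I y * (w x - w y)\<^sup>2)" for x y
  have [measurable]: "(\<lambda>(x, y). f x y) \<in> borel_measurable (borel \<Otimes>\<^sub>M borel)"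
    unfolding f_def by measurable
  have inner: "integrable lborel (f x)" "(LINT y|lborel. f x y) = indicator I x * (m * (w x)\<^sup>2 - 2 * S * w x + E)" for x
  proof -
    have eq: "f x = (\<lambda>y. indicator I x * ((w x)\<^sup>2 * indicator I y - 2 * w x * (indicator I y * w y) + indicator I y * (w y)\<^sup>2))"
      unfolding f_def by (auto simp: fun_eq_iff power2_diff algebra_simps)
    show "integrable lborel (f x)" unfolding eq using i0 i1 i2 by simp
    show "(LINT y|lborel. f x y) = indicator I x * (m * (w x)\<^sup>2 - 2 * S * w x + E)"
      unfolding eq S E m using i0 i1 i2 by simp
  qed
  have outer: "integrable lborel (\<lambda>x. indicator I x * (m * (w x)\<^sup>2 - 2 * S * w x + E))"
    "(LINT x|lborel. indicator I x * (m * (w x)\<^sup>2 - 2 * S * w x + E)) = 2 * m * E - 2 * S\<^sup>2"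
  proof -
    have eq: "(\<lambda>x. indicator I x * (m * (w x)\<^sup>2 - 2 * S * w x + E)) =
        (\<lambda>x. m * (indicator I x * (w x)\<^sup>2) - 2 * S * (indicator I x * w x) + E * indicator I x)"
      by (auto simp: fun_eq_iff algebra_simps)
    show "integrable lborel (\<lambda>x. indicator I x * (m * (w x)\<^sup>2 - 2 * S * w x + E))"
      unfolding eq using i0 i1 i2 by simp
    have "(LINT x|lborel. m * (indicator I x * (w x)\<^sup>2) - 2 * S * (indicator I x * w x) + E * indicator I x)
        = m * E - 2 * S * S + E * m"
      unfolding S E m using i0 i1 i2 by simp
    then show "(LINT x|lborel. indicator I x * (m * (w x)\<^sup>2 - 2 * S * w x + E)) = 2 * m * E - 2 * S\<^sup>2"
      unfolding eq by (simp add: power2_eq_square)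
  qed
  have f0: "0 \<le> f x y" for x y unfolding f_def by simp
  \<comment> \<open>Nonnegative as the inner integral of \<open>f x\<close>. This permits the
    passage to nonnegative integrals, where measurability alone justifies the exchange.\<close>
  have q0: "0 \<le> indicator I x * (m * (w x)\<^sup>2 - 2 * S * w x + E)" for x
    unfolding inner(2)[symmetric] by (intro integral_nonneg_AE) (simp add: f0)
  have h: "(\<integral>\<^sup>+ x. ennreal (f x (x + h)) \<partial>lborel) \<le> ennreal (D\<^sup>2 * A) * indicator (cball 0 D) h" for h
  proof -
    define U where "U = {x \<in> I. x + h \<in> I}"
    have "U = I \<inter> (\<lambda>x. x + h) -` I" unfolding U_def by auto
    then have "open U" using I(1) by (auto intro!: open_Int open_vimage continuous_intros)
    then have [measurable]: "U \<in> sets borel" by simp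
    note te = translation_estimate[OF X I wm w g, of h, folded U_def A_def]
    have eq: "f x (x + h) = indicator U x * (w (x + h) - w x)\<^sup>2" for x
      unfolding f_def U_def by (auto simp: indicator_def power2_commute)
    have i: "integrable lborel (\<lambda>x. indicator U x * (w (x + h) - w x)\<^sup>2)"
      using L2_square_integrable[OF te(1)] by (simp add: lebesgue_on_borel)
    have "(\<integral>\<^sup>+ x. ennreal (f x (x + h)) \<partial>lborel) = ennreal ((l2_norm U (\<lambda>x. w (x + h) - w x))\<^sup>2)"
      unfolding eq by (subst nn_integral_eq_integral[OF i]) (auto simp: l2_norm_square_integral lebesgue_on_borel)
    also have "\<dots> \<le> ennreal (D\<^sup>2 * A) * indicator (cball 0 D) h"
    \<comment> \<open>If \<open>U\<close> is nonempty, \<open>h\<close> is a difference of two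
      points of \<open>I\<close> and so has norm at most \<open>D\<close>.\<close>
    proof (cases "U = {}")
      case True
      then have "l2_norm U (\<lambda>x. w (x + h) - w x) = 0"
        by (simp add: l2_norm_def l2_inner_lebesgue)
      then show ?thesis by simp
    next
      case False
      then obtain x where "x \<in> I" "x + h \<in> I" unfolding U_def by auto
      from D(1)[OF this(2,1)] have n: "norm h \<le> D" by (simp add: dist_norm)
      have "(l2_norm U (\<lambda>x. w (x + h) - w x))\<^sup>2 \<le> D\<^sup>2 * A"
        using te(2) mult_right_mono[OF power_mono[OF n, of 2] A] by simp
      then show ?thesis using n by (simp add: ennreal_leI)
    qed
    finally show ?thesis .
  qed
  have "ennreal (2 * m * E - 2 * S\<^sup>2) = (\<integral>\<^sup>+ x. ennreal (indicator I x * (m * (w x)\<^sup>2 - 2 * S * w x + E)) \<partial>lborel)"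
    unfolding outer(2)[symmetric] using nn_integral_eq_integral[OF outer(1)] q0 by simp
  also have "\<dots> = (\<integral>\<^sup>+ x. (\<integral>\<^sup>+ y. ennreal (f x y) \<partial>lborel) \<partial>lborel)"
    unfolding inner(2)[symmetric] using nn_integral_eq_integral[OF inner(1)] f0 by (intro nn_integral_cong) simp
  also have "\<dots> = (\<integral>\<^sup>+ x. (\<integral>\<^sup>+ h. ennreal (f x (x + h)) \<partial>lborel) \<partial>lborel)"
  proof (rule nn_integral_cong)
    fix x
    have "(\<integral>\<^sup>+ y. ennreal (f x y) \<partial>lborel) = (\<integral>\<^sup>+ y. ennreal (f x y) \<partial>(distr lborel borel ((+) x)))"
      by (simp add: lborel_distr_plus)
    also have "\<dots> = (\<integral>\<^sup>+ h. ennreal (f x (x + h)) \<partial>lborel)" by (subst nn_integral_distr) auto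
    finally show "(\<integral>\<^sup>+ y. ennreal (f x y) \<partial>lborel) = (\<integral>\<^sup>+ h. ennreal (f x (x + h)) \<partial>lborel)" .
  qed
  also have "\<dots> = (\<integral>\<^sup>+ h. (\<integral>\<^sup>+ x. ennreal (f x (x + h)) \<partial>lborel) \<partial>lborel)"
    by (rule lborel_pair.Fubini'[symmetric]) measurable
  also have "\<dots> \<le> (\<integral>\<^sup>+ h. ennreal (D\<^sup>2 * A) * indicator (cball 0 D) (h::'a) \<partial>lborel)"
    by (intro nn_integral_mono h)
  also have "\<dots> = ennreal (D\<^sup>2 * A) * emeasure lborel (cball 0 D :: 'a set)"
    by (rule nn_integral_cmult_indicator) simp
  also have "\<dots> = ennreal (D\<^sup>2 * A * measure lebesgue (cball 0 D :: 'a set))"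
  proof -
    have "emeasure lborel (cball 0 D :: 'a set) = ennreal (measure lborel (cball 0 D :: 'a set))"
      using emeasure_lborel_cball_finite[of "0::'a" D] by (intro emeasure_eq_ennreal_measure) simp
    then show ?thesis using A by (simp add: ennreal_mult')
  qed
  finally show ?thesis
    using A unfolding A_def[symmetric] by (subst (asm) ennreal_le_iff) (auto simp: mult_ac)
qed

text \<open>Passes to a Borel representative \<open>w'\<close>, since translates and the double
  integral above are handled with Borel measurability, and recognises
  \<open>2 m E - 2 S\<^sup>2\<close> as \<open>2 m\<close> times the squared distance of
  \<open>w\<close> from its mean \<open>S / m\<close>.\<close>

lemma poincare:
  fixes w :: "'a::euclidean_space \<Rightarrow> real"
  assumes X: "open X" "bounded X" and I: "open I" "convex I" "I \<subseteq> X" "I \<noteq> {}"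
    and D: "\<And>x y. x \<in> I \<Longrightarrow> y \<in> I \<Longrightarrow> dist x y \<le> D" "0 \<le> D"
    and w: "w \<in> L2 X" and g: "has_weak_grad X w g"
  defines "m \<equiv> measure lebesgue I"
  shows "2 * m * (l2_norm I (\<lambda>x. w x - (LINT x|lebesgue_on I. w x) / m))\<^sup>2
    \<le> measure lebesgue (cball 0 D :: 'a set) * D\<^sup>2 * (\<Sum>b\<in>Basis. (l2_norm I (\<lambda>x. g x \<bullet> b))\<^sup>2)"
proof -
  have sI: "X \<in> sets lebesgue" "I \<in> sets lebesgue" using X(1) I(1) by (auto simp: borel_open)
  have lI: "I \<in> lmeasurable" using I(1) bounded_subset[OF X(2) I(3)] by (rule lmeasurable_open_bounded)
  have lX: "X \<in> lmeasurable" using X by (rule lmeasurable_open_bounded)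
  \<comment> \<open>Nothing is known about \<open>w\<close> off \<open>X\<close>; extension by zero
    makes it measurable on the whole space.\<close>
  have "(\<lambda>x. indicator X x * w x) \<in> borel_measurable lebesgue"
    using L2_measurable[OF w] sI(1) borel_measurable_restrict_space_iff[of X lebesgue w] by simp
  from completion_ex_borel_measurable_real[OF this] obtain w' where
    w'[measurable]: "w' \<in> borel_measurable borel" and ae: "AE x in lborel. indicator X x * w x = w' x" by auto
  have "AE x in lebesgue. indicator X x * w x = w' x" using ae by (rule AE_completion)
  then have ael: "AE x in lebesgue. x \<in> X \<longrightarrow> w x = w' x" by eventually_elim auto
  then have aeX: "ae_eq X w w'" using sI by (intro AE_lebesgue_onI)
  have aeI: "ae_eq I w w'" using ael sI I(3) by (intro AE_lebesgue_onI) auto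
  have w'm: "w' \<in> borel_measurable (lebesgue_on Y)" for Y
    by (intro measurable_restrict_space1 measurable_completion) simp
  have w'L: "w' \<in> L2 X" using w aeX w'm by (rule L2_ae_cong)
  have w'g: "has_weak_grad X w' g"
    unfolding has_weak_grad_def
  proof (intro ballI conjI allI impI)
    fix b :: 'a assume b: "b \<in> Basis"
    show "(\<lambda>x. g x \<bullet> b) \<in> L2 X" using g b unfolding has_weak_grad_def by auto
    fix \<phi> assume \<phi>: "test_function X \<phi>"
    have "l2_inner X w' (\<lambda>x. frechet_derivative \<phi> (at x) b) = l2_inner X w (\<lambda>x. frechet_derivative \<phi> (at x) b)"
      using aeX w'm L2_measurable[OF w] L2_measurable[OF C1c_derivative_L2[OF test_function_C1c[OF \<phi>] lX]]
      by (intro l2_inner_ae_cong) auto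
    then show "l2_inner X w' (\<lambda>x. frechet_derivative \<phi> (at x) b) = - l2_inner X (\<lambda>x. g x \<bullet> b) \<phi>"
      using g b \<phi> unfolding has_weak_grad_def by auto
  qed
  define S where "S = (LINT x|lebesgue_on I. w x)"
  have wI: "w \<in> L2 I" using w sI I(3) by (rule L2_subset)
  have w'I: "w' \<in> L2 I" using w'L sI I(3) by (rule L2_subset)
  have S: "S = (LINT x|lebesgue_on I. w' x)"
    unfolding S_def using aeI L2_measurable[OF wI] w'm by (intro integral_cong_AE) auto
  have m: "m > 0" unfolding m_def using I(1,4) lI
    by (metis interior_open measure_nonneg negligible_iff_measure open_not_negligible order_le_less)
  have "(l2_norm I (\<lambda>x. w x - S / m))\<^sup>2 = (l2_norm I (\<lambda>x. w' x - S / m))\<^sup>2"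
  proof (subst l2_norm_ae_cong)
    show "ae_eq I (\<lambda>x. w x - S / m) (\<lambda>x. w' x - S / m)" using aeI by eventually_elim simp
  qed (use L2_measurable[OF wI] w'm in auto)
  also have "\<dots> = (LINT x|lebesgue_on I. (w' x)\<^sup>2 - 2 * (S / m) * w' x + (S / m)\<^sup>2)"
    unfolding l2_norm_square_integral by (simp add: power2_diff algebra_simps)
  also have "\<dots> = (LINT x|lebesgue_on I. (w' x)\<^sup>2) - 2 * (S / m) * S + (S / m)\<^sup>2 * m"
  proof -
    interpret finite_measure "lebesgue_on I" using lI by (rule finite_measure_lebesgue_on)
    have "measure (lebesgue_on I) (space (lebesgue_on I)) = m"
      unfolding m_def using sI by (simp add: measure_restrict_space)
    then show ?thesis
      unfolding S using L2_integrable[OF lI w'I] L2_square_integrable[OF w'I] by simp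
  qed
  finally have "2 * m * (l2_norm I (\<lambda>x. w x - S / m))\<^sup>2 = 2 * m * (LINT x|lebesgue_on I. (w' x)\<^sup>2) - 2 * S\<^sup>2"
    using m by (simp add: field_simps power2_eq_square)
  with poincare_borel[OF X I(1-3) D w' w'L w'g, folded S m_def] show ?thesis
    unfolding S_def[symmetric] by simp
qed

section \<open>Piecewise constant functions on a partition\<close>

lemma sum_mult_sum_diagonal:
  fixes f g :: "'i \<Rightarrow> real"
  assumes "finite F" "\<And>i j. i \<in> F \<Longrightarrow> j \<in> F \<Longrightarrow> i \<noteq> j \<Longrightarrow> f i * g j = 0"
  shows "(\<Sum>i\<in>F. f i) * (\<Sum>j\<in>F. g j) = (\<Sum>i\<in>F. f i * g i)"
proof -
  have "(\<Sum>j\<in>F. f i * g j) = f i * g i" if "i \<in> F" for i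
  proof -
    have "(\<Sum>j\<in>F - {i}. f i * g j) = 0" by (intro sum.neutral ballI assms(2)) (use that in auto)
    then show ?thesis using assms(1) that by (simp add: sum.remove[of F i])
  qed
  then show ?thesis by (simp add: sum_product)
qed

text \<open>Normal form for piecewise constant functions. Interiors are used so that the pieces do
  not overlap; the faces, a null set, receive the value 0.\<close>

definition pc :: "'a::euclidean_space set set \<Rightarrow> ('a set \<Rightarrow> real) \<Rightarrow> 'a \<Rightarrow> real" where
  "pc \<S> a x = (\<Sum>S\<in>\<S>. a S * indicator (interior S) x)"

lemma mesh_size_pc: "mesh_size \<T> = pc \<T> simplex_size"
  by (simp add: fun_eq_iff mesh_size_def pc_def)

lemma pc_measurable: "pc \<S> a \<in> borel_measurable (lebesgue_on \<Omega>)"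
proof -
  have "pc \<S> a \<in> borel_measurable borel" unfolding pc_def[abs_def] by measurable
  then have "pc \<S> a \<in> borel_measurable lebesgue" by (intro measurable_completion) simp
  then show ?thesis by (rule measurable_restrict_space1)
qed

locale bounded_open =
  fixes \<Omega> :: "'a::euclidean_space set"
  assumes open_\<Omega>: "open \<Omega>" and bounded_\<Omega>: "bounded \<Omega>"
begin

lemma sets_\<Omega>: "\<Omega> \<in> sets lebesgue" using open_\<Omega> by (simp add: borel_open)
lemma lmeasurable_\<Omega>: "\<Omega> \<in> lmeasurable" using open_\<Omega> bounded_\<Omega> by (rule lmeasurable_open_bounded)

end

locale partition = bounded_open \<Omega> for \<Omega> :: "'a::euclidean_space set" +
  fixes \<T> :: "'a set set"
  assumes partition: "simplicial_partition \<Omega> \<T>"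
begin

lemma finite_\<T>: "finite \<T>" using partition by (simp add: simplicial_partition_def)

lemma simplex: "T \<in> \<T> \<Longrightarrow> int DIM('a) simplex T" using partition by (simp add: simplicial_partition_def)

lemma convex: "T \<in> \<T> \<Longrightarrow> convex T" using simplex convex_simplex by blast
lemma compact: "T \<in> \<T> \<Longrightarrow> compact T" using simplex compact_simplex by blast

lemma interior_subset_\<Omega>: "T \<in> \<T> \<Longrightarrow> interior T \<subseteq> \<Omega>"
  using partition by (simp add: simplicial_partition_def)

lemma interior_nonempty: assumes "T \<in> \<T>" shows "interior T \<noteq> {}"
proof -
  have d: "aff_dim T = int DIM('a)" using simplex[OF assms] by (rule aff_dim_simplex)
  then have "affine hull T = UNIV" by (simp add: aff_dim_eq_full)
  then have "rel_interior T = interior T" by (rule rel_interior_interior)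
  moreover have "T \<noteq> {}" using d by auto
  ultimately show ?thesis using rel_interior_eq_empty[OF convex[OF assms]] by auto
qed

lemma interior_lmeasurable: "T \<in> \<T> \<Longrightarrow> interior T \<in> lmeasurable"
  using bounded_subset[OF bounded_\<Omega> interior_subset_\<Omega>] by (intro lmeasurable_open_bounded) auto

lemma measure_interior: "T \<in> \<T> \<Longrightarrow> measure lebesgue (interior T) = measure lebesgue T"
  using compact convex by (intro measure_interior negligible_convex_frontier compact_imp_bounded)

lemma measure_pos: assumes "T \<in> \<T>" shows "0 < measure lebesgue T"
proof -
  have "\<not> negligible (interior T)" using interior_nonempty[OF assms] open_not_negligible by blast
  then have "measure lebesgue (interior T) \<noteq> 0"
    using negligible_iff_measure[of "interior T"] interior_lmeasurable[OF assms] by simp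
  then show ?thesis using measure_interior[OF assms] by (simp add: less_le)
qed

lemma simplex_size_pos: "T \<in> \<T> \<Longrightarrow> 0 < simplex_size T"
  unfolding simplex_size_def using measure_pos by (simp add: real_root_gt_zero)

lemma simplex_size_power: "T \<in> \<T> \<Longrightarrow> simplex_size T ^ DIM('a) = measure lebesgue T"
  unfolding simplex_size_def using measure_pos by (simp add: less_imp_le)

text \<open>\<open>T\<close> is contained in the closure of its interior, so a neighbourhood of
  \<open>x\<close> inside \<open>S\<close> would meet the interior of a different
  \<open>T\<close>.\<close>

lemma interior_unique:
  assumes "S \<in> \<T>" "T \<in> \<T>" "x \<in> interior S" "x \<in> T"
  shows "S = T"
proof (rule ccontr)
  assume "S \<noteq> T"
  then have d: "interior S \<inter> interior T = {}"
    using partition assms(1,2) by (simp add: simplicial_partition_def)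
  have "T \<subseteq> closure (interior T)"
    using convex_closure_interior[OF convex[OF assms(2)] interior_nonempty[OF assms(2)]] closure_subset by blast
  then have "x \<in> closure (interior T)" using assms(4) by blast
  then show False using d assms(3) open_Int_closure_eq_empty[of "interior S" "interior T"] by auto
qed

lemma pc_interior: assumes "T \<in> \<T>" "x \<in> interior T" shows "pc \<T> a x = a T"
proof -
  have "x \<notin> interior S" if "S \<in> \<T>" "S \<noteq> T" for S
    using interior_unique[OF assms(1) that(1) assms(2)] that interior_subset by blast
  then show ?thesis
    unfolding pc_def using assms finite_\<T> by (subst sum.remove[of _ T]) (auto intro!: sum.neutral)
qed

text \<open>Frontiers of convex sets are null sets, and there are finitely many simplices.\<close>

lemma AE_interior: "AE x in lebesgue_on \<Omega>. \<exists>T\<in>\<T>. x \<in> interior T"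
proof -
  have "negligible (\<Union>T\<in>\<T>. frontier T)"
    using finite_\<T> convex by (intro negligible_Union) (auto intro: negligible_convex_frontier)
  then have "AE x in lebesgue. x \<notin> (\<Union>T\<in>\<T>. frontier T)"
    by (intro AE_not_in) (simp add: negligible_iff_null_sets)
  then have "AE x in lebesgue. x \<in> \<Omega> \<longrightarrow> (\<exists>T\<in>\<T>. x \<in> interior T)"
  proof eventually_elim
    case (elim x)
    show ?case
    proof
      assume "x \<in> \<Omega>"
      then have "x \<in> \<Union>\<T>" using partition closure_subset unfolding simplicial_partition_def by auto
      then obtain T where "T \<in> \<T>" "x \<in> T" by auto
      then show "\<exists>T\<in>\<T>. x \<in> interior T"
        using elim closure_subset by (auto simp: frontier_def)
    qed
  qed
  with sets_\<Omega> show ?thesis by (rule AE_lebesgue_onI)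
qed

lemma pc_L2: "pc \<T> a \<in> L2 \<Omega>"
proof (rule L2_bounded[OF lmeasurable_\<Omega> pc_measurable])
  fix x
  have "\<bar>pc \<T> a x\<bar> \<le> (\<Sum>T\<in>\<T>. \<bar>a T * indicator (interior T) x\<bar>)" unfolding pc_def by (rule sum_abs)
  also have "\<dots> \<le> (\<Sum>T\<in>\<T>. \<bar>a T\<bar>)" by (intro sum_mono) (auto simp: indicator_def)
  finally show "\<bar>pc \<T> a x\<bar> \<le> (\<Sum>T\<in>\<T>. \<bar>a T\<bar>)" .
qed

lemma l2_inner_pc:
  assumes "f \<in> L2 \<Omega>"
  shows "l2_inner \<Omega> f (pc \<T> b) = (\<Sum>T\<in>\<T>. b T * (LINT x|lebesgue_on (interior T). f x))"
proof -
  have i: "integrable (lebesgue_on \<Omega>) (\<lambda>x. f x * (b T * indicator (interior T) x))" for T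
    by (intro L2_integrable_mult assms L2_cmult L2_bounded[OF lmeasurable_\<Omega>, where B = 1] measurable_restrict_space1
        borel_measurable_indicator) (auto simp: borel_open)
  have "l2_inner \<Omega> f (pc \<T> b) = (\<Sum>T\<in>\<T>. LINT x|lebesgue_on \<Omega>. f x * (b T * indicator (interior T) x))"
    unfolding l2_inner_def pc_def sum_distrib_left using i by (rule Bochner_Integration.integral_sum)
  also have "\<dots> = (\<Sum>T\<in>\<T>. b T * (LINT x|lebesgue_on (interior T). f x))"
  proof (intro sum.cong refl)
    fix T assume T: "T \<in> \<T>"
    have "(LINT x|lebesgue_on \<Omega>. f x * (b T * indicator (interior T) x)) =
        b T * (LINT x|lebesgue_on \<Omega>. f x * indicator (interior T) x)"
      unfolding integral_mult_right_zero[symmetric] by (simp add: mult_ac)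
    also have "(LINT x|lebesgue_on \<Omega>. f x * indicator (interior T) x) = (LINT x|lebesgue_on (interior T). f x)"
      using sets_\<Omega> interior_subset_\<Omega>[OF T]
      by (subst (1 2) integral_restrict_space) (auto intro!: Bochner_Integration.integral_cong simp: indicator_def)
    finally show "(LINT x|lebesgue_on \<Omega>. f x * (b T * indicator (interior T) x)) =
        b T * (LINT x|lebesgue_on (interior T). f x)" .
  qed
  finally show ?thesis .
qed

lemma integral_pc_interior:
  assumes T: "T \<in> \<T>" shows "(LINT x|lebesgue_on (interior T). pc \<T> a x) = a T * measure lebesgue T"
proof -
  have "(LINT x|lebesgue_on (interior T). pc \<T> a x) = (LINT x|lebesgue_on (interior T). a T)"
    using pc_interior[OF T] by (intro Bochner_Integration.integral_cong) auto
  also have "\<dots> = a T * measure lebesgue T"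
    using measure_interior[OF T] by (simp add: measure_restrict_space)
  finally show ?thesis .
qed

lemma l2_inner_pc_pc: "l2_inner \<Omega> (pc \<T> a) (pc \<T> b) = (\<Sum>T\<in>\<T>. a T * b T * measure lebesgue T)"
  unfolding l2_inner_pc[OF pc_L2] by (intro sum.cong) (auto simp: integral_pc_interior)

lemma l2_norm_pc: "(l2_norm \<Omega> (pc \<T> a))\<^sup>2 = (\<Sum>T\<in>\<T>. (a T)\<^sup>2 * measure lebesgue T)"
  unfolding l2_norm_square l2_inner_pc_pc by (simp add: power2_eq_square)

lemma ae_eqI:
  assumes "\<And>T x. T \<in> \<T> \<Longrightarrow> x \<in> interior T \<Longrightarrow> f x = g x"
  shows "ae_eq \<Omega> f g"
  using AE_interior by eventually_elim (use assms in blast)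

subsection \<open>The orthogonal projector onto the piecewise constants\<close>

lemma pc_U_space: "pc \<T> a \<in> U_space \<Omega> \<T>"
proof -
  have "AE x in lebesgue_on \<Omega>. x \<in> T \<longrightarrow> pc \<T> a x = a T" if T: "T \<in> \<T>" for T
    using AE_interior
  proof eventually_elim
    case (elim x)
    then obtain S where S: "S \<in> \<T>" "x \<in> interior S" by blast
    show ?case using interior_unique[OF S(1) T S(2)] pc_interior[OF S] by auto
  qed
  then show ?thesis unfolding U_space_def using pc_L2 by blast
qed

lemma U_space_pc:
  assumes "u \<in> U_space \<Omega> \<T>" obtains a where "ae_eq \<Omega> u (pc \<T> a)"
proof -
  have "\<forall>T\<in>\<T>. \<exists>c. AE x in lebesgue_on \<Omega>. x \<in> T \<longrightarrow> u x = c"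
    using assms by (simp add: U_space_def)
  then obtain a where a: "\<And>T. T \<in> \<T> \<Longrightarrow> AE x in lebesgue_on \<Omega>. x \<in> T \<longrightarrow> u x = a T"
    unfolding bchoice_iff by blast
  have "AE x in lebesgue_on \<Omega>. \<forall>T\<in>\<T>. x \<in> T \<longrightarrow> u x = a T"
    using finite_\<T> a by (intro AE_finite_allI)
  with AE_interior have "ae_eq \<Omega> u (pc \<T> a)"
  proof eventually_elim
    case (elim x)
    then obtain S where S: "S \<in> \<T>" "x \<in> interior S" by blast
    then show ?case using pc_interior[OF S] elim(2) interior_subset by auto
  qed
  then show thesis by (rule that)
qed

definition avg :: "('a \<Rightarrow> real) \<Rightarrow> 'a set \<Rightarrow> real" where
  "avg f T = (LINT x|lebesgue_on (interior T). f x) / measure lebesgue T"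

lemma avg_pc: "T \<in> \<T> \<Longrightarrow> avg (pc \<T> a) T = a T"
  using measure_pos[of T] by (simp add: avg_def integral_pc_interior)

lemma pc_cong: "(\<And>T. T \<in> \<T> \<Longrightarrow> a T = b T) \<Longrightarrow> pc \<T> a = pc \<T> b"
  unfolding pc_def by (simp add: fun_eq_iff)

lemma l2_inner_pc_avg:
  assumes f: "f \<in> L2 \<Omega>"
  shows "l2_inner \<Omega> (pc \<T> (avg f)) (pc \<T> b) = l2_inner \<Omega> f (pc \<T> b)"
  unfolding l2_inner_pc[OF f] l2_inner_pc_pc
  by (intro sum.cong) (auto simp: avg_def dest: measure_pos)

lemma U_space_L2: "u \<in> U_space \<Omega> \<T> \<Longrightarrow> u \<in> L2 \<Omega>" by (simp add: U_space_def)

lemma avg_orthogonal: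
  assumes f: "f \<in> L2 \<Omega>" and v: "v \<in> U_space \<Omega> \<T>"
  shows "l2_inner \<Omega> (\<lambda>x. f x - pc \<T> (avg f) x) v = 0"
proof -
  obtain b where b: "ae_eq \<Omega> v (pc \<T> b)" by (rule U_space_pc[OF v]) (rule that)
  have d: "(\<lambda>x. f x - pc \<T> (avg f) x) \<in> L2 \<Omega>" using f pc_L2 by (rule L2_diff)
  have "l2_inner \<Omega> (\<lambda>x. f x - pc \<T> (avg f) x) v = l2_inner \<Omega> (\<lambda>x. f x - pc \<T> (avg f) x) (pc \<T> b)"
    using b d[THEN L2_measurable] pc_measurable U_space_L2[OF v, THEN L2_measurable]
    by (intro l2_inner_ae_cong) auto
  then show ?thesis using f by (simp add: l2_inner_diff_left pc_L2 l2_inner_pc_avg)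
qed

text \<open>The element averages are a witness for the choice in \<open>l2_proj\<close>.\<close>

lemma Q_spec:
  assumes f: "f \<in> L2 \<Omega>"
  shows "Q \<Omega> \<T> f \<in> U_space \<Omega> \<T>" "v \<in> U_space \<Omega> \<T> \<Longrightarrow> l2_inner \<Omega> (\<lambda>x. f x - Q \<Omega> \<T> f x) v = 0"
proof -
  have "Q \<Omega> \<T> f \<in> U_space \<Omega> \<T> \<and> (\<forall>v\<in>U_space \<Omega> \<T>. l2_inner \<Omega> (\<lambda>x. f x - Q \<Omega> \<T> f x) v = 0)"
    unfolding Q_def l2_proj_def
    by (rule someI[where x = "pc \<T> (avg f)"]) (use pc_U_space avg_orthogonal[OF f] in auto)
  then show "Q \<Omega> \<T> f \<in> U_space \<Omega> \<T>" "v \<in> U_space \<Omega> \<T> \<Longrightarrow> l2_inner \<Omega> (\<lambda>x. f x - Q \<Omega> \<T> f x) v = 0"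
    by auto
qed

lemma Q_L2: "f \<in> L2 \<Omega> \<Longrightarrow> Q \<Omega> \<T> f \<in> L2 \<Omega>"
  by (rule U_space_L2[OF Q_spec(1)])

text \<open>Orthogonality leaves no freedom beyond null sets: pairing with the function that is 1 on
  \<open>T\<close> and 0 on the other simplices isolates the coefficient at
  \<open>T\<close>.\<close>

lemma Q_ae:
  assumes f: "f \<in> L2 \<Omega>" shows "ae_eq \<Omega> (Q \<Omega> \<T> f) (pc \<T> (avg f))"
proof -
  obtain a where a: "ae_eq \<Omega> (Q \<Omega> \<T> f) (pc \<T> a)" by (rule U_space_pc[OF Q_spec(1)[OF f]]) (rule that)
  have q: "Q \<Omega> \<T> f \<in> L2 \<Omega>" using f by (rule Q_L2)
  have eq: "l2_inner \<Omega> (pc \<T> a) (pc \<T> b) = l2_inner \<Omega> (pc \<T> (avg f)) (pc \<T> b)" for b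
  proof -
    have "l2_inner \<Omega> (pc \<T> a) (pc \<T> b) = l2_inner \<Omega> (Q \<Omega> \<T> f) (pc \<T> b)"
      using a q[THEN L2_measurable] pc_measurable by (intro l2_inner_ae_cong) auto
    also have "\<dots> = l2_inner \<Omega> f (pc \<T> b)"
      using Q_spec(2)[OF f pc_U_space, of b] by (simp add: l2_inner_diff_left f q pc_L2)
    finally show ?thesis by (simp add: l2_inner_pc_avg f)
  qed
  have "a T = avg f T" if T: "T \<in> \<T>" for T
  proof -
    have "(\<Sum>S\<in>\<T>. c S * (if S = T then 1 else 0) * measure lebesgue S) = c T * measure lebesgue T" for c :: "'a set \<Rightarrow> real"
      using T finite_\<T> by (subst sum.remove[of _ T]) (auto intro!: sum.neutral)
    then show ?thesis using eq[of "\<lambda>S. if S = T then 1 else 0"] measure_pos[OF T]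
      by (simp add: l2_inner_pc_pc)
  qed
  then have "pc \<T> a = pc \<T> (avg f)" by (rule pc_cong)
  with a show ?thesis by simp
qed

lemma avg_ae_cong:
  assumes f: "f \<in> L2 \<Omega>" and g: "g \<in> L2 \<Omega>" and ae: "ae_eq \<Omega> f g" and T: "T \<in> \<T>"
  shows "avg f T = avg g T"
proof -
  have "l2_inner \<Omega> f (pc \<T> (\<lambda>S. if S = T then 1 else 0)) = l2_inner \<Omega> g (pc \<T> (\<lambda>S. if S = T then 1 else 0))"
    using ae f g pc_measurable by (intro l2_inner_ae_cong) (auto dest: L2_measurable)
  moreover have "(\<Sum>S\<in>\<T>. (if S = T then 1 else 0) * (LINT x|lebesgue_on (interior S). h x)) = (LINT x|lebesgue_on (interior T). h x)" for h :: "'a \<Rightarrow> real"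
    using T finite_\<T> by (subst sum.remove[of _ T]) (auto intro!: sum.neutral)
  ultimately show ?thesis unfolding l2_inner_pc[OF f] l2_inner_pc[OF g] avg_def by simp
qed

lemma Q_ae_cong:
  assumes "f \<in> L2 \<Omega>" "g \<in> L2 \<Omega>" "ae_eq \<Omega> f g" shows "ae_eq \<Omega> (Q \<Omega> \<T> f) (Q \<Omega> \<T> g)"
proof -
  have eq: "pc \<T> (avg f) = pc \<T> (avg g)" using avg_ae_cong[OF assms] by (rule pc_cong)
  show ?thesis using Q_ae[OF assms(1)] Q_ae[OF assms(2)] unfolding eq by eventually_elim simp
qed

lemma Q_pc: "ae_eq \<Omega> (Q \<Omega> \<T> (pc \<T> a)) (pc \<T> a)"
  using Q_ae[OF pc_L2, of a] pc_cong[of "avg (pc \<T> a)" a] by (simp add: avg_pc)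

lemma interior_L2_integrable:
  assumes "f \<in> L2 \<Omega>" "T \<in> \<T>" shows "integrable (lebesgue_on (interior T)) f"
  by (rule L2_integrable[OF interior_lmeasurable[OF assms(2)] L2_subset[OF assms(1) sets_\<Omega> _ interior_subset_\<Omega>[OF assms(2)]]])
     (simp add: borel_open)

lemma avg_linear:
  assumes "f \<in> L2 \<Omega>" "g \<in> L2 \<Omega>" "T \<in> \<T>"
  shows "avg (\<lambda>x. a * f x + b * g x) T = a * avg f T + b * avg g T"
  unfolding avg_def using assms(1,2)[THEN interior_L2_integrable, OF assms(3)]
  by (simp add: add_divide_distrib)

lemma Q_linear:
  assumes f: "f \<in> L2 \<Omega>" and g: "g \<in> L2 \<Omega>"
  shows "ae_eq \<Omega> (Q \<Omega> \<T> (\<lambda>x. a * f x + b * g x)) (\<lambda>x. a * Q \<Omega> \<T> f x + b * Q \<Omega> \<T> g x)"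
proof -
  have fg: "(\<lambda>x. a * f x + b * g x) \<in> L2 \<Omega>" using f g by (intro L2_add L2_cmult)
  have "pc \<T> (avg (\<lambda>x. a * f x + b * g x)) = pc \<T> (\<lambda>T. a * avg f T + b * avg g T)"
    by (rule pc_cong) (rule avg_linear[OF f g])
  also have "\<dots> = (\<lambda>x. a * pc \<T> (avg f) x + b * pc \<T> (avg g) x)"
    unfolding pc_def by (simp add: fun_eq_iff sum_distrib_left distrib_right sum.distrib mult.assoc)
  finally have eq: "pc \<T> (avg (\<lambda>x. a * f x + b * g x)) = (\<lambda>x. a * pc \<T> (avg f) x + b * pc \<T> (avg g) x)" .
  show ?thesis
    using Q_ae[OF fg] Q_ae[OF f] Q_ae[OF g] unfolding eq by eventually_elim simp
qed

lemma Q_U_space: assumes "u \<in> U_space \<Omega> \<T>" shows "ae_eq \<Omega> (Q \<Omega> \<T> u) u"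
proof -
  obtain a where a: "ae_eq \<Omega> u (pc \<T> a)" by (rule U_space_pc[OF assms]) (rule that)
  then have "ae_eq \<Omega> (Q \<Omega> \<T> u) (Q \<Omega> \<T> (pc \<T> a))"
    using U_space_L2[OF assms] pc_L2 by (intro Q_ae_cong)
  with Q_pc[of a] a show ?thesis by eventually_elim simp
qed

lemma Q_idem: "f \<in> L2 \<Omega> \<Longrightarrow> ae_eq \<Omega> (Q \<Omega> \<T> (Q \<Omega> \<T> f)) (Q \<Omega> \<T> f)"
  by (intro Q_U_space Q_spec(1))

lemma Q_self_adjoint:
  assumes f: "f \<in> L2 \<Omega>" and g: "g \<in> L2 \<Omega>"
  shows "l2_inner \<Omega> (Q \<Omega> \<T> f) g = l2_inner \<Omega> f (Q \<Omega> \<T> g)"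
proof -
  note q = Q_L2[OF f] Q_L2[OF g]
  have "l2_inner \<Omega> f (Q \<Omega> \<T> g) = l2_inner \<Omega> (Q \<Omega> \<T> f) (Q \<Omega> \<T> g)"
    using Q_spec(2)[OF f Q_spec(1)[OF g]] by (simp add: l2_inner_diff_left f q)
  moreover have "l2_inner \<Omega> g (Q \<Omega> \<T> f) = l2_inner \<Omega> (Q \<Omega> \<T> g) (Q \<Omega> \<T> f)"
    using Q_spec(2)[OF g Q_spec(1)[OF f]] by (simp add: l2_inner_diff_left g q)
  ultimately show ?thesis
    by (simp add: l2_inner_commute[of _ "Q \<Omega> \<T> f"])
qed

lemma Q_contraction: assumes f: "f \<in> L2 \<Omega>" shows "l2_norm \<Omega> (Q \<Omega> \<T> f) \<le> l2_norm \<Omega> f"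
proof (rule power2_le_imp_le)
  note q = Q_L2[OF f]
  have d: "(\<lambda>x. f x - Q \<Omega> \<T> f x) \<in> L2 \<Omega>" using f q by (rule L2_diff)
  have "(l2_norm \<Omega> (\<lambda>x. (f x - Q \<Omega> \<T> f x) + Q \<Omega> \<T> f x))\<^sup>2 =
      (l2_norm \<Omega> (\<lambda>x. f x - Q \<Omega> \<T> f x))\<^sup>2 + (l2_norm \<Omega> (Q \<Omega> \<T> f))\<^sup>2"
    by (rule l2_norm_pythagoras[OF d q Q_spec(2)[OF f Q_spec(1)[OF f]]])
  then show "(l2_norm \<Omega> (Q \<Omega> \<T> f))\<^sup>2 \<le> (l2_norm \<Omega> f)\<^sup>2" by simp
qed simp

text \<open>Self-adjointness makes \<open>Q\<close> applied to \<open>w\<close> a witness for the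
  choice, and testing the defining identity with the difference of the two shows that they agree
  almost everywhere. On L_2 the adjoint thus also takes element averages.\<close>

lemma dual_adjoint_Q:
  assumes w: "w \<in> L2 \<Omega>" shows "dual_adjoint \<Omega> (Q \<Omega> \<T>) w \<in> L2 \<Omega>" "ae_eq \<Omega> (dual_adjoint \<Omega> (Q \<Omega> \<T>) w) (pc \<T> (avg w))"
proof -
  let ?g = "dual_adjoint \<Omega> (Q \<Omega> \<T>) w"
  have *: "?g \<in> L2 \<Omega> \<and> (\<forall>f\<in>L2 \<Omega>. l2_inner \<Omega> ?g f = l2_inner \<Omega> (Q \<Omega> \<T> f) w)"
    unfolding dual_adjoint_def
    by (rule someI[where x = "Q \<Omega> \<T> w"])
       (use w in \<open>auto simp: Q_L2 Q_self_adjoint l2_inner_commute[of _ "Q \<Omega> \<T> w"]\<close>)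
  then show g: "?g \<in> L2 \<Omega>" by simp
  define e where "e x = ?g x - Q \<Omega> \<T> w x" for x
  have e: "e \<in> L2 \<Omega>" unfolding e_def using g Q_L2[OF w] by (rule L2_diff)
  have "l2_inner \<Omega> ?g e = l2_inner \<Omega> (Q \<Omega> \<T> w) e"
    using * e w by (simp add: Q_self_adjoint l2_inner_commute[of _ w])
  then have "l2_inner \<Omega> e e = 0"
    using l2_inner_diff_left[OF g Q_L2[OF w] e] by (simp add: e_def[abs_def])
  then have "ae_eq \<Omega> e (\<lambda>x. 0)" using e by (intro l2_norm_eq_0_imp_ae) (auto simp: l2_norm_def)
  with Q_ae[OF w] show "ae_eq \<Omega> ?g (pc \<T> (avg w))" unfolding e_def by eventually_elim simp
qed

lemma U_space_subspace: "l2_subspace \<Omega> (U_space \<Omega> \<T>)"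
  unfolding l2_subspace_def
proof (intro conjI ballI allI)
  show "U_space \<Omega> \<T> \<subseteq> L2 \<Omega>" by (auto simp: U_space_def)
  show "(\<lambda>x. 0) \<in> U_space \<Omega> \<T>" by (auto simp: U_space_def)
next
  fix f g assume fg: "f \<in> U_space \<Omega> \<T>" "g \<in> U_space \<Omega> \<T>"
  have "\<exists>c. AE x in lebesgue_on \<Omega>. x \<in> T \<longrightarrow> f x + g x = c" if T: "T \<in> \<T>" for T
  proof -
    obtain c d where c: "AE x in lebesgue_on \<Omega>. x \<in> T \<longrightarrow> f x = c" and d: "AE x in lebesgue_on \<Omega>. x \<in> T \<longrightarrow> g x = d"
      using fg T unfolding U_space_def by blast
    from c d have "AE x in lebesgue_on \<Omega>. x \<in> T \<longrightarrow> f x + g x = c + d" by eventually_elim simp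
    then show ?thesis by blast
  qed
  then show "(\<lambda>x. f x + g x) \<in> U_space \<Omega> \<T>"
    using L2_add[OF fg[THEN U_space_L2]] unfolding U_space_def by simp
next
  fix f a assume f: "f \<in> U_space \<Omega> \<T>"
  have "\<exists>c. AE x in lebesgue_on \<Omega>. x \<in> T \<longrightarrow> a * f x = c" if T: "T \<in> \<T>" for T
  proof -
    obtain c where c: "AE x in lebesgue_on \<Omega>. x \<in> T \<longrightarrow> f x = c"
      using f T unfolding U_space_def by blast
    from c have "AE x in lebesgue_on \<Omega>. x \<in> T \<longrightarrow> a * f x = a * c" by eventually_elim simp
    then show ?thesis by blast
  qed
  then show "(\<lambda>x. a * f x) \<in> U_space \<Omega> \<T>"
    using L2_cmult[OF U_space_L2[OF f]] unfolding U_space_def by simp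
qed

end

section \<open>Red-refinement\<close>

text \<open>Distinct vertices own distinct children, so on a child the sum of the
  \<open>c v * of_bool (P v S)\<close> is a single coefficient or 0. Call it \<open>e S\<close>: its
  sum over the children is \<open>s\<close>, the sum of its squares is \<open>q\<close>, and
  expanding \<open>(2 n e - 2 s)\<^sup>2\<close> gives
  \<open>4 n\<^sup>2 q - 8 n s\<^sup>2 + 4 n s\<^sup>2\<close>.\<close>

lemma sum_square_corners:
  fixes c :: "'v \<Rightarrow> real" and n :: real
  assumes C: "finite C" "real (card C) = n" and A: "finite A"
    and one: "\<And>v. v \<in> A \<Longrightarrow> card {S\<in>C. P v S} = 1"
    and disj: "\<And>v u S. v \<in> A \<Longrightarrow> u \<in> A \<Longrightarrow> S \<in> C \<Longrightarrow> P v S \<Longrightarrow> P u S \<Longrightarrow> v = u"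
  shows "(\<Sum>S\<in>C. (\<Sum>v\<in>A. c v * (2 * n * of_bool (P v S) - 2))\<^sup>2) =
    4 * n * (n * (\<Sum>v\<in>A. (c v)\<^sup>2) - (\<Sum>v\<in>A. c v)\<^sup>2)"
proof -
  define e where "e S = (\<Sum>v\<in>A. c v * of_bool (P v S))" for S
  define s where "s = (\<Sum>v\<in>A. c v)"
  define q where "q = (\<Sum>v\<in>A. (c v)\<^sup>2)"
  have cnt: "(\<Sum>S\<in>C. of_bool (P v S)) = (1::real)" if "v \<in> A" for v
    using one[OF that] C(1) by (simp add: Int_def)
  have e1: "(\<Sum>S\<in>C. e S) = s"
    unfolding e_def s_def by (subst sum.swap) (simp add: cnt flip: sum_distrib_left)
  have sq: "(e S)\<^sup>2 = (\<Sum>v\<in>A. (c v)\<^sup>2 * of_bool (P v S))" if "S \<in> C" for S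
    unfolding e_def power2_eq_square
    by (subst sum_mult_sum_diagonal[OF A]) (use disj that in \<open>auto intro!: sum.cong\<close>)
  have e2: "(\<Sum>S\<in>C. (e S)\<^sup>2) = q"
    unfolding q_def by (simp add: sq) (subst sum.swap, simp add: cnt flip: sum_distrib_left)
  have lin: "(\<Sum>v\<in>A. c v * (2 * n * of_bool (P v S) - 2)) = 2 * n * e S - 2 * s" for S
    unfolding e_def s_def by (simp add: algebra_simps sum_subtractf sum_distrib_left sum_distrib_right)
  have "(\<Sum>S\<in>C. (\<Sum>v\<in>A. c v * (2 * n * of_bool (P v S) - 2))\<^sup>2) =
      (\<Sum>S\<in>C. 4 * n\<^sup>2 * (e S)\<^sup>2 - 8 * n * s * e S + 4 * s\<^sup>2)"
    unfolding lin by (simp add: power2_eq_square algebra_simps)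
  also have "\<dots> = 4 * n\<^sup>2 * q - 8 * n * s * s + 4 * n * s\<^sup>2"
    by (simp add: sum.distrib sum_subtractf C(2) e1 e2 flip: sum_distrib_left)
  also have "\<dots> = 4 * n * (n * q - s\<^sup>2)" by (simp add: power2_eq_square algebra_simps)
  finally show ?thesis unfolding q_def s_def .
qed

lemma finite_extreme_points_simplex:
  assumes "n simplex T" shows "finite {v. v extreme_point_of T}" "int (card {v. v extreme_point_of T}) \<le> n + 1"
proof -
  obtain C where C: "finite C" "int (card C) = n + 1" "T = convex hull C"
    using assms unfolding Polytope.simplex by blast
  have sub: "{v. v extreme_point_of T} \<subseteq> C"
    unfolding C(3) using extreme_point_of_convex_hull by blast
  show "finite {v. v extreme_point_of T}" using sub C(1) by (rule finite_subset)
  show "int (card {v. v extreme_point_of T}) \<le> n + 1" using card_mono[OF C(1) sub] C(2) by linarith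
qed

locale red_partition = partition \<Omega> \<T> for \<Omega> :: "'a::euclidean_space set" and \<T> :: "'a set set" +
  fixes \<S> :: "'a set set" and \<gamma> :: "'a set"
  assumes conforming: "conforming \<T>" and red: "red_refinement \<Omega> \<T> \<S>"
begin

sublocale S: partition \<Omega> \<S>
  by unfold_locales (use red in \<open>simp add: red_refinement_def\<close>)

definition children :: "'a set \<Rightarrow> 'a set set" where "children T = {S\<in>\<S>. S \<subseteq> T}"

abbreviation N :: "'a set" where "N \<equiv> free_vertices \<gamma> \<T>"

lemma exists_parent: "S \<in> \<S> \<Longrightarrow> \<exists>T\<in>\<T>. S \<subseteq> T"
  using red by (auto simp: red_refinement_def)

lemma finite_children: "finite (children T)" using S.finite_\<T> by (simp add: children_def)

lemma children:
  assumes "T \<in> \<T>"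
  shows card_children: "card (children T) = 2 ^ DIM('a)"
    and measure_child: "S \<in> children T \<Longrightarrow> measure lebesgue S = measure lebesgue T / 2 ^ DIM('a)"
    and corner: "v extreme_point_of T \<Longrightarrow> {S\<in>children T. v \<in> S} = {(\<lambda>x. v + (1/2) *\<^sub>R (x - v)) ` T}"
  using red assms unfolding red_refinement_def Let_def children_def by auto

lemma parent_unique:
  assumes "S \<in> \<S>" "S \<subseteq> T" "S \<subseteq> T'" "T \<in> \<T>" "T' \<in> \<T>" shows "T = T'"
proof -
  obtain x where x: "x \<in> interior S" using S.interior_nonempty[OF assms(1)] by blast
  then have "x \<in> interior T" "x \<in> T'" using assms(2,3) interior_mono interior_subset by blast+
  then show ?thesis using interior_unique assms by blast
qed

definition parent :: "'a set \<Rightarrow> 'a set" where "parent S = (THE T. T \<in> \<T> \<and> S \<subseteq> T)"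

lemma parent: assumes "S \<in> \<S>" shows "parent S \<in> \<T>" "S \<subseteq> parent S"
proof -
  have "\<exists>!T. T \<in> \<T> \<and> S \<subseteq> T" using exists_parent[OF assms] parent_unique[OF assms] by blast
  from theI'[OF this] show "parent S \<in> \<T>" "S \<subseteq> parent S" unfolding parent_def by auto
qed

lemma parent_eq: "S \<in> \<S> \<Longrightarrow> T \<in> \<T> \<Longrightarrow> S \<subseteq> T \<Longrightarrow> parent S = T"
  using parent[of S] parent_unique by blast

lemma children_eq: "T \<in> \<T> \<Longrightarrow> children T = {S\<in>\<S>. parent S = T}"
  unfolding children_def using parent parent_eq by blast

lemma sum_children: "(\<Sum>S\<in>\<S>. f S) = (\<Sum>T\<in>\<T>. \<Sum>S\<in>children T. f S)" for f :: "'a set \<Rightarrow> real"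
proof -
  have "(\<Sum>T\<in>\<T>. \<Sum>S\<in>children T. f S) = (\<Sum>T\<in>\<T>. \<Sum>S\<in>{S\<in>\<S>. parent S = T}. f S)"
    by (intro sum.cong) (auto simp: children_eq)
  also have "\<dots> = (\<Sum>S\<in>\<S>. f S)"
    by (rule sum.group) (use S.finite_\<T> finite_\<T> parent(1) in auto)
  finally show ?thesis ..
qed

lemma interior_parent: "S \<in> \<S> \<Longrightarrow> x \<in> interior S \<Longrightarrow> x \<in> interior (parent S)"
  using parent(2) interior_mono by blast

lemma finite_N: "finite N"
proof -
  have "N \<subseteq> (\<Union>T\<in>\<T>. {v. v extreme_point_of T})" by (auto simp: free_vertices_def)
  then show ?thesis
    using finite_\<T> simplex finite_extreme_points_simplex(1) by (elim finite_subset) auto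
qed

text \<open>Conformity excludes hanging nodes: \<open>v\<close> is extreme in the intersection with
  the simplex it came from, which is a face of \<open>T\<close>, and extreme points of a face are
  extreme.\<close>

lemma vertex: assumes "v \<in> N" "T \<in> \<T>" "v \<in> T" shows "v extreme_point_of T"
proof -
  obtain T' where T': "T' \<in> \<T>" "v extreme_point_of T'" using assms(1) by (auto simp: free_vertices_def)
  then have "v \<in> T'" by (simp add: extreme_point_of_def)
  have f: "T \<inter> T' face_of T" using conforming assms(2) T'(1) by (simp add: conforming_def)
  have "v extreme_point_of (T \<inter> T')"
    using T'(2) \<open>v \<in> T'\<close> assms(3) unfolding extreme_point_of_def by auto
  then show ?thesis using extreme_point_of_face[OF f] by blast
qed

lemma vertices_subset: "T \<in> \<T> \<Longrightarrow> N \<inter> T \<subseteq> {v. v extreme_point_of T}"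
  using vertex by blast

lemma card_vertices: assumes "T \<in> \<T>" shows "card (N \<inter> T) \<le> DIM('a) + 1"
  using card_mono[OF finite_extreme_points_simplex(1)[OF simplex[OF assms]] vertices_subset[OF assms]]
    finite_extreme_points_simplex(2)[OF simplex[OF assms]] by linarith

lemma one_corner: assumes "T \<in> \<T>" "v \<in> N" "v \<in> T" shows "card {S\<in>children T. v \<in> S} = 1"
  using corner[OF assms(1) vertex[OF assms(2,1,3)]] by simp

text \<open>The child at \<open>v\<close> is \<open>T\<close> shrunk by one half towards
  \<open>v\<close>. A second vertex \<open>u\<close> in it would be the midpoint of \<open>v\<close>
  and a point of \<open>T\<close>, and so not extreme.\<close>

lemma corners_distinct:
  assumes T: "T \<in> \<T>" and v: "v \<in> N" and u: "u \<in> N" and S: "S \<in> children T" "v \<in> S" "u \<in> S"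
  shows "v = u"
proof (rule ccontr)
  assume neq: "v \<noteq> u"
  have ST: "S \<subseteq> T" using S(1) by (simp add: children_def)
  have e: "v extreme_point_of T" "u extreme_point_of T"
    using v u S(2,3) ST T by (auto intro!: vertex)
  have "S \<in> {S\<in>children T. v \<in> S}" using S by simp
  then have "S = (\<lambda>x. v + (1/2) *\<^sub>R (x - v)) ` T" unfolding corner[OF T e(1)] by simp
  with S(3) obtain x where x: "x \<in> T" "u = v + (1/2) *\<^sub>R (x - v)" by blast
  then have m: "u = midpoint v x"
  proof -
    have "u = ((1/2) *\<^sub>R v + (1/2) *\<^sub>R v) + (1/2) *\<^sub>R (x - v)"
      using x(2) scaleR_half_double[of v] by (simp only: scaleR_right_distrib)
    then show ?thesis by (simp add: midpoint_def scaleR_diff_right scaleR_right_distrib)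
  qed
  have "x \<noteq> v" using neq x(2) by auto
  then have "u \<in> open_segment v x" unfolding m by (simp add: midpoint_in_open_segment)
  moreover have "v \<in> T" using S(2) ST by blast
  ultimately show False using e(2) x(1) unfolding extreme_point_of_def by blast
qed

section \<open>Coefficients of psi and theta on the refinement\<close>

lemma patch_interior:
  assumes "S \<in> \<S>" "x \<in> interior S"
  shows "indicator (patch \<S> v) x = (of_bool (v \<in> S) :: real)"
    "indicator (patch \<T> v) x = (of_bool (v \<in> parent S) :: real)"
proof -
  have "S' = S" if "S' \<in> \<S>" "x \<in> S'" for S' using S.interior_unique[OF assms(1) that(1) assms(2) that(2)] by simp
  then show "indicator (patch \<S> v) x = (of_bool (v \<in> S) :: real)"
    using assms interior_subset unfolding patch_def indicator_def by auto
  have x: "x \<in> interior (parent S)" by (rule interior_parent[OF assms])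
  have "T = parent S" if "T \<in> \<T>" "x \<in> T" for T
    using interior_unique[OF parent(1)[OF assms(1)] that(1) x that(2)] by simp
  then show "indicator (patch \<T> v) x = (of_bool (v \<in> parent S) :: real)"
    using x interior_subset parent(1)[OF assms(1)] unfolding patch_def indicator_def by auto
qed

definition psi_coeff :: "'a \<Rightarrow> 'a set \<Rightarrow> real" where
  "psi_coeff v S = 2 * 2 ^ DIM('a) * of_bool (v \<in> S) - of_bool (v \<in> parent S)"

definition theta_coeff :: "'a \<Rightarrow> 'a set \<Rightarrow> real" where
  "theta_coeff v S = 2 * 2 ^ DIM('a) * of_bool (v \<in> S) - 2 * of_bool (v \<in> parent S)"

lemma psi_ae: "ae_eq \<Omega> (psi \<T> \<S> v) (pc \<S> (psi_coeff v))"
  by (rule S.ae_eqI) (simp add: psi_def psi_coeff_def patch_interior S.pc_interior)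

lemma patch_measurable: "(indicator (patch \<T> v) :: 'a \<Rightarrow> real) \<in> borel_measurable (lebesgue_on \<Omega>)"
  and patch_measurable': "(indicator (patch \<S> v) :: 'a \<Rightarrow> real) \<in> borel_measurable (lebesgue_on \<Omega>)"
proof -
  have "patch \<T> v \<in> sets lebesgue" "patch \<S> v \<in> sets lebesgue"
    unfolding patch_def using finite_\<T> S.finite_\<T> compact S.compact
    by (auto intro!: sets.finite_Union simp: compact_imp_closed borel_closed)
  then show "(indicator (patch \<T> v) :: 'a \<Rightarrow> real) \<in> borel_measurable (lebesgue_on \<Omega>)"
    "(indicator (patch \<S> v) :: 'a \<Rightarrow> real) \<in> borel_measurable (lebesgue_on \<Omega>)"
    by (auto intro: measurable_restrict_space1)
qed

lemma psi_L2: "psi \<T> \<S> v \<in> L2 \<Omega>"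
proof (rule L2_ae_cong[OF S.pc_L2 ae_eq_sym[OF psi_ae]])
  show "psi \<T> \<S> v \<in> borel_measurable (lebesgue_on \<Omega>)"
    unfolding psi_def[abs_def] using patch_measurable patch_measurable' by simp
qed

lemma measure_children_sum: "T \<in> \<T> \<Longrightarrow> (\<Sum>S\<in>children T. f S * measure lebesgue S) = (\<Sum>S\<in>children T. f S) * (measure lebesgue T / 2 ^ DIM('a))"
  by (simp add: measure_child sum_distrib_right sum_divide_distrib)

text \<open>Children have equal volume, so the mean over \<open>T\<close> is the arithmetic mean of
  their values. The proof pairs with the indicator of \<open>T\<close>, rewritten on the
  refinement.\<close>

lemma avg_pc_children:
  assumes T: "T \<in> \<T>" shows "avg (pc \<S> a) T = (\<Sum>S\<in>children T. a S) / 2 ^ DIM('a)"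
proof -
  let ?b = "\<lambda>T'. if T' = T then 1 else 0 :: real"
  have par: "ae_eq \<Omega> (pc \<T> ?b) (pc \<S> (\<lambda>S. ?b (parent S)))"
    by (rule S.ae_eqI) (simp add: S.pc_interior pc_interior[OF parent(1) interior_parent])
  have "(LINT x|lebesgue_on (interior T). pc \<S> a x) = l2_inner \<Omega> (pc \<S> a) (pc \<T> ?b)"
    unfolding l2_inner_pc[OF S.pc_L2] using T finite_\<T> by (subst sum.remove[of _ T]) (auto intro!: sum.neutral)
  also have "\<dots> = l2_inner \<Omega> (pc \<S> a) (pc \<S> (\<lambda>S. ?b (parent S)))"
    using par pc_measurable by (intro l2_inner_ae_cong) auto
  also have "\<dots> = (\<Sum>T'\<in>\<T>. \<Sum>S\<in>children T'. a S * ?b (parent S) * measure lebesgue S)"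
    unfolding S.l2_inner_pc_pc by (rule sum_children)
  also have "\<dots> = (\<Sum>T'\<in>\<T>. if T' = T then (\<Sum>S\<in>children T. a S * measure lebesgue S) else 0)"
    by (intro sum.cong refl) (auto simp: children_eq intro!: sum.neutral sum.cong)
  also have "\<dots> = (\<Sum>S\<in>children T. a S) * (measure lebesgue T / 2 ^ DIM('a))"
    using T finite_\<T> by (simp add: measure_children_sum)
  finally show ?thesis unfolding avg_def using measure_pos[OF T] by simp
qed

text \<open>Exactly one child contains a vertex \<open>v\<close> of \<open>T\<close>, which leaves
  \<open>2 * 2 ^ d - 2 ^ d\<close>; division by the number of children gives mean 1.\<close>

lemma sum_psi_coeff:
  assumes T: "T \<in> \<T>" and v: "v \<in> N" shows "(\<Sum>S\<in>children T. psi_coeff v S) = 2 ^ DIM('a) * of_bool (v \<in> T)"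
proof -
  have "(\<Sum>S\<in>children T. psi_coeff v S) = 2 * 2 ^ DIM('a) * (\<Sum>S\<in>children T. of_bool (v \<in> S)) - (\<Sum>S\<in>children T. of_bool (v \<in> T))"
    unfolding psi_coeff_def sum_subtractf sum_distrib_left by (simp add: children_eq[OF T])
  also have "(\<Sum>S\<in>children T. of_bool (v \<in> S)) = (of_bool (v \<in> T) :: real)"
  proof (cases "v \<in> T")
    case True
    then show ?thesis using one_corner[OF T v] finite_children[of T] by (simp add: Int_def)
  next
    case False
    then show ?thesis by (auto simp: children_def intro!: sum.neutral)
  qed
  finally show ?thesis by (simp add: card_children[OF T])
qed

lemma Q_psi:
  assumes v: "v \<in> N" shows "ae_eq \<Omega> (Q \<Omega> \<T> (psi \<T> \<S> v)) (indicator (patch \<T> v))"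
proof -
  have "avg (psi \<T> \<S> v) T = of_bool (v \<in> T)" if "T \<in> \<T>" for T
    using avg_ae_cong[OF psi_L2 S.pc_L2 psi_ae that] avg_pc_children[OF that] sum_psi_coeff[OF that v] by simp
  then have eq: "pc \<T> (avg (psi \<T> \<S> v)) = pc \<T> (\<lambda>T. of_bool (v \<in> T))" by (rule pc_cong)
  have "ae_eq \<Omega> (pc \<T> (\<lambda>T. of_bool (v \<in> T))) (indicator (patch \<T> v))"
    by (rule S.ae_eqI) (simp add: patch_interior pc_interior[OF parent(1) interior_parent])
  with Q_ae[OF psi_L2, of v] show ?thesis unfolding eq by (rule ae_eq_trans)
qed

lemma theta_L2: "theta \<Omega> \<T> \<S> v \<in> L2 \<Omega>"
  unfolding theta_def[abs_def] by (intro L2_diff Q_L2 psi_L2)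

lemma theta_ae:
  assumes v: "v \<in> N" shows "ae_eq \<Omega> (theta \<Omega> \<T> \<S> v) (pc \<S> (theta_coeff v))"
  using Q_psi[OF v] psi_ae[of v] S.AE_interior
proof eventually_elim
  case (elim x)
  then obtain S where "S \<in> \<S>" "x \<in> interior S" by blast
  then show ?case
    using elim by (simp add: theta_def S.pc_interior patch_interior psi_coeff_def theta_coeff_def)
qed

lemma theta_sum_ae: "ae_eq \<Omega> (\<lambda>x. \<Sum>v\<in>N. c v * theta \<Omega> \<T> \<S> v x) (pc \<S> (\<lambda>S. \<Sum>v\<in>N. c v * theta_coeff v S))"
proof -
  have "AE x in lebesgue_on \<Omega>. \<forall>v\<in>N. theta \<Omega> \<T> \<S> v x = pc \<S> (theta_coeff v) x"
    using finite_N theta_ae by (intro AE_finite_allI)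
  with S.AE_interior show ?thesis
  proof eventually_elim
    case (elim x)
    then obtain S where "S \<in> \<S>" "x \<in> interior S" by blast
    then show ?case using elim(2) by (simp add: S.pc_interior)
  qed
qed

section \<open>Weighted norms and stability of the functions theta\<close>

lemma mesh_size_interior: "S \<in> \<S> \<Longrightarrow> x \<in> interior S \<Longrightarrow> mesh_size \<T> x = simplex_size (parent S)"
  unfolding mesh_size_pc by (rule pc_interior[OF parent(1) interior_parent])

lemma mesh_size_measurable: "mesh_size \<T> \<in> borel_measurable (lebesgue_on \<Omega>)"
  unfolding mesh_size_pc by (rule pc_measurable)

lemma theta_sum_L2: "(\<lambda>x. \<Sum>v\<in>N. c v * theta \<Omega> \<T> \<S> v x) \<in> L2 \<Omega>"
  by (intro L2_sum L2_cmult theta_L2)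

text \<open>The factor \<open>4 n\<close> of \<open>sum_square_corners\<close> times the volume of a
  child, which is the volume of \<open>T\<close> divided by \<open>n\<close>, times the squared mesh
  factor.\<close>

definition weight :: "real \<Rightarrow> 'a set \<Rightarrow> real" where
  "weight s T = 4 * (simplex_size T powr s)\<^sup>2 * measure lebesgue T"

lemma weight_pos: "T \<in> \<T> \<Longrightarrow> 0 < weight s T"
  unfolding weight_def using measure_pos simplex_size_pos[of T] by simp

text \<open>Mesh factor and child volume are constant over the children of one simplex, so the norm
  is an exact sum of local quadratic forms in the coefficients.\<close>

lemma norm_theta_sum:
  "(l2_norm \<Omega> (\<lambda>x. mesh_size \<T> x powr s * (\<Sum>v\<in>N. c v * theta \<Omega> \<T> \<S> v x)))\<^sup>2 =
    (\<Sum>T\<in>\<T>. weight s T * (2 ^ DIM('a) * (\<Sum>v\<in>N \<inter> T. (c v)\<^sup>2) - (\<Sum>v\<in>N \<inter> T. c v)\<^sup>2))"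
proof -
  let ?a = "\<lambda>S. simplex_size (parent S) powr s * (\<Sum>v\<in>N. c v * theta_coeff v S)"
  have "ae_eq \<Omega> (\<lambda>x. mesh_size \<T> x powr s * (\<Sum>v\<in>N. c v * theta \<Omega> \<T> \<S> v x)) (pc \<S> ?a)"
    using theta_sum_ae[of c] S.AE_interior
  proof eventually_elim
    case (elim x)
    then obtain S where "S \<in> \<S>" "x \<in> interior S" by blast
    then show ?case unfolding elim(1) by (simp add: S.pc_interior mesh_size_interior)
  qed
  then have "(l2_norm \<Omega> (\<lambda>x. mesh_size \<T> x powr s * (\<Sum>v\<in>N. c v * theta \<Omega> \<T> \<S> v x)))\<^sup>2 = (l2_norm \<Omega> (pc \<S> ?a))\<^sup>2"
    using mesh_size_measurable theta_sum_L2[of c, THEN L2_measurable] pc_measurable by (subst l2_norm_ae_cong) auto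
  also have "\<dots> = (\<Sum>T\<in>\<T>. \<Sum>S\<in>children T. (?a S)\<^sup>2 * measure lebesgue S)"
    unfolding S.l2_norm_pc by (rule sum_children)
  also have "\<dots> = (\<Sum>T\<in>\<T>. weight s T * (2 ^ DIM('a) * (\<Sum>v\<in>N \<inter> T. (c v)\<^sup>2) - (\<Sum>v\<in>N \<inter> T. c v)\<^sup>2))"
  proof (intro sum.cong refl)
    fix T assume T: "T \<in> \<T>"
    \<comment> \<open>Children of \<open>T\<close> lie in \<open>T\<close>, so a vertex outside
      \<open>T\<close> contributes nothing there.\<close>
    have co: "(\<Sum>v\<in>N. c v * theta_coeff v S) = (\<Sum>v\<in>N \<inter> T. c v * (2 * 2 ^ DIM('a) * of_bool (v \<in> S) - 2))"
      if S: "S \<in> children T" for S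
    proof -
      have p: "S \<subseteq> T" "parent S = T" using S parent_eq[OF _ T] by (auto simp: children_def)
      have "(\<Sum>v\<in>N. c v * theta_coeff v S) = (\<Sum>v\<in>N \<inter> T. c v * theta_coeff v S)"
        using finite_N p by (intro sum.mono_neutral_right) (auto simp: theta_coeff_def)
      then show ?thesis using p by (simp add: theta_coeff_def)
    qed
    have "(\<Sum>S\<in>children T. (?a S)\<^sup>2 * measure lebesgue S) =
        (\<Sum>S\<in>children T. (simplex_size T powr s)\<^sup>2 * (\<Sum>v\<in>N \<inter> T. c v * (2 * 2 ^ DIM('a) * of_bool (v \<in> S) - 2))\<^sup>2) * (measure lebesgue T / 2 ^ DIM('a))"
      unfolding measure_children_sum[OF T, symmetric]
      by (intro sum.cong refl) (simp add: co power_mult_distrib children_eq[OF T])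
    also have "\<dots> = (simplex_size T powr s)\<^sup>2 * (\<Sum>S\<in>children T. (\<Sum>v\<in>N \<inter> T. c v * (2 * 2 ^ DIM('a) * of_bool (v \<in> S) - 2))\<^sup>2) * (measure lebesgue T / 2 ^ DIM('a))"
      by (simp add: sum_distrib_left)
    also have "(\<Sum>S\<in>children T. (\<Sum>v\<in>N \<inter> T. c v * (2 * 2 ^ DIM('a) * of_bool (v \<in> S) - 2))\<^sup>2) =
        4 * 2 ^ DIM('a) * (2 ^ DIM('a) * (\<Sum>v\<in>N \<inter> T. (c v)\<^sup>2) - (\<Sum>v\<in>N \<inter> T. c v)\<^sup>2)"
      by (rule sum_square_corners)
         (use finite_children finite_N one_corner[OF T] corners_distinct[OF T] in \<open>auto simp: card_children[OF T]\<close>)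
    finally show "(\<Sum>S\<in>children T. (?a S)\<^sup>2 * measure lebesgue S) =
        weight s T * (2 ^ DIM('a) * (\<Sum>v\<in>N \<inter> T. (c v)\<^sup>2) - (\<Sum>v\<in>N \<inter> T. c v)\<^sup>2)"
      by (simp add: weight_def)
  qed
  finally show ?thesis .
qed

text \<open>The coefficient family that is 1 at \<open>u\<close> and 0 elsewhere makes both local
  sums 1 on each simplex containing \<open>u\<close>, whence \<open>2 ^ d - 1\<close>.\<close>

lemma norm_theta:
  assumes u: "u \<in> N"
  shows "(l2_norm \<Omega> (\<lambda>x. mesh_size \<T> x powr s * theta \<Omega> \<T> \<S> u x))\<^sup>2 =
    (\<Sum>T\<in>\<T>. weight s T * (2 ^ DIM('a) - 1) * of_bool (u \<in> T))"
proof -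
  \<comment> \<open>Stated for \<open>f\<close> to treat the coefficients and their squares at once:
    both maps fix 0 and 1.\<close>
  have d: "(\<Sum>v\<in>A. f (of_bool (v = u)) * g v) = of_bool (u \<in> A) * g u"
    if "finite A" "f 0 = 0" "f 1 = 1" for A :: "'a set" and f :: "real \<Rightarrow> real" and g
    using that by (subst sum.mono_neutral_right[of A "A \<inter> {u}"]) auto
  have "(\<lambda>x. mesh_size \<T> x powr s * theta \<Omega> \<T> \<S> u x) =
      (\<lambda>x. mesh_size \<T> x powr s * (\<Sum>v\<in>N. of_bool (v = u) * theta \<Omega> \<T> \<S> v x))"
    using d[OF finite_N, of "\<lambda>x. x"] u by simp
  then show ?thesis
    using finite_N d[of "N \<inter> _" "\<lambda>x. x\<^sup>2" "\<lambda>_. 1"] d[of "N \<inter> _" "\<lambda>x. x" "\<lambda>_. 1"] u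
    by (simp only: norm_theta_sum) (intro sum.cong; simp add: algebra_simps)
qed

text \<open>Exchanging the sums over vertices and simplices localises this side too, so that
  stability can be checked on one simplex at a time.\<close>

lemma sum_norm_theta:
  "(\<Sum>v\<in>N. \<bar>c v\<bar>\<^sup>2 * (l2_norm \<Omega> (\<lambda>x. mesh_size \<T> x powr s * theta \<Omega> \<T> \<S> v x))\<^sup>2) =
    (\<Sum>T\<in>\<T>. weight s T * ((2 ^ DIM('a) - 1) * (\<Sum>v\<in>N \<inter> T. (c v)\<^sup>2)))"
proof -
  have "(\<Sum>v\<in>N. \<bar>c v\<bar>\<^sup>2 * (l2_norm \<Omega> (\<lambda>x. mesh_size \<T> x powr s * theta \<Omega> \<T> \<S> v x))\<^sup>2) =
      (\<Sum>v\<in>N. \<Sum>T\<in>\<T>. (c v)\<^sup>2 * (weight s T * (2 ^ DIM('a) - 1) * of_bool (v \<in> T)))"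
    by (intro sum.cong) (auto simp: norm_theta sum_distrib_left)
  also have "\<dots> = (\<Sum>T\<in>\<T>. \<Sum>v\<in>N. (c v)\<^sup>2 * (weight s T * (2 ^ DIM('a) - 1) * of_bool (v \<in> T)))"
    by (rule sum.swap)
  also have "\<dots> = (\<Sum>T\<in>\<T>. weight s T * ((2 ^ DIM('a) - 1) * (\<Sum>v\<in>N \<inter> T. (c v)\<^sup>2)))"
  proof (intro sum.cong refl)
    fix T
    have "(\<Sum>v\<in>N. (c v)\<^sup>2 * (weight s T * (2 ^ DIM('a) - 1) * of_bool (v \<in> T))) =
        (\<Sum>v\<in>N \<inter> T. (c v)\<^sup>2 * (weight s T * (2 ^ DIM('a) - 1)))"
      using finite_N by (subst sum.mono_neutral_right[of N "N \<inter> T"]) auto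
    then show "(\<Sum>v\<in>N. (c v)\<^sup>2 * (weight s T * (2 ^ DIM('a) - 1) * of_bool (v \<in> T))) =
        weight s T * ((2 ^ DIM('a) - 1) * (\<Sum>v\<in>N \<inter> T. (c v)\<^sup>2))"
      by (simp add: sum_distrib_left sum_distrib_right mult_ac)
  qed
  finally show ?thesis .
qed

text \<open>Drop the negative square and use \<open>n \<le> 2 (n - 1)\<close>, true for
  \<open>n = 2 ^ d \<ge> 2\<close>.\<close>

lemma theta_upper:
  "(l2_norm \<Omega> (\<lambda>x. mesh_size \<T> x powr s * (\<Sum>v\<in>N. c v * theta \<Omega> \<T> \<S> v x)))\<^sup>2
    \<le> 2 * (\<Sum>v\<in>N. \<bar>c v\<bar>\<^sup>2 * (l2_norm \<Omega> (\<lambda>x. mesh_size \<T> x powr s * theta \<Omega> \<T> \<S> v x))\<^sup>2)"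
proof -
  have "(\<Sum>T\<in>\<T>. weight s T * (2 ^ DIM('a) * (\<Sum>v\<in>N \<inter> T. (c v)\<^sup>2) - (\<Sum>v\<in>N \<inter> T. c v)\<^sup>2))
    \<le> (\<Sum>T\<in>\<T>. 2 * (weight s T * ((2 ^ DIM('a) - 1) * (\<Sum>v\<in>N \<inter> T. (c v)\<^sup>2))))"
  proof (rule sum_mono)
  fix T assume T: "T \<in> \<T>"
  have "(2::real) ^ 1 \<le> 2 ^ DIM('a)" by (rule power_increasing) (auto simp: Suc_leI)
  then have "2 ^ DIM('a) * (\<Sum>v\<in>N \<inter> T. (c v)\<^sup>2) \<le> (2 * (2 ^ DIM('a) - 1)) * (\<Sum>v\<in>N \<inter> T. (c v)\<^sup>2)"
    by (intro mult_right_mono sum_nonneg) auto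
  then have "2 ^ DIM('a) * (\<Sum>v\<in>N \<inter> T. (c v)\<^sup>2) - (\<Sum>v\<in>N \<inter> T. c v)\<^sup>2 \<le> 2 * ((2 ^ DIM('a) - 1) * (\<Sum>v\<in>N \<inter> T. (c v)\<^sup>2))"
    using zero_le_power2[of "\<Sum>v\<in>N \<inter> T. c v"] by linarith
  from mult_left_mono[OF this, of "weight s T"]
  show "weight s T * (2 ^ DIM('a) * (\<Sum>v\<in>N \<inter> T. (c v)\<^sup>2) - (\<Sum>v\<in>N \<inter> T. c v)\<^sup>2)
      \<le> 2 * (weight s T * ((2 ^ DIM('a) - 1) * (\<Sum>v\<in>N \<inter> T. (c v)\<^sup>2)))"
    using weight_pos[OF T, of s] by (simp add: mult.left_commute)
  qed
  then show ?thesis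
    unfolding norm_theta_sum sum_norm_theta by (simp only: sum_distrib_left[symmetric])
qed

text \<open>With at most \<open>d + 1\<close> vertices, \<open>s\<^sup>2 \<le> (d + 1) q\<close>, so
  the local form is at least \<open>(n - d - 1) q \<ge> q\<close>. The constant \<open>n - 1\<close>
  is the one from the norm of a single function.\<close>

lemma theta_lower:
  assumes d: "2 \<le> DIM('a)"
  shows "(\<Sum>v\<in>N. \<bar>c v\<bar>\<^sup>2 * (l2_norm \<Omega> (\<lambda>x. mesh_size \<T> x powr s * theta \<Omega> \<T> \<S> v x))\<^sup>2)
    \<le> (2 ^ DIM('a) - 1) * (l2_norm \<Omega> (\<lambda>x. mesh_size \<T> x powr s * (\<Sum>v\<in>N. c v * theta \<Omega> \<T> \<S> v x)))\<^sup>2"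
proof -
  have "(\<Sum>T\<in>\<T>. weight s T * ((2 ^ DIM('a) - 1) * (\<Sum>v\<in>N \<inter> T. (c v)\<^sup>2)))
    \<le> (\<Sum>T\<in>\<T>. (2 ^ DIM('a) - 1) *
        (weight s T * (2 ^ DIM('a) * (\<Sum>v\<in>N \<inter> T. (c v)\<^sup>2) - (\<Sum>v\<in>N \<inter> T. c v)\<^sup>2)))"
  proof (rule sum_mono)
  fix T assume T: "T \<in> \<T>"
  define q where "q = (\<Sum>v\<in>N \<inter> T. (c v)\<^sup>2)"
  have q: "0 \<le> q" unfolding q_def by (simp add: sum_nonneg)
  have "(\<Sum>v\<in>N \<inter> T. c v * 1)\<^sup>2 \<le> q * (\<Sum>v\<in>N \<inter> T. 1\<^sup>2)"
    unfolding q_def by (rule Cauchy_Schwarz_ineq_sum)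
  also have "\<dots> \<le> q * (real DIM('a) + 1)"
    using card_vertices[OF T] q by (intro mult_left_mono) (auto simp flip: of_nat_Suc)
  finally have s: "(\<Sum>v\<in>N \<inter> T. c v)\<^sup>2 \<le> q * (real DIM('a) + 1)" by simp
  \<comment> \<open>True from d = 2 on, with equality there; for d = 1 it would read 3 \<le>
    2.\<close>
  have "DIM('a) + 2 \<le> 2 ^ DIM('a)"
    using d
  proof (induction rule: dec_induct)
    case (step k) then show ?case by simp
  qed simp
  then have "real (DIM('a) + 2) \<le> real (2 ^ DIM('a))" unfolding of_nat_le_iff .
  then have "1 * q \<le> (2 ^ DIM('a) - (real DIM('a) + 1)) * q" by (intro mult_right_mono q) simp
  then have "q \<le> 2 ^ DIM('a) * q - (\<Sum>v\<in>N \<inter> T. c v)\<^sup>2" using s by (simp add: algebra_simps)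
  from mult_left_mono[OF this, of "weight s T * (2 ^ DIM('a) - 1)"]
  show "weight s T * ((2 ^ DIM('a) - 1) * (\<Sum>v\<in>N \<inter> T. (c v)\<^sup>2))
      \<le> (2 ^ DIM('a) - 1) * (weight s T * (2 ^ DIM('a) * (\<Sum>v\<in>N \<inter> T. (c v)\<^sup>2) - (\<Sum>v\<in>N \<inter> T. c v)\<^sup>2))"
    using weight_pos[OF T, of s] unfolding q_def[symmetric] by (simp add: mult_ac)
  qed
  then show ?thesis
    unfolding norm_theta_sum sum_norm_theta by (simp only: sum_distrib_left[symmetric])
qed

text \<open>The lower bound forces every term of the right-hand sum of squares to vanish, and the
  norm of each single function is positive because its vertex lies in some simplex.\<close>

lemma theta_independent:
  assumes d: "2 \<le> DIM('a)" and z: "ae_eq \<Omega> (\<lambda>x. \<Sum>v\<in>N. c v * theta \<Omega> \<T> \<S> v x) (\<lambda>x. 0)" and u: "u \<in> N"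
  shows "c u = 0"
proof -
  \<comment> \<open>Any exponent would serve, as the weighted combination vanishes along with the
    unweighted one.\<close>
  define s :: real where "s = 0"
  let ?t = "\<lambda>v. \<bar>c v\<bar>\<^sup>2 * (l2_norm \<Omega> (\<lambda>x. mesh_size \<T> x powr s * theta \<Omega> \<T> \<S> v x))\<^sup>2"
  have "ae_eq \<Omega> (\<lambda>x. mesh_size \<T> x powr s * (\<Sum>v\<in>N. c v * theta \<Omega> \<T> \<S> v x)) (\<lambda>x. 0)"
    using z by eventually_elim simp
  then have "l2_norm \<Omega> (\<lambda>x. mesh_size \<T> x powr s * (\<Sum>v\<in>N. c v * theta \<Omega> \<T> \<S> v x)) = l2_norm \<Omega> (\<lambda>x. 0)"
    by (rule l2_norm_ae_cong) (use mesh_size_measurable theta_sum_L2[of c, THEN L2_measurable] in simp_all)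
  with theta_lower[OF d, of c s] have "(\<Sum>v\<in>N. ?t v) \<le> 0" by simp
  then have "?t u = 0"
    using sum_nonneg_eq_0_iff[OF finite_N, of ?t] sum_nonneg[of N ?t] u by fastforce
  moreover have "0 < (\<Sum>T\<in>\<T>. weight s T * (2 ^ DIM('a) - 1) * of_bool (u \<in> T))"
  proof -
    have "(2::real) ^ 1 \<le> 2 ^ DIM('a)" by (rule power_increasing) (auto simp: Suc_leI)
    then have d: "0 < (2::real) ^ DIM('a) - 1" by simp
    obtain T where T: "T \<in> \<T>" "u \<in> T" using u by (auto simp: free_vertices_def extreme_point_of_def)
    show ?thesis
    proof (rule sum_pos2[OF finite_\<T> T(1)])
      show "0 < weight s T * (2 ^ DIM('a) - 1) * of_bool (u \<in> T)" using T d weight_pos[OF T(1)] by simp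
    qed (use d weight_pos in \<open>auto intro: less_imp_le\<close>)
  qed
  ultimately show ?thesis unfolding norm_theta[OF u] by simp
qed

end

section \<open>Quadratic bumps\<close>

text \<open>Squaring removes the kink on the sphere of radius \<open>r\<close>. The bump is only of
  class C^1, but its lower bound on the half ball and its derivative bound are explicit and scale
  with \<open>r\<close>.\<close>

definition quad_bump :: "'a::euclidean_space \<Rightarrow> real \<Rightarrow> 'a \<Rightarrow> real" where
  "quad_bump c r x = (max 0 (1 - (x - c) \<bullet> (x - c) / r\<^sup>2))\<^sup>2"

lemma has_real_derivative_max_square: "((\<lambda>u. (max 0 u)\<^sup>2) has_real_derivative 2 * max 0 u) (at u)"
proof -
  consider "u < 0" | "u = 0" | "u > 0" by linarith
  then show ?thesis
  proof cases
    case 1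
    have "((\<lambda>u. 0) has_real_derivative 0) (at u)" by simp
    then have "((\<lambda>u. (max 0 u)\<^sup>2) has_real_derivative 0) (at u)"
      by (rule has_field_derivative_transform_within_open[where S="{..<0}"]) (use 1 in auto)
    then show ?thesis using 1 by simp
  next
    case 2
    \<comment> \<open>At 0 the difference quotient is \<open>max 0 h\<close> itself.\<close>
    have "((\<lambda>h::real. max 0 h) \<longlongrightarrow> max 0 0) (at 0)" by (intro tendsto_intros)
    then have "((\<lambda>h::real. max 0 h) \<longlongrightarrow> 0) (at 0)" by simp
    then have "((\<lambda>h::real. (max 0 h)\<^sup>2 / h) \<longlongrightarrow> 0) (at 0)"
      by (rule Lim_transform_eventually) (auto simp: eventually_at_filter max_def power2_eq_square)
    then show ?thesis unfolding 2 by (simp add: DERIV_def)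
  next
    case 3
    have "((\<lambda>u. u\<^sup>2) has_real_derivative 2 * u) (at u)" by (auto intro!: derivative_eq_intros)
    then have "((\<lambda>u. (max 0 u)\<^sup>2) has_real_derivative 2 * u) (at u)"
      by (rule has_field_derivative_transform_within_open[where S="{0<..}"]) (use 3 in auto)
    then show ?thesis using 3 by simp
  qed
qed

lemma quad_bump_has_derivative:
  "(quad_bump c r has_derivative (\<lambda>h. 2 * max 0 (1 - (x - c) \<bullet> (x - c) / r\<^sup>2) * (- (2 * ((x - c) \<bullet> h) / r\<^sup>2)))) (at x)"
proof -
  have "((\<lambda>x. 1 - (x - c) \<bullet> (x - c) / r\<^sup>2) has_derivative (\<lambda>h. - (2 * ((x - c) \<bullet> h) / r\<^sup>2))) (at x)"
    by (auto intro!: derivative_eq_intros simp: inner_commute divide_inverse algebra_simps)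
  from has_derivative_compose[OF this has_real_derivative_max_square[unfolded has_field_derivative_def]]
  show ?thesis unfolding quad_bump_def[abs_def] .
qed

lemma quad_bump_outside: assumes "0 < r" "x \<notin> cball c r" shows "quad_bump c r x = 0" "max 0 (1 - (x - c) \<bullet> (x - c) / r\<^sup>2) = 0"
proof -
  have "r < norm (x - c)" using assms(2) by (simp add: dist_norm norm_minus_commute)
  then have "r\<^sup>2 < (norm (x - c))\<^sup>2" using assms(1) by (intro power_strict_mono) auto
  then have "1 < (x - c) \<bullet> (x - c) / r\<^sup>2" using assms(1) by (simp add: power2_norm_eq_inner)
  then show "max 0 (1 - (x - c) \<bullet> (x - c) / r\<^sup>2) = 0" by simp
  then show "quad_bump c r x = 0" by (simp add: quad_bump_def)
qed

lemma quad_bump_derivative: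
  "frechet_derivative (quad_bump c r) (at x) h = 2 * max 0 (1 - (x - c) \<bullet> (x - c) / r\<^sup>2) * (- (2 * ((x - c) \<bullet> h) / r\<^sup>2))"
  using frechet_derivative_at[OF quad_bump_has_derivative[of c r x]] by metis

lemma C1c_quad_bump: assumes "0 < r" shows "C1c (quad_bump c r)"
  unfolding C1c_def
proof
  have "C_k (Suc 0) (quad_bump c r)"
    by (rule C_k_Suc_I[OF quad_bump_has_derivative]) (use assms in \<open>auto intro!: continuous_intros\<close>)
  then show "C_k 1 (quad_bump c r)" by simp
  show "\<exists>K. compact K \<and> (\<forall>x. x \<notin> K \<longrightarrow> quad_bump c r x = 0)"
    using quad_bump_outside(1)[OF assms] by (intro exI[of _ "cball c r"]) auto
qed

lemma quad_bump_le_1: "quad_bump c r x \<le> 1" and quad_bump_nonneg: "0 \<le> quad_bump c r x"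
  unfolding quad_bump_def by (auto intro!: power_le_one)

lemma quad_bump_ge: assumes "0 < r" "x \<in> cball c (r / 2)" shows "1 / 2 \<le> quad_bump c r x"
proof -
  have "norm (x - c) \<le> r / 2" using assms(2) by (simp add: dist_norm norm_minus_commute)
  then have "(norm (x - c))\<^sup>2 \<le> (r / 2)\<^sup>2" by (intro power_mono) auto
  \<comment> \<open>On the half ball the base is at least 3/4, and
    \<open>(3 / 4)\<^sup>2 = 9 / 16\<close> exceeds 1/2.\<close>
  then have "(x - c) \<bullet> (x - c) / r\<^sup>2 \<le> 1 / 4"
    using assms(1) by (simp add: power2_norm_eq_inner power_divide field_simps)
  then have q: "3 / 4 \<le> max 0 (1 - (x - c) \<bullet> (x - c) / r\<^sup>2)" unfolding le_max_iff_disj by linarith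
  have "(3 / 4)\<^sup>2 \<le> quad_bump c r x" unfolding quad_bump_def by (rule power_mono[OF q]) simp
  then show ?thesis by (simp add: power2_eq_square)
qed

text \<open>Inside the ball the three factors are at most 2, 1 and
  \<open>2 r / r\<^sup>2\<close>.\<close>

lemma quad_bump_derivative_le:
  assumes r: "0 < r" and b: "b \<in> Basis"
  shows "\<bar>frechet_derivative (quad_bump c r) (at x) b\<bar> \<le> 4 / r"
proof (cases "x \<in> cball c r")
  case False
  then show ?thesis unfolding quad_bump_derivative quad_bump_outside(2)[OF r False] using r by simp
next
  case True
  have "\<bar>(x - c) \<bullet> b\<bar> \<le> norm (x - c)" using b by (rule Basis_le_norm)
  also have "\<dots> \<le> r" using True by (simp add: dist_norm norm_minus_commute)
  finally have i: "\<bar>(x - c) \<bullet> b\<bar> \<le> r" .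
  have m: "\<bar>max 0 (1 - (x - c) \<bullet> (x - c) / r\<^sup>2)\<bar> \<le> 1" by simp
  have "\<bar>max 0 (1 - (x - c) \<bullet> (x - c) / r\<^sup>2)\<bar> * \<bar>(x - c) \<bullet> b\<bar> \<le> 1 * r"
    using m i by (intro mult_mono) auto
  then show ?thesis
    unfolding quad_bump_derivative abs_mult using r
    by (simp add: abs_mult abs_divide field_simps power2_eq_square)
qed

section \<open>Shape regularity\<close>

lemma content_cball_scale: "0 \<le> r \<Longrightarrow> measure lebesgue (cball c r :: 'a::euclidean_space set) = unit_ball_vol DIM('a) * r ^ DIM('a)"
  by (simp add: content_cball)

definition shape_regular :: "real \<Rightarrow> 'a::euclidean_space set \<Rightarrow> bool" where
  "shape_regular \<kappa> T \<longleftrightarrow> (\<exists>c r. 0 < r \<and> cball c r \<subseteq> T \<and> diameter T \<le> \<kappa> * r)"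

text \<open>The size of the unit ball measured as \<open>simplex_size\<close> measures a simplex; a
  ball of radius \<open>r\<close> has size \<open>ball_size * r\<close>.\<close>

definition ball_size :: "'a::euclidean_space itself \<Rightarrow> real" where
  "ball_size _ = root DIM('a) (unit_ball_vol DIM('a))"

lemma ball_size: "0 < ball_size TYPE('a::euclidean_space)"
  "ball_size TYPE('a) ^ DIM('a) = unit_ball_vol DIM('a)"
  unfolding ball_size_def by (auto intro!: real_root_pow_pos2)

context partition
begin

lemma cball_le_simplex_size:
  assumes T: "T \<in> \<T>" and r: "0 \<le> r" "cball c r \<subseteq> T"
  shows "unit_ball_vol DIM('a) * r ^ DIM('a) \<le> measure lebesgue T" "ball_size TYPE('a) * r \<le> simplex_size T"
proof -
  have "measure lebesgue (cball c r) \<le> measure lebesgue T"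
    using r(2) lmeasurable_compact[OF compact[OF T]] by (intro measure_mono_fmeasurable) auto
  then show m: "unit_ball_vol DIM('a) * r ^ DIM('a) \<le> measure lebesgue T"
    by (simp only: content_cball_scale[OF r(1)])
  show "ball_size TYPE('a) * r \<le> simplex_size T"
  proof (rule power_le_imp_le_base)
    show "(ball_size TYPE('a) * r) ^ Suc (DIM('a) - 1) \<le> simplex_size T ^ Suc (DIM('a) - 1)"
      using m by (simp add: power_mult_distrib ball_size simplex_size_power[OF T])
    show "0 \<le> simplex_size T" using simplex_size_pos[OF T] by simp
  qed
qed

lemma measure_le_diameter:
  assumes T: "T \<in> \<T>" and D: "diameter T \<le> D"
  shows "measure lebesgue T \<le> unit_ball_vol DIM('a) * D ^ DIM('a)"
proof -
  obtain x where x: "x \<in> T" using interior_nonempty[OF T] interior_subset by blast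
  have "T \<subseteq> cball x D"
    using diameter_bounded_bound[OF compact_imp_bounded[OF compact[OF T]] x] D by fastforce
  then have "measure lebesgue T \<le> measure lebesgue (cball x D)"
    using lmeasurable_compact[OF compact[OF T]] by (intro measure_mono_fmeasurable) (auto simp: fmeasurableD)
  also have "\<dots> = unit_ball_vol DIM('a) * D ^ DIM('a)"
    using order_trans[OF diameter_ge_0[OF compact_imp_bounded[OF compact[OF T]]] D] by (rule content_cball_scale)
  finally show ?thesis .
qed

section \<open>Localisation, the local Poincare inequality and the projection error\<close>

lemma integral_decompose:
  fixes f :: "'a \<Rightarrow> real"
  assumes f: "integrable (lebesgue_on \<Omega>) f"
  shows "(LINT x|lebesgue_on \<Omega>. f x) = (\<Sum>T\<in>\<T>. LINT x|lebesgue_on (interior T). f x)"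
proof -
  have ind: "(\<lambda>x. indicator (interior T) x :: real) \<in> borel_measurable (lebesgue_on \<Omega>)" for T
    by (intro measurable_restrict_space1 borel_measurable_indicator) (simp add: borel_open)
  have i: "integrable (lebesgue_on \<Omega>) (\<lambda>x. indicator (interior T) x * f x)" for T
    by (rule Bochner_Integration.integrable_bound[OF f])
       (use ind borel_measurable_integrable[OF f] in \<open>auto simp: indicator_def\<close>)
  have ae: "ae_eq \<Omega> f (\<lambda>x. \<Sum>T\<in>\<T>. indicator (interior T) x * f x)"
  proof (rule ae_eqI)
    fix T x assume "T \<in> \<T>" "x \<in> interior T"
    from pc_interior[OF this, of "\<lambda>_. 1"] have "(\<Sum>T\<in>\<T>. indicator (interior T) x) = (1::real)"
      by (simp add: pc_def)
    then show "f x = (\<Sum>T\<in>\<T>. indicator (interior T) x * f x)" by (simp flip: sum_distrib_right)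
  qed
  have "(LINT x|lebesgue_on \<Omega>. f x) = (LINT x|lebesgue_on \<Omega>. (\<Sum>T\<in>\<T>. indicator (interior T) x * f x))"
    by (rule integral_cong_AE) (use ae ind borel_measurable_integrable[OF f] in auto)
  also have "\<dots> = (\<Sum>T\<in>\<T>. LINT x|lebesgue_on \<Omega>. indicator (interior T) x * f x)"
    using i by (rule Bochner_Integration.integral_sum)
  also have "\<dots> = (\<Sum>T\<in>\<T>. LINT x|lebesgue_on (interior T). f x)"
  proof (intro sum.cong refl)
    fix T assume T: "T \<in> \<T>"
    show "(LINT x|lebesgue_on \<Omega>. indicator (interior T) x * f x) = (LINT x|lebesgue_on (interior T). f x)"
      using sets_\<Omega> interior_subset_\<Omega>[OF T]
      by (subst (1 2) integral_restrict_space) (auto intro!: Bochner_Integration.integral_cong simp: indicator_def)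
  qed
  finally show ?thesis .
qed

lemma l2_norm_decompose:
  assumes "f \<in> L2 \<Omega>" shows "(l2_norm \<Omega> f)\<^sup>2 = (\<Sum>T\<in>\<T>. (l2_norm (interior T) f)\<^sup>2)"
  unfolding l2_norm_square_integral using assms by (intro integral_decompose L2_square_integrable)

text \<open>The ball of radius \<open>D = \<bar>\<kappa>\<bar> r\<close> has
  \<open>\<bar>\<kappa>\<bar> ^ d\<close> times the volume of the inscribed ball, hence at most that
  multiple of the volume \<open>m\<close> of \<open>T\<close>, and \<open>m\<close> cancels. The
  remaining \<open>D\<^sup>2\<close> is \<open>\<kappa>\<^sup>2 r\<^sup>2\<close>, with
  \<open>r\<close> at most the simplex size over \<open>ball_size\<close>. The factor 2 on the left
  is given away.\<close>

lemma poincare_simplex: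
  assumes T: "T \<in> \<T>" and reg: "shape_regular \<kappa> T" and w: "w \<in> L2 \<Omega>" and g: "has_weak_grad \<Omega> w g"
  shows "(l2_norm (interior T) (\<lambda>x. w x - avg w T))\<^sup>2 \<le>
    \<bar>\<kappa>\<bar> ^ (DIM('a) + 2) / (ball_size TYPE('a))\<^sup>2 * (simplex_size T)\<^sup>2 * (\<Sum>b\<in>Basis. (l2_norm (interior T) (\<lambda>x. g x \<bullet> b))\<^sup>2)"
proof -
  obtain c r where r: "0 < r" "cball c r \<subseteq> T" "diameter T \<le> \<kappa> * r" using reg unfolding shape_regular_def by blast
  \<comment> \<open>Shape regularity comes with no sign condition on \<kappa>; the absolute value
    makes all factors nonnegative.\<close>
  define D where "D = \<bar>\<kappa>\<bar> * r"
  define A where "A = (\<Sum>b\<in>Basis. (l2_norm (interior T) (\<lambda>x. g x \<bullet> b))\<^sup>2)"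
  define \<omega> where "\<omega> = unit_ball_vol (real DIM('a))"
  have \<omega>: "0 < \<omega>" unfolding \<omega>_def by simp
  define m where "m = measure lebesgue T"
  define X where "X = (l2_norm (interior T) (\<lambda>x. w x - avg w T))\<^sup>2"
  have A: "0 \<le> A" unfolding A_def by (simp add: sum_nonneg)
  have "\<kappa> * r \<le> D" unfolding D_def using r(1) by (intro mult_right_mono) auto
  then have D: "0 \<le> D" "diameter T \<le> D" using r(1) order_trans[OF r(3)] by (simp_all add: D_def)
  have dist: "dist x y \<le> D" if "x \<in> interior T" "y \<in> interior T" for x y
    using diameter_bounded_bound[OF compact_imp_bounded[OF compact[OF T]], of x y] that interior_subset[of T] D(2)
    by fastforce
  have m: "\<omega> * r ^ DIM('a) \<le> m" "ball_size TYPE('a) * r \<le> simplex_size T"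
    using cball_le_simplex_size[OF T _ r(2)] r(1) unfolding \<omega>_def m_def by auto
  have "2 * m * X \<le> measure lebesgue (cball 0 D :: 'a set) * D\<^sup>2 * A"
    unfolding X_def A_def m_def
    using poincare[OF open_\<Omega> bounded_\<Omega> _ convex_interior[OF convex[OF T]] interior_subset_\<Omega>[OF T] interior_nonempty[OF T] dist D(1) w g]
    by (simp add: avg_def measure_interior[OF T])
  also have "\<dots> = (\<bar>\<kappa>\<bar> ^ DIM('a) * D\<^sup>2 * A) * (\<omega> * r ^ DIM('a))"
    unfolding content_cball_scale[OF D(1)] \<omega>_def by (simp add: D_def power_mult_distrib)
  also have "\<dots> \<le> (\<bar>\<kappa>\<bar> ^ DIM('a) * D\<^sup>2 * A) * m"
    using m(1) A by (intro mult_left_mono) auto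
  finally have "2 * X * m \<le> (\<bar>\<kappa>\<bar> ^ DIM('a) * D\<^sup>2 * A) * m" by (simp add: mult_ac)
  moreover have m0: "0 < m" unfolding m_def using T by (rule measure_pos)
  ultimately have "2 * X \<le> \<bar>\<kappa>\<bar> ^ DIM('a) * D\<^sup>2 * A" by simp
  moreover have "0 \<le> X" unfolding X_def by simp
  ultimately have "X \<le> \<bar>\<kappa>\<bar> ^ DIM('a) * D\<^sup>2 * A" by linarith
  also have "\<dots> = \<bar>\<kappa>\<bar> ^ (DIM('a) + 2) * A * r\<^sup>2"
    unfolding D_def power_mult_distrib power_add by (simp add: mult_ac)
  also have "\<dots> \<le> \<bar>\<kappa>\<bar> ^ (DIM('a) + 2) * A * ((simplex_size T)\<^sup>2 / (ball_size TYPE('a))\<^sup>2)"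
  proof (intro mult_left_mono)
    have "(ball_size TYPE('a) * r)\<^sup>2 \<le> (simplex_size T)\<^sup>2"
      using m(2) r(1) ball_size(1)[where 'a='a] by (intro power_mono) auto
    then show "r\<^sup>2 \<le> (simplex_size T)\<^sup>2 / (ball_size TYPE('a))\<^sup>2"
      using ball_size(1)[where 'a='a] by (simp add: pos_le_divide_eq power_mult_distrib mult.commute)
  qed (use A in auto)
  finally show ?thesis unfolding X_def A_def by (simp add: mult_ac)
qed

text \<open>Serves only to put functions into L_2: this bound depends on the partition and does not
  enter a constant.\<close>

lemma inverse_mesh_size_bounded: "\<bar>inverse (mesh_size \<T> x)\<bar> \<le> (\<Sum>T\<in>\<T>. \<bar>inverse (simplex_size T)\<bar>)"
proof (cases "\<exists>T\<in>\<T>. x \<in> interior T")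
  case True
  then obtain T where T: "T \<in> \<T>" "x \<in> interior T" by blast
  show ?thesis
    unfolding mesh_size_pc pc_interior[OF T] by (rule member_le_sum[OF T(1)]) (auto simp: finite_\<T>)
next
  case False
  then have "mesh_size \<T> x = 0" by (auto simp: mesh_size_def intro!: sum.neutral)
  then show ?thesis by (simp add: sum_nonneg)
qed

lemma inverse_mesh_size_measurable: "(\<lambda>x. inverse (mesh_size \<T> x)) \<in> borel_measurable (lebesgue_on \<Omega>)"
  unfolding mesh_size_pc by (intro borel_measurable_inverse pc_measurable)

text \<open>On each simplex the mesh size is a constant, whose inverse square cancels the square of
  the size in \<open>poincare_simplex\<close>. The local gradient norms then add up to the global
  one.\<close>

lemma projection_error:
  assumes reg: "\<And>T. T \<in> \<T> \<Longrightarrow> shape_regular \<kappa> T" and w: "w \<in> H1 \<Omega>"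
  shows "(\<lambda>x. inverse (mesh_size \<T> x) * (w x - dual_adjoint \<Omega> (Q \<Omega> \<T>) w x)) \<in> L2 \<Omega>" (is "?e \<in> _")
    and "l2_norm \<Omega> (\<lambda>x. inverse (mesh_size \<T> x) * (w x - dual_adjoint \<Omega> (Q \<Omega> \<T>) w x))
      \<le> sqrt (\<bar>\<kappa>\<bar> ^ (DIM('a) + 2) / (ball_size TYPE('a))\<^sup>2) * h1_norm \<Omega> w"
proof -
  define g where "g = weak_grad \<Omega> w"
  have wL: "w \<in> L2 \<Omega>" using w by (simp add: H1_def)
  have g: "has_weak_grad \<Omega> w g" unfolding g_def using w by (rule H1_weak_grad)
  then have gL: "(\<lambda>x. g x \<bullet> b) \<in> L2 \<Omega>" if "b \<in> Basis" for b using that by (simp add: has_weak_grad_def)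
  define C where "C = \<bar>\<kappa>\<bar> ^ (DIM('a) + 2) / (ball_size TYPE('a))\<^sup>2"
  have C: "0 \<le> C" unfolding C_def by simp
  show eL: "?e \<in> L2 \<Omega>"
    by (rule L2_bounded_mult[OF L2_diff[OF wL dual_adjoint_Q(1)[OF wL]] _ inverse_mesh_size_bounded])
       (rule inverse_mesh_size_measurable)
  let ?f = "\<lambda>x. inverse (mesh_size \<T> x) * (w x - pc \<T> (avg w) x)"
  have "ae_eq \<Omega> ?e ?f" using dual_adjoint_Q(2)[OF wL] by eventually_elim simp
  moreover have fL: "?f \<in> L2 \<Omega>"
    by (rule L2_bounded_mult[OF L2_diff[OF wL pc_L2] _ inverse_mesh_size_bounded])
       (rule inverse_mesh_size_measurable)
  ultimately have "(l2_norm \<Omega> ?e)\<^sup>2 = (l2_norm \<Omega> ?f)\<^sup>2"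
    using eL by (subst l2_norm_ae_cong) (auto dest: L2_measurable)
  also have "\<dots> = (\<Sum>T\<in>\<T>. (l2_norm (interior T) ?f)\<^sup>2)" by (rule l2_norm_decompose[OF fL])
  also have "\<dots> \<le> (\<Sum>T\<in>\<T>. C * (\<Sum>b\<in>Basis. (l2_norm (interior T) (\<lambda>x. g x \<bullet> b))\<^sup>2))"
  proof (rule sum_mono)
    fix T assume T: "T \<in> \<T>"
    have "(l2_norm (interior T) ?f)\<^sup>2 = (l2_norm (interior T) (\<lambda>x. inverse (simplex_size T) * (w x - avg w T)))\<^sup>2"
      unfolding l2_norm_square_integral
      by (intro Bochner_Integration.integral_cong) (auto simp: mesh_size_pc pc_interior[OF T])
    also have "\<dots> = (inverse (simplex_size T))\<^sup>2 * (l2_norm (interior T) (\<lambda>x. w x - avg w T))\<^sup>2"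
      by (simp only: l2_norm_cmult power_mult_distrib power2_abs)
    also have "\<dots> \<le> (inverse (simplex_size T))\<^sup>2 * (C * (simplex_size T)\<^sup>2 * (\<Sum>b\<in>Basis. (l2_norm (interior T) (\<lambda>x. g x \<bullet> b))\<^sup>2))"
      unfolding C_def by (intro mult_left_mono poincare_simplex[OF T reg[OF T] wL g]) auto
    also have "\<dots> = C * (\<Sum>b\<in>Basis. (l2_norm (interior T) (\<lambda>x. g x \<bullet> b))\<^sup>2)"
      using simplex_size_pos[OF T] by (simp add: power_inverse field_simps)
    finally show "(l2_norm (interior T) ?f)\<^sup>2 \<le> C * (\<Sum>b\<in>Basis. (l2_norm (interior T) (\<lambda>x. g x \<bullet> b))\<^sup>2)" .
  qed
  also have "\<dots> = C * (\<Sum>b\<in>Basis. \<Sum>T\<in>\<T>. (l2_norm (interior T) (\<lambda>x. g x \<bullet> b))\<^sup>2)"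
    unfolding sum_distrib_left[symmetric] by (subst sum.swap) (rule refl)
  also have "\<dots> = C * (\<Sum>b\<in>Basis. (l2_norm \<Omega> (\<lambda>x. g x \<bullet> b))\<^sup>2)"
    by (intro arg_cong2[where f="(*)"] sum.cong refl l2_norm_decompose[symmetric] gL)
  also have "\<dots> \<le> C * (h1_norm \<Omega> w)\<^sup>2"
    using C unfolding h1_norm_def g_def[symmetric] by (intro mult_left_mono) (auto simp: sum_nonneg)
  also have "\<dots> = (sqrt C * h1_norm \<Omega> w)\<^sup>2" using C by (simp add: power_mult_distrib)
  finally show "l2_norm \<Omega> ?e \<le> sqrt (\<bar>\<kappa>\<bar> ^ (DIM('a) + 2) / (ball_size TYPE('a))\<^sup>2) * h1_norm \<Omega> w"
    unfolding C_def[symmetric] by (rule power2_le_imp_le)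
      (use C order_trans[OF l2_norm_nonneg l2_norm_le_h1_norm] in \<open>auto intro!: mult_nonneg_nonneg\<close>)
qed

end

section \<open>The inverse inequality\<close>

lemma C1cI: "C_k 1 f \<Longrightarrow> compact K \<Longrightarrow> (\<And>x. x \<notin> K \<Longrightarrow> f x = 0) \<Longrightarrow> C1c f"
  unfolding C1c_def by blast

lemma C1c_C_1: "C1c f \<Longrightarrow> C_k 1 f"
  unfolding C1c_def by (rule conjunct1)

lemma C1c_add:
  assumes f: "C1c f" and g: "C1c g" shows "C1c (\<lambda>x. f x + g x)"
proof -
  obtain K where K: "compact K" "\<And>x. x \<notin> K \<Longrightarrow> f x = 0" by (rule C1c_support[OF f]) (rule that)
  obtain L where L: "compact L" "\<And>x. x \<notin> L \<Longrightarrow> g x = 0" by (rule C1c_support[OF g]) (rule that)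
  show ?thesis
    by (rule C1cI[OF C_k_add[OF f[THEN C1c_C_1] g[THEN C1c_C_1]] compact_Un[OF K(1) L(1)]]) (simp add: K(2) L(2))
qed

lemma C1c_cmult: assumes f: "C1c f" shows "C1c (\<lambda>x. a * f x)"
proof -
  obtain K where K: "compact K" "\<And>x. x \<notin> K \<Longrightarrow> f x = 0" by (rule C1c_support[OF f]) (rule that)
  show ?thesis
    by (rule C1cI[OF C_k_mult[OF C_k_const C1c_C_1[OF f]] K(1)]) (simp add: K(2))
qed

lemma C1c_zero: "C1c (\<lambda>x. 0)"
  by (rule C1cI[OF C_k_const compact_empty]) simp

lemma C1c_sum: "(\<And>i. i \<in> I \<Longrightarrow> C1c (f i)) \<Longrightarrow> C1c (\<lambda>x. \<Sum>i\<in>I. f i x)"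
  by (induction I rule: infinite_finite_induct) (auto intro: C1c_add C1c_zero)

lemma frechet_derivative_sum_cmult:
  assumes "\<And>i. i \<in> I \<Longrightarrow> C1c (f i)"
  shows "frechet_derivative (\<lambda>x. \<Sum>i\<in>I. a i * f i x) (at x) v = (\<Sum>i\<in>I. a i * frechet_derivative (f i) (at x) v)"
proof -
  have "((\<lambda>x. \<Sum>i\<in>I. a i * f i x) has_derivative (\<lambda>h. \<Sum>i\<in>I. a i * frechet_derivative (f i) (at x) h)) (at x)"
    by (intro has_derivative_sum has_derivative_mult_right C1c_has_derivative assms)
  from fun_cong[OF frechet_derivative_at[OF this], of v] show ?thesis by simp
qed

lemma dual_norm_nonneg:
  assumes "open \<Omega>" "bounded \<Omega>" "f \<in> L2 \<Omega>" shows "0 \<le> dual_norm \<Omega> \<gamma> f"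
  by (rule order_trans[OF abs_ge_zero l2_inner_le_dual_norm[OF assms(3) zero_H1_0[OF assms(1,2)]]])
     (simp add: h1_norm_zero[OF assms(1,2)])

context red_partition
begin

lemma simplex_size_parent_power: "S \<in> \<S> \<Longrightarrow> simplex_size (parent S) ^ DIM('a) = 2 ^ DIM('a) * measure lebesgue S"
  using measure_child[OF parent(1), of S S] parent(2)[of S] by (simp add: simplex_size_power parent(1) children_def)

text \<open>Let \<open>Z\<close> be the squared left-hand side. The test function \<open>w\<close>
  satisfies \<open>Z \<le> K1 \<langle>z, w\<rangle>\<close> and has squared H^1 norm at most
  \<open>K2 Z\<close>, so \<open>Z \<le> K1 sqrt (K2 Z)\<close> times the dual norm, and a factor
  \<open>sqrt Z\<close> is divided out.\<close>

lemma inverse_inequality_pc: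
  assumes \<gamma>: "\<gamma> \<subseteq> frontier \<Omega>" and reg: "\<And>S. S \<in> \<S> \<Longrightarrow> shape_regular \<kappa> S"
    and R: "0 < R" "\<Omega> \<subseteq> cball 0 R"
    and z: "z \<in> L2 \<Omega>" "ae_eq \<Omega> z (pc \<S> a)"
  shows "l2_norm \<Omega> (\<lambda>x. mesh_size \<T> x * z x) \<le>
    (32 * \<kappa>\<^sup>2 * (ball_size TYPE('a))\<^sup>2 * (4 * \<bar>\<kappa>\<bar>) ^ DIM('a)) * sqrt ((R\<^sup>2 + 16 * real DIM('a)) / (ball_size TYPE('a))\<^sup>2) * dual_norm \<Omega> \<gamma> z"
proof -
  define \<rho> where "\<rho> = ball_size TYPE('a)"
  have \<rho>: "0 < \<rho>" "\<rho> ^ DIM('a) = unit_ball_vol (real DIM('a))"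
    unfolding \<rho>_def by (rule ball_size)+
  \<comment> \<open>\<open>16 \<kappa>\<^sup>2 \<rho>\<^sup>2\<close> is from the square of
    \<open>h_up\<close>, a factor 2 from the bump being at least 1/2 on its half ball, and
    \<open>(4 \<bar>\<kappa>\<bar>) ^ d\<close> compares the ball of radius
    \<open>2 \<bar>\<kappa>\<bar> q\<close> around \<open>S\<close> with that half ball.\<close>
  define K1 where "K1 = 32 * \<kappa>\<^sup>2 * \<rho>\<^sup>2 * (4 * \<bar>\<kappa>\<bar>) ^ DIM('a)"
  \<comment> \<open>The function contributes \<open>q ^ 4\<close> and each of the d partial
    derivatives \<open>16 q\<^sup>2\<close>. Factor out \<open>q\<^sup>2\<close>, then bound this
    factor by \<open>h\<^sup>2 / \<rho>\<^sup>2\<close> and the other \<open>q\<^sup>2\<close> by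
    \<open>R\<^sup>2\<close>.\<close>
  define K2 where "K2 = (R\<^sup>2 + 16 * real DIM('a)) / \<rho>\<^sup>2"
  have K: "0 \<le> K1" "0 < K2" using \<rho>(1) R(1) by (auto simp: K1_def K2_def intro!: divide_pos_pos add_pos_nonneg)
  \<comment> \<open>Half the inscribed radius, so that the closed support ball lies in the interior
    of \<open>S\<close>; the shape constant doubles.\<close>
  have "\<exists>c r. 0 < r \<and> cball c (2 * r) \<subseteq> S \<and> diameter S \<le> 2 * \<bar>\<kappa>\<bar> * r" if S: "S \<in> \<S>" for S
  proof -
    obtain c r where r: "0 < r" "cball c r \<subseteq> S" "diameter S \<le> \<kappa> * r"
      using reg[OF S] unfolding shape_regular_def by blast
    have "\<kappa> * r \<le> \<bar>\<kappa>\<bar> * r" using r(1) by (intro mult_right_mono) auto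
    with r(3) have "diameter S \<le> \<bar>\<kappa>\<bar> * r" by (rule order_trans)
    then show ?thesis using r(1,2) by (intro exI[of _ c] exI[of _ "r / 2"]) auto
  qed
  then obtain c q where cq: "\<And>S. S \<in> \<S> \<Longrightarrow> 0 < q S \<and> cball (c S) (2 * q S) \<subseteq> S \<and> diameter S \<le> 2 * \<bar>\<kappa>\<bar> * q S"
    by metis
  then have q: "0 < q S" and cb: "cball (c S) (2 * q S) \<subseteq> S" and D: "diameter S \<le> 2 * \<bar>\<kappa>\<bar> * q S" if "S \<in> \<S>" for S
    using that by blast+
  have B: "cball (c S) (q S) \<subseteq> interior S" if S: "S \<in> \<S>" for S
  proof -
    have "ball (c S) (2 * q S) \<subseteq> interior S"
      using cb[OF S] ball_subset_cball by (intro interior_maximal) blast+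
    moreover have "cball (c S) (q S) \<subseteq> ball (c S) (2 * q S)" using q[OF S] by (auto simp: subset_iff)
    ultimately show ?thesis by blast
  qed
  \<comment> \<open>Two antipodal points of the ball are \<open>2 q\<close> apart and both have norm
    at most \<open>R\<close>.\<close>
  have qR: "q S \<le> R" if S: "S \<in> \<S>" for S
  proof -
    obtain b :: 'a where b: "b \<in> Basis" using nonempty_Basis by blast
    have sub: "cball (c S) (q S) \<subseteq> cball 0 R" using B[OF S] S.interior_subset_\<Omega>[OF S] R(2) by blast
    have "c S + q S *\<^sub>R b \<in> cball (c S) (q S)" "c S - q S *\<^sub>R b \<in> cball (c S) (q S)"
      using q[OF S] b by (auto simp: dist_norm)
    then have n: "norm (c S + q S *\<^sub>R b) \<le> R" "norm (c S - q S *\<^sub>R b) \<le> R"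
      using subsetD[OF sub] unfolding mem_cball_0[symmetric] by blast+
    have "norm ((c S + q S *\<^sub>R b) - (c S - q S *\<^sub>R b)) \<le> R + R"
      by (rule order_trans[OF norm_triangle_ineq4]) (use n in simp)
    also have "(c S + q S *\<^sub>R b) - (c S - q S *\<^sub>R b) = (2 * q S) *\<^sub>R b"
      by (simp add: algebra_simps flip: scaleR_2)
    finally show ?thesis using q[OF S] b by simp
  qed
  define h where "h S = simplex_size (parent S)" for S
  have hpos: "0 < h S" if "S \<in> \<S>" for S unfolding h_def using simplex_size_pos parent(1) that by blast
  have m: "measure lebesgue S \<le> unit_ball_vol (real DIM('a)) * (2 * \<bar>\<kappa>\<bar> * q S) ^ DIM('a)" if S: "S \<in> \<S>" for S
    using S D[OF S] by (rule S.measure_le_diameter)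
  \<comment> \<open>\<open>h\<close> is the size of the parent, whose volume is \<open>2 ^ d\<close>
    times that of \<open>S\<close>; taking the root turns this into a further factor 2.\<close>
  have h_up: "h S \<le> 4 * \<bar>\<kappa>\<bar> * \<rho> * q S" if S: "S \<in> \<S>" for S
  proof (rule power_le_imp_le_base)
    have "h S ^ DIM('a) \<le> 2 ^ DIM('a) * (unit_ball_vol (real DIM('a)) * (2 * \<bar>\<kappa>\<bar> * q S) ^ DIM('a))"
      unfolding h_def simplex_size_parent_power[OF S] using m[OF S] by simp
    also have "\<dots> = (2 * (\<rho> * (2 * \<bar>\<kappa>\<bar> * q S))) ^ DIM('a)"
      by (simp only: \<rho>(2)[symmetric] power_mult_distrib)
    finally show "h S ^ Suc (DIM('a) - 1) \<le> (4 * \<bar>\<kappa>\<bar> * \<rho> * q S) ^ Suc (DIM('a) - 1)"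
      by (simp add: mult_ac)
    show "0 \<le> 4 * \<bar>\<kappa>\<bar> * \<rho> * q S" using \<rho>(1) q[OF S] by simp
  qed
  have h_low: "\<rho> * q S \<le> h S" if S: "S \<in> \<S>" for S
  proof -
    have "cball (c S) (q S) \<subseteq> parent S" using B[OF S] interior_subset parent(2)[OF S] by blast
    then show ?thesis unfolding \<rho>_def h_def using q[OF S] by (intro cball_le_simplex_size(2)[OF parent(1)[OF S]]) auto
  qed
  define \<eta> where "\<eta> S = quad_bump (c S) (q S)" for S
  define w where "w x = (\<Sum>S\<in>\<S>. (a S * (q S)\<^sup>2) * \<eta> S x)" for x
  have \<eta>C: "C1c (\<eta> S)" if "S \<in> \<S>" for S unfolding \<eta>_def using q[OF that] by (rule C1c_quad_bump)
  have wC: "C1c w" unfolding w_def[abs_def] by (intro C1c_sum C1c_cmult \<eta>C)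
  \<comment> \<open>Inside one subsimplex only its own bump is visible, so values and derivatives of
    \<open>w\<close> have a single term there.\<close>
  have other: "x \<notin> cball (c S') (q S')" if "S \<in> \<S>" "S' \<in> \<S>" "S \<noteq> S'" "x \<in> interior S" for S S' x
    using S.interior_unique[OF that(1,2,4)] that(3) B[OF that(2)] interior_subset by blast
  have w_in: "w x = (a S * (q S)\<^sup>2) * \<eta> S x" if S: "S \<in> \<S>" "x \<in> interior S" for S x
  proof -
    have "\<eta> S' x = 0" if "S' \<in> \<S>" "S' \<noteq> S" for S'
      unfolding \<eta>_def using quad_bump_outside(1)[OF q[OF that(1)]] other[OF S(1) that(1) _ S(2)] that(2) by auto
    then show ?thesis unfolding w_def using S S.finite_\<T> by (subst sum.remove[of _ S]) (auto intro!: sum.neutral)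
  qed
  have dw_in: "frechet_derivative w (at x) b = (a S * (q S)\<^sup>2) * frechet_derivative (\<eta> S) (at x) b" if S: "S \<in> \<S>" "x \<in> interior S" for S x b
  proof -
    have "frechet_derivative (\<eta> S') (at x) b = 0" if "S' \<in> \<S>" "S' \<noteq> S" for S'
      unfolding \<eta>_def quad_bump_derivative
      using quad_bump_outside(2)[OF q[OF that(1)]] other[OF S(1) that(1) _ S(2)] that(2) by auto
    moreover have "frechet_derivative w (at x) b = (\<Sum>S\<in>\<S>. (a S * (q S)\<^sup>2) * frechet_derivative (\<eta> S) (at x) b)"
      unfolding w_def[abs_def] by (rule frechet_derivative_sum_cmult[OF \<eta>C])
    ultimately show ?thesis using S S.finite_\<T> by (simp add: sum.remove[of _ S])
  qed
  define g where "g x = (\<Sum>b\<in>Basis. frechet_derivative w (at x) b *\<^sub>R b)" for x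
  have g: "has_weak_grad \<Omega> w g" unfolding g_def[abs_def] using open_\<Omega> bounded_\<Omega> wC by (rule has_weak_grad_C1c)
  have gb: "(\<lambda>x. g x \<bullet> b) = (\<lambda>x. frechet_derivative w (at x) b)" if "b \<in> Basis" for b
    unfolding g_def using that by (simp add: inner_sum_left_Basis)
  have wL: "w \<in> L2 \<Omega>" using wC lmeasurable_\<Omega> by (rule C1c_L2)
  have bound: "(l2_norm \<Omega> f)\<^sup>2 \<le> (\<Sum>S\<in>\<S>. (M S)\<^sup>2 * measure lebesgue S)"
    if f: "f \<in> L2 \<Omega>" and M: "\<And>S x. S \<in> \<S> \<Longrightarrow> x \<in> interior S \<Longrightarrow> \<bar>f x\<bar> \<le> M S" for f M
    unfolding S.l2_norm_decompose[OF f]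
  proof (rule sum_mono)
    fix S assume S: "S \<in> \<S>"
    have sb: "interior S \<in> sets lebesgue" by (simp add: borel_open)
    have fS: "f \<in> L2 (interior S)" using f sets_\<Omega> sb S.interior_subset_\<Omega>[OF S] by (rule L2_subset)
    interpret finite_measure "lebesgue_on (interior S)"
      using S.interior_lmeasurable[OF S] by (rule finite_measure_lebesgue_on)
    have "(f x)\<^sup>2 \<le> (M S)\<^sup>2" if "x \<in> interior S" for x
      using power_mono[OF M[OF S that], of 2] by simp
    then have "(l2_norm (interior S) f)\<^sup>2 \<le> (LINT x|lebesgue_on (interior S). (M S)\<^sup>2)"
      unfolding l2_norm_square_integral using L2_square_integrable[OF fS] by (intro integral_mono) auto
    also have "\<dots> = (M S)\<^sup>2 * measure lebesgue S"
      using S.measure_interior[OF S] sb by (simp add: measure_restrict_space)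
    finally show "(l2_norm (interior S) f)\<^sup>2 \<le> (M S)\<^sup>2 * measure lebesgue S" .
  qed
  define Z where "Z = (\<Sum>S\<in>\<S>. (h S * a S)\<^sup>2 * measure lebesgue S)"
  have Z0: "0 \<le> Z" unfolding Z_def by (simp add: sum_nonneg)
  have Z: "(l2_norm \<Omega> (\<lambda>x. mesh_size \<T> x * z x))\<^sup>2 = Z"
  proof -
    have "ae_eq \<Omega> (\<lambda>x. mesh_size \<T> x * z x) (pc \<S> (\<lambda>S. h S * a S))"
      using z(2) S.AE_interior
    proof eventually_elim
      case (elim x)
      then obtain S where "S \<in> \<S>" "x \<in> interior S" by blast
      then show ?case using elim(1) by (simp add: S.pc_interior mesh_size_interior h_def)
    qed
    then have "l2_norm \<Omega> (\<lambda>x. mesh_size \<T> x * z x) = l2_norm \<Omega> (pc \<S> (\<lambda>S. h S * a S))"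
      by (rule l2_norm_ae_cong) (use mesh_size_measurable z(1)[THEN L2_measurable] pc_measurable in auto)
    then show ?thesis unfolding Z_def by (simp add: S.l2_norm_pc)
  qed
  have wnorm: "(l2_norm \<Omega> w)\<^sup>2 \<le> (\<Sum>S\<in>\<S>. (\<bar>a S\<bar> * (q S)\<^sup>2)\<^sup>2 * measure lebesgue S)"
  proof (rule bound[OF wL])
    fix S x assume S: "S \<in> \<S>" "x \<in> interior S"
    have "\<bar>\<eta> S x\<bar> \<le> 1" unfolding \<eta>_def using quad_bump_le_1[of "c S" "q S" x] quad_bump_nonneg[of "c S" "q S" x] by simp
    then show "\<bar>w x\<bar> \<le> \<bar>a S\<bar> * (q S)\<^sup>2"
      unfolding w_in[OF S] abs_mult using mult_left_mono[of "\<bar>\<eta> S x\<bar>" 1 "\<bar>a S\<bar> * (q S)\<^sup>2"] by simp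
  qed
  have gnorm: "(l2_norm \<Omega> (\<lambda>x. g x \<bullet> b))\<^sup>2 \<le> (\<Sum>S\<in>\<S>. (\<bar>a S\<bar> * (4 * q S))\<^sup>2 * measure lebesgue S)" if b: "b \<in> Basis" for b
    unfolding gb[OF b]
  proof (rule bound[OF C1c_derivative_L2[OF wC lmeasurable_\<Omega>]])
    fix S x assume S: "S \<in> \<S>" "x \<in> interior S"
    have "\<bar>frechet_derivative (\<eta> S) (at x) b\<bar> \<le> 4 / q S"
      unfolding \<eta>_def using q[OF S(1)] b by (rule quad_bump_derivative_le)
    then have "\<bar>frechet_derivative w (at x) b\<bar> \<le> (\<bar>a S\<bar> * (q S)\<^sup>2) * (4 / q S)"
      unfolding dw_in[OF S] abs_mult abs_power2 by (rule mult_left_mono) simp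
    also have "\<dots> = \<bar>a S\<bar> * (4 * q S)" using q[OF S(1)] by (simp add: power2_eq_square)
    finally show "\<bar>frechet_derivative w (at x) b\<bar> \<le> \<bar>a S\<bar> * (4 * q S)" .
  qed
  have "(l2_norm \<Omega> w)\<^sup>2 + (\<Sum>b\<in>Basis. (l2_norm \<Omega> (\<lambda>x. g x \<bullet> b))\<^sup>2)
      \<le> (\<Sum>S\<in>\<S>. (\<bar>a S\<bar> * (q S)\<^sup>2)\<^sup>2 * measure lebesgue S) + (\<Sum>b\<in>(Basis::'a set). \<Sum>S\<in>\<S>. (\<bar>a S\<bar> * (4 * q S))\<^sup>2 * measure lebesgue S)"
    by (intro add_mono sum_mono wnorm gnorm)
  also have "\<dots> = (\<Sum>S\<in>\<S>. ((q S)\<^sup>2 + 16 * real DIM('a)) * ((a S)\<^sup>2 * (q S)\<^sup>2 * measure lebesgue S))"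
    by (simp add: sum_distrib_left power_mult_distrib power2_abs algebra_simps flip: sum.distrib power_mult power_add)
  also have "\<dots> \<le> (\<Sum>S\<in>\<S>. K2 * ((h S * a S)\<^sup>2 * measure lebesgue S))"
  proof (rule sum_mono)
    fix S assume S: "S \<in> \<S>"
    have "(\<rho> * q S)\<^sup>2 \<le> (h S)\<^sup>2" using h_low[OF S] q[OF S] \<rho>(1) by (intro power_mono) auto
    then have qh: "(q S)\<^sup>2 \<le> (h S)\<^sup>2 / \<rho>\<^sup>2" using \<rho>(1) by (simp add: pos_le_divide_eq power_mult_distrib mult.commute)
    have qR2: "(q S)\<^sup>2 \<le> R\<^sup>2" using qR[OF S] q[OF S] by (intro power_mono) auto
    have "((q S)\<^sup>2 + 16 * real DIM('a)) * ((a S)\<^sup>2 * (q S)\<^sup>2 * measure lebesgue S)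
        \<le> (R\<^sup>2 + 16 * real DIM('a)) * ((a S)\<^sup>2 * ((h S)\<^sup>2 / \<rho>\<^sup>2) * measure lebesgue S)"
      using qR2 qh by (intro mult_mono) auto
    then show "((q S)\<^sup>2 + 16 * real DIM('a)) * ((a S)\<^sup>2 * (q S)\<^sup>2 * measure lebesgue S) \<le> K2 * ((h S * a S)\<^sup>2 * measure lebesgue S)"
      unfolding K2_def by (simp add: power_mult_distrib mult_ac)
  qed
  also have "\<dots> = K2 * Z" unfolding Z_def by (simp add: sum_distrib_left)
  finally have H1w: "(l2_norm \<Omega> w)\<^sup>2 + (\<Sum>b\<in>Basis. (l2_norm \<Omega> (\<lambda>x. g x \<bullet> b))\<^sup>2) \<le> K2 * Z" .
  \<comment> \<open>Since \<open>z\<close> and \<open>w\<close> carry the same coefficient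
    \<open>a S\<close>, each subsimplex contributes a square to the pairing, and there is no
    cancellation between them.\<close>
  have pair: "Z \<le> K1 * l2_inner \<Omega> z w"
  proof -
    have "l2_inner \<Omega> z w = l2_inner \<Omega> w (pc \<S> a)"
      unfolding l2_inner_commute[of \<Omega> z] using z wL pc_measurable by (intro l2_inner_ae_cong) (auto dest: L2_measurable)
    also have "\<dots> = (\<Sum>S\<in>\<S>. a S * (LINT x|lebesgue_on (interior S). w x))" using wL by (rule S.l2_inner_pc)
    finally have eq: "K1 * l2_inner \<Omega> z w = (\<Sum>S\<in>\<S>. K1 * (a S * (LINT x|lebesgue_on (interior S). w x)))"
      by (simp add: sum_distrib_left)
    show ?thesis unfolding eq Z_def
    proof (rule sum_mono)
      fix S assume S: "S \<in> \<S>"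
      have sb: "interior S \<in> sets lebesgue" by (simp add: borel_open)
      interpret finite_measure "lebesgue_on (interior S)"
        using S.interior_lmeasurable[OF S] by (rule finite_measure_lebesgue_on)
      have sub: "cball (c S) (q S / 2) \<subseteq> interior S" using B[OF S] q[OF S] by (auto simp: subset_iff)
      have "(LINT x|lebesgue_on (interior S). (1/2) * indicator (cball (c S) (q S / 2)) x) =
          (1/2) * measure lebesgue (cball (c S) (q S / 2))"
        using sub sb by (simp add: measure_restrict_space Int_absorb1 Int_absorb2)
      then have "(1/2) * (unit_ball_vol (real DIM('a)) * (q S / 2) ^ DIM('a)) = (LINT x|lebesgue_on (interior S). (1/2) * indicator (cball (c S) (q S / 2)) x)"
        using q[OF S] by (simp only: content_cball_scale)
      also have "\<dots> \<le> (LINT x|lebesgue_on (interior S). \<eta> S x)"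
      proof (rule integral_mono)
        show "integrable (lebesgue_on (interior S)) (\<eta> S)"
          using S.interior_L2_integrable[OF C1c_L2[OF \<eta>C[OF S] lmeasurable_\<Omega>] S] .
        show "integrable (lebesgue_on (interior S)) (\<lambda>x. (1/2) * indicator (cball (c S) (q S / 2)) x :: real)"
          using sub sb by (intro integrable_mult_right integrable_real_indicator) (auto simp: sets_restrict_space_iff less_top[symmetric])
        show "(1/2) * indicator (cball (c S) (q S / 2)) x \<le> \<eta> S x" for x
          unfolding \<eta>_def using quad_bump_ge[OF q[OF S], of x "c S"] quad_bump_nonneg[of "c S" "q S" x]
          by (auto simp: indicator_def)
      qed
      finally have I: "(1/2) * (unit_ball_vol (real DIM('a)) * (q S / 2) ^ DIM('a)) \<le> (LINT x|lebesgue_on (interior S). \<eta> S x)" .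
      have W: "(LINT x|lebesgue_on (interior S). w x) = (a S * (q S)\<^sup>2) * (LINT x|lebesgue_on (interior S). \<eta> S x)"
        unfolding integral_mult_right_zero[symmetric] by (intro Bochner_Integration.integral_cong) (auto simp: w_in[OF S])
      have "(h S)\<^sup>2 \<le> (4 * \<bar>\<kappa>\<bar> * \<rho> * q S)\<^sup>2" using h_up[OF S] hpos[OF S] by (intro power_mono) auto
      then have "(h S)\<^sup>2 * measure lebesgue S \<le> (4 * \<bar>\<kappa>\<bar> * \<rho> * q S)\<^sup>2 * (unit_ball_vol (real DIM('a)) * (2 * \<bar>\<kappa>\<bar> * q S) ^ DIM('a))"
        using m[OF S] by (intro mult_mono) auto
      also have "\<dots> = (K1 * (q S)\<^sup>2) * ((1/2) * (unit_ball_vol (real DIM('a)) * (q S / 2) ^ DIM('a)))"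
      proof -
        have "(2 * \<bar>\<kappa>\<bar> * q S) = (4 * \<bar>\<kappa>\<bar>) * (q S / 2)" by simp
        then have "(2 * \<bar>\<kappa>\<bar> * q S) ^ DIM('a) = (4 * \<bar>\<kappa>\<bar>) ^ DIM('a) * (q S / 2) ^ DIM('a)"
          by (simp only: power_mult_distrib)
        moreover have "(4 * \<bar>\<kappa>\<bar> * \<rho> * q S)\<^sup>2 = 16 * \<kappa>\<^sup>2 * \<rho>\<^sup>2 * (q S)\<^sup>2" by (simp add: power_mult_distrib)
        ultimately show ?thesis unfolding K1_def by (simp only: mult_ac)
      qed
      also have "\<dots> \<le> (K1 * (q S)\<^sup>2) * (LINT x|lebesgue_on (interior S). \<eta> S x)"
        using I K(1) by (intro mult_left_mono) auto
      finally have "(a S)\<^sup>2 * ((h S)\<^sup>2 * measure lebesgue S) \<le> (a S)\<^sup>2 * ((K1 * (q S)\<^sup>2) * (LINT x|lebesgue_on (interior S). \<eta> S x))"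
        by (intro mult_left_mono) auto
      then show "(h S * a S)\<^sup>2 * measure lebesgue S \<le> K1 * (a S * (LINT x|lebesgue_on (interior S). w x))"
        unfolding W by (simp add: power_mult_distrib power2_eq_square mult_ac)
    qed
  qed
  \<comment> \<open>The supports are compact subsets of the open domain and so miss its frontier;
    their complement is an open neighbourhood of \<gamma> on which \<open>w\<close>
    vanishes.\<close>
  define V where "V = - (\<Union>S\<in>\<S>. cball (c S) (q S))"
  have V: "open V" unfolding V_def using S.finite_\<T> by (intro open_Compl closed_UN) auto
  have "frontier \<Omega> \<inter> \<Omega> = {}" using open_\<Omega> by (auto simp: frontier_def interior_open)
  then have \<gamma>V: "\<gamma> \<subseteq> V" unfolding V_def using \<gamma> B S.interior_subset_\<Omega> by blast
  have wV: "w x = 0" if "x \<in> V" for x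
    using that q unfolding w_def V_def \<eta>_def by (intro sum.neutral) (auto simp: quad_bump_outside(1))
  have dn: "0 \<le> dual_norm \<Omega> \<gamma> z" using open_\<Omega> bounded_\<Omega> z(1) by (rule dual_norm_nonneg)
  have "sqrt Z \<le> K1 * sqrt K2 * dual_norm \<Omega> \<gamma> z"
  \<comment> \<open>The bound \<open>E = sqrt (K2 * Z)\<close> on the H^1 norm has to be positive to
    be divided by.\<close>
  proof (cases "Z = 0")
    case True
    then show ?thesis using K dn by simp
  next
    case False
    with Z0 have Zp: "0 < Z" by simp
    have "\<bar>l2_inner \<Omega> z w\<bar> \<le> sqrt (K2 * Z) * dual_norm \<Omega> \<gamma> z"
      by (rule l2_inner_le_dual_norm_mult[OF open_\<Omega> bounded_\<Omega> z(1) wL g V \<gamma>V wV])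
         (use Zp K(2) H1w in auto)
    then have "K1 * l2_inner \<Omega> z w \<le> K1 * (sqrt (K2 * Z) * dual_norm \<Omega> \<gamma> z)"
      using K(1) by (intro mult_left_mono) auto
    with pair have "Z \<le> K1 * (sqrt (K2 * Z) * dual_norm \<Omega> \<gamma> z)" by linarith
    then have "sqrt Z * sqrt Z \<le> (K1 * sqrt K2 * dual_norm \<Omega> \<gamma> z) * sqrt Z"
      using Z0 by (simp add: real_sqrt_mult mult_ac)
    then show ?thesis by (rule mult_right_le_imp_le) (use Zp in simp)
  qed
  moreover have "l2_norm \<Omega> (\<lambda>x. mesh_size \<T> x * z x) = sqrt Z"
    unfolding Z[symmetric] by simp
  ultimately show ?thesis unfolding K1_def K2_def \<rho>_def by simp
qed

section \<open>The spaces spanned by the functions\<close>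

lemma psi_sum_ae: "ae_eq \<Omega> (\<lambda>x. \<Sum>v\<in>N. c v * psi \<T> \<S> v x) (pc \<S> (\<lambda>S. \<Sum>v\<in>N. c v * psi_coeff v S))"
  by (rule S.ae_eqI) (simp add: S.pc_interior psi_def psi_coeff_def patch_interior)

lemma pc_parent_ae: "ae_eq \<Omega> (pc \<T> a) (pc \<S> (\<lambda>S. a (parent S)))"
  by (rule S.ae_eqI) (simp add: S.pc_interior pc_interior[OF parent(1) interior_parent])

lemma Z_space_pc:
  assumes "z \<in> Z_space \<Omega> \<gamma> \<T> \<S>" obtains a where "z \<in> L2 \<Omega>" "ae_eq \<Omega> z (pc \<S> a)"
proof -
  obtain u b where z: "z \<in> L2 \<Omega>" "u \<in> U_space \<Omega> \<T>" "b \<in> B_space \<Omega> \<gamma> \<T> \<S>" "ae_eq \<Omega> z (\<lambda>x. u x + b x)"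
    using assms unfolding Z_space_def l2_sum_def by blast
  obtain a where a: "ae_eq \<Omega> u (pc \<T> a)" by (rule U_space_pc[OF z(2)]) (rule that)
  obtain c where c: "ae_eq \<Omega> b (\<lambda>x. \<Sum>v\<in>N. c v * theta \<Omega> \<T> \<S> v x)"
    using z(3) unfolding B_space_def l2_span_def by blast
  have "ae_eq \<Omega> z (pc \<S> (\<lambda>S. a (parent S) + (\<Sum>v\<in>N. c v * theta_coeff v S)))"
    using z(4) a c pc_parent_ae[of a] theta_sum_ae[of c] S.AE_interior
  proof eventually_elim
    case (elim x)
    then obtain S where "S \<in> \<S>" "x \<in> interior S" by blast
    then show ?case using elim by (simp add: S.pc_interior)
  qed
  with z(1) show thesis by (rule that)
qed

text \<open>Each \<open>\<psi>\<close> is its projection, the indicator of a patch, plus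
  \<open>\<theta>\<close>; the same coefficients serve for both parts.\<close>

lemma W_subset_Z: "W_space \<Omega> \<gamma> \<T> \<S> \<subseteq> Z_space \<Omega> \<gamma> \<T> \<S>"
proof
  fix f assume "f \<in> W_space \<Omega> \<gamma> \<T> \<S>"
  then obtain c where f: "f \<in> L2 \<Omega>" "ae_eq \<Omega> f (\<lambda>x. \<Sum>v\<in>N. c v * psi \<T> \<S> v x)"
    unfolding W_space_def l2_span_def by blast
  let ?u = "pc \<T> (\<lambda>T. \<Sum>v\<in>N. c v * of_bool (v \<in> T))"
  let ?b = "\<lambda>x. \<Sum>v\<in>N. c v * theta \<Omega> \<T> \<S> v x"
  have "ae_eq \<Omega> f (\<lambda>x. ?u x + ?b x)"
    using f(2) psi_sum_ae[of c] theta_sum_ae[of c] S.AE_interior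
  proof eventually_elim
    case (elim x)
    then obtain S where S: "S \<in> \<S>" "x \<in> interior S" by blast
    have "(\<Sum>v\<in>N. c v * psi_coeff v S) = (\<Sum>v\<in>N. c v * of_bool (v \<in> parent S)) + (\<Sum>v\<in>N. c v * theta_coeff v S)"
      unfolding sum.distrib[symmetric] psi_coeff_def theta_coeff_def by (simp add: algebra_simps)
    then show ?case
      using elim S pc_interior[OF parent(1)[OF S(1)] interior_parent[OF S]] by (simp add: S.pc_interior)
  qed
  moreover have "?u \<in> U_space \<Omega> \<T>" by (rule pc_U_space)
  moreover have "?b \<in> B_space \<Omega> \<gamma> \<T> \<S>" unfolding B_space_def l2_span_def using theta_sum_L2[of c] by blast
  ultimately show "f \<in> Z_space \<Omega> \<gamma> \<T> \<S>"
    unfolding Z_space_def l2_sum_def using f(1) by (intro CollectI conjI bexI[where x = ?u] bexI[where x = ?b])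
qed

text \<open>Over the children of a simplex at \<open>v\<close> the coefficients of
  \<open>\<theta>\<close> sum to \<open>2 * 2 ^ d - 2 * 2 ^ d = 0\<close>, so all element averages
  vanish.\<close>

lemma Q_B_space: assumes "b \<in> B_space \<Omega> \<gamma> \<T> \<S>" shows "b \<in> L2 \<Omega>" "ae_eq \<Omega> (Q \<Omega> \<T> b) (\<lambda>x. 0)"
proof -
  obtain c where b: "b \<in> L2 \<Omega>" "ae_eq \<Omega> b (\<lambda>x. \<Sum>v\<in>N. c v * theta \<Omega> \<T> \<S> v x)"
    using assms unfolding B_space_def l2_span_def by blast
  show "b \<in> L2 \<Omega>" by (rule b)
  have ae: "ae_eq \<Omega> b (pc \<S> (\<lambda>S. \<Sum>v\<in>N. c v * theta_coeff v S))"
    using b(2) theta_sum_ae by (rule ae_eq_trans)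
  have "avg b T = 0" if T: "T \<in> \<T>" for T
  proof -
    have 0: "(\<Sum>S\<in>children T. theta_coeff v S) = 0" if v: "v \<in> N" for v
    proof -
      have "(\<Sum>S\<in>children T. theta_coeff v S) = (\<Sum>S\<in>children T. psi_coeff v S) - (\<Sum>S\<in>children T. of_bool (v \<in> T))"
        unfolding sum_subtractf[symmetric] by (intro sum.cong) (auto simp: theta_coeff_def psi_coeff_def children_eq[OF T])
      then show ?thesis by (simp add: sum_psi_coeff[OF T v] card_children[OF T])
    qed
    have "avg b T = (\<Sum>S\<in>children T. \<Sum>v\<in>N. c v * theta_coeff v S) / 2 ^ DIM('a)"
      using avg_ae_cong[OF b(1) S.pc_L2 ae T] avg_pc_children[OF T] by simp
    also have "(\<Sum>S\<in>children T. \<Sum>v\<in>N. c v * theta_coeff v S) = 0"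
      by (subst sum.swap) (simp add: 0 flip: sum_distrib_left)
    finally show ?thesis by simp
  qed
  then have "pc \<T> (avg b) = pc \<T> (\<lambda>_. 0)" by (rule pc_cong)
  then show "ae_eq \<Omega> (Q \<Omega> \<T> b) (\<lambda>x. 0)" using Q_ae[OF b(1)] by (simp add: pc_def)
qed

lemma B_subset_ran: "B_space \<Omega> \<gamma> \<T> \<S> \<subseteq> l2_ran \<Omega> (\<lambda>f x. f x - Q \<Omega> \<T> f x)"
proof
  fix b assume b: "b \<in> B_space \<Omega> \<gamma> \<T> \<S>"
  have "ae_eq \<Omega> b (\<lambda>x. b x - Q \<Omega> \<T> b x)" using Q_B_space(2)[OF b] by eventually_elim simp
  then show "b \<in> l2_ran \<Omega> (\<lambda>f x. f x - Q \<Omega> \<T> f x)" unfolding l2_ran_def using Q_B_space(1)[OF b] by blast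
qed

lemma U_subset_ran: "U_space \<Omega> \<T> \<subseteq> l2_ran \<Omega> (Q \<Omega> \<T>)"
proof
  fix u assume u: "u \<in> U_space \<Omega> \<T>"
  show "u \<in> l2_ran \<Omega> (Q \<Omega> \<T>)"
    unfolding l2_ran_def using U_space_L2[OF u] ae_eq_sym[OF Q_U_space[OF u]] by blast
qed

end

section \<open>Spans and ranges as subspaces\<close>

lemma l2_subspace_span: "l2_subspace \<Omega> (l2_span \<Omega> N F)"
  unfolding l2_subspace_def
proof (intro conjI ballI allI)
  show "l2_span \<Omega> N F \<subseteq> L2 \<Omega>" by (auto simp: l2_span_def)
  show "(\<lambda>x. 0) \<in> l2_span \<Omega> N F" by (auto simp: l2_span_def intro!: exI[of _ "\<lambda>_. 0"])
next
  fix f g assume "f \<in> l2_span \<Omega> N F" "g \<in> l2_span \<Omega> N F"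
  then obtain c d where f: "f \<in> L2 \<Omega>" "ae_eq \<Omega> f (\<lambda>x. \<Sum>i\<in>N. c i * F i x)"
    and g: "g \<in> L2 \<Omega>" "ae_eq \<Omega> g (\<lambda>x. \<Sum>i\<in>N. d i * F i x)" unfolding l2_span_def by blast
  have "ae_eq \<Omega> (\<lambda>x. f x + g x) (\<lambda>x. \<Sum>i\<in>N. (c i + d i) * F i x)"
    using f(2) g(2) by eventually_elim (simp add: distrib_right sum.distrib)
  moreover have "(\<lambda>x. f x + g x) \<in> L2 \<Omega>" using f(1) g(1) by (rule L2_add)
  ultimately show "(\<lambda>x. f x + g x) \<in> l2_span \<Omega> N F"
    unfolding l2_span_def by (intro CollectI conjI exI[of _ "\<lambda>i. c i + d i"])
next
  fix f a assume "f \<in> l2_span \<Omega> N F"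
  then obtain c where f: "f \<in> L2 \<Omega>" "ae_eq \<Omega> f (\<lambda>x. \<Sum>i\<in>N. c i * F i x)" unfolding l2_span_def by blast
  have "ae_eq \<Omega> (\<lambda>x. a * f x) (\<lambda>x. \<Sum>i\<in>N. (a * c i) * F i x)"
    using f(2) by eventually_elim (simp add: sum_distrib_left mult.assoc)
  moreover have "(\<lambda>x. a * f x) \<in> L2 \<Omega>" using f(1) by (rule L2_cmult)
  ultimately show "(\<lambda>x. a * f x) \<in> l2_span \<Omega> N F"
    unfolding l2_span_def by (intro CollectI conjI exI[of _ "\<lambda>i. a * c i"])
qed

text \<open>Linearity up to null sets suffices, because \<open>l2_ran\<close> is saturated under
  almost everywhere equality.\<close>

lemma l2_subspace_ran:
  assumes lin: "\<And>f g a b. f \<in> L2 \<Omega> \<Longrightarrow> g \<in> L2 \<Omega> \<Longrightarrow> ae_eq \<Omega> (A (\<lambda>x. a * f x + b * g x)) (\<lambda>x. a * A f x + b * A g x)"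
  shows "l2_subspace \<Omega> (l2_ran \<Omega> A)"
proof -
  have comb: "(\<lambda>x. a * f x + b * g x) \<in> l2_ran \<Omega> A" if fg: "f \<in> l2_ran \<Omega> A" "g \<in> l2_ran \<Omega> A" for f g a b
  proof -
    obtain f' g' where f: "f \<in> L2 \<Omega>" "f' \<in> L2 \<Omega>" "ae_eq \<Omega> f (A f')"
      and g: "g \<in> L2 \<Omega>" "g' \<in> L2 \<Omega>" "ae_eq \<Omega> g (A g')" using fg unfolding l2_ran_def by blast
    have "ae_eq \<Omega> (\<lambda>x. a * f x + b * g x) (A (\<lambda>x. a * f' x + b * g' x))"
      using f(3) g(3) lin[OF f(2) g(2), of a b] by eventually_elim simp
    moreover have "(\<lambda>x. a * f x + b * g x) \<in> L2 \<Omega>" "(\<lambda>x. a * f' x + b * g' x) \<in> L2 \<Omega>"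
      using f g by (auto intro!: L2_add L2_cmult)
    ultimately show ?thesis unfolding l2_ran_def by blast
  qed
  have "ae_eq \<Omega> (\<lambda>x. 0) (A (\<lambda>x. 0))"
    using lin[OF L2_zero L2_zero, of 0 0] by simp
  then have "(\<lambda>x. 0) \<in> l2_ran \<Omega> A" unfolding l2_ran_def using L2_zero by blast
  then show ?thesis
    unfolding l2_subspace_def
  proof (intro conjI ballI allI)
    show "l2_ran \<Omega> A \<subseteq> L2 \<Omega>" by (auto simp: l2_ran_def)
    show "(\<lambda>x. f x + g x) \<in> l2_ran \<Omega> A" if "f \<in> l2_ran \<Omega> A" "g \<in> l2_ran \<Omega> A" for f g
      using comb[OF that, of 1 1] by simp
    show "(\<lambda>x. a * f x) \<in> l2_ran \<Omega> A" if "f \<in> l2_ran \<Omega> A" for f a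
      using comb[OF that that, of a 0] by simp
  qed
qed

theorem proposition5p7:
  fixes \<Omega> \<gamma> :: "'a::euclidean_space set"
    and \<TT> :: "'a set set set"
    and red :: "'a set set \<Rightarrow> 'a set set"
    and s :: real
  assumes "polytopal_domain \<Omega>" and "bounded \<Omega>"
    and "\<gamma> \<subseteq> frontier \<Omega>" and "closed \<gamma>" and "\<gamma> \<in> sets lebesgue"
    and "0 \<le> s" and "s \<le> 1"
    and "\<And>\<T>. \<T> \<in> \<TT> \<Longrightarrow> simplicial_partition \<Omega> \<T> \<and> conforming \<T>"
    and "uniformly_shape_regular \<TT>"
    and "DIM('a) = 1 \<Longrightarrow> K_mesh \<TT>"
    and "\<And>\<T>. \<T> \<in> \<TT> \<Longrightarrow> union_of_facets \<T> \<gamma>"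
    and "\<And>\<T>. \<T> \<in> \<TT> \<Longrightarrow> red_refinement \<Omega> \<T> (red \<T>)"
    and "uniformly_shape_regular (red ` \<TT>)"
  shows
    "(\<forall>\<T>\<in>\<TT>. W_space \<Omega> \<gamma> \<T> (red \<T>) \<subseteq> Z_space \<Omega> \<gamma> \<T> (red \<T>)) \<and>
     \<comment> \<open>(a)\<close>
     (\<exists>C. \<forall>\<T>\<in>\<TT>. l2_to_dual_bounded \<Omega> \<gamma> C (Q \<Omega> \<T>)) \<and>
     (\<forall>\<T>\<in>\<TT>. \<forall>f\<in>L2 \<Omega>. ae_eq \<Omega> (Q \<Omega> \<T> (Q \<Omega> \<T> f)) (Q \<Omega> \<T> f)) \<and>
     (\<forall>\<T>\<in>\<TT>. U_space \<Omega> \<T> \<subseteq> l2_ran \<Omega> (Q \<Omega> \<T>) \<and>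
        B_space \<Omega> \<gamma> \<T> (red \<T>) \<subseteq> l2_ran \<Omega> (\<lambda>f x. f x - Q \<Omega> \<T> f x) \<and>
        l2_subspace \<Omega> (U_space \<Omega> \<T>) \<and> l2_subspace \<Omega> (B_space \<Omega> \<gamma> \<T> (red \<T>)) \<and>
        l2_subspace \<Omega> (l2_ran \<Omega> (Q \<Omega> \<T>)) \<and>
        l2_subspace \<Omega> (l2_ran \<Omega> (\<lambda>f x. f x - Q \<Omega> \<T> f x))) \<and>
     \<comment> \<open>(1)\<close>
     (\<exists>C. \<forall>\<T>\<in>\<TT>. \<forall>w\<in>H1_0 \<Omega> \<gamma>.
        (\<lambda>x. inverse (mesh_size \<T> x) * (w x - dual_adjoint \<Omega> (Q \<Omega> \<T>) w x)) \<in> L2 \<Omega> \<and>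
        l2_norm \<Omega> (\<lambda>x. inverse (mesh_size \<T> x) * (w x - dual_adjoint \<Omega> (Q \<Omega> \<T>) w x))
          \<le> C * h1_norm \<Omega> w) \<and>
     \<comment> \<open>(2)\<close>
     (\<exists>C. \<forall>\<T>\<in>\<TT>. \<forall>z\<in>Z_space \<Omega> \<gamma> \<T> (red \<T>). l2_norm \<Omega> (Q \<Omega> \<T> z) \<le> C * l2_norm \<Omega> z) \<and>
     \<comment> \<open>(3)\<close>
     (\<exists>C. \<forall>\<T>\<in>\<TT>. \<forall>z\<in>Z_space \<Omega> \<gamma> \<T> (red \<T>).
        l2_norm \<Omega> (\<lambda>x. mesh_size \<T> x * z x) \<le> C * dual_norm \<Omega> \<gamma> z) \<and>
     \<comment> \<open>(b)\<close>
     (\<forall>\<T>\<in>\<TT>. \<forall>\<nu>\<in>free_vertices \<gamma> \<T>. ae_eq \<Omega> (Q \<Omega> \<T> (psi \<T> (red \<T>) \<nu>)) (indicator (patch \<T> \<nu>))) \<and>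
     \<comment> \<open>(c); the lower bound fails for \<open>d = 1\<close>, where neighbouring \<open>\<theta>\<^sub>\<nu>\<close> are opposite on the common interval\<close>
     (\<forall>\<T>\<in>\<TT>. B_space \<Omega> \<gamma> \<T> (red \<T>) = l2_span \<Omega> (free_vertices \<gamma> \<T>) (theta \<Omega> \<T> (red \<T>))) \<and>
     (\<exists>C. \<forall>\<T>\<in>\<TT>. \<forall>c :: 'a \<Rightarrow> real.
        (l2_norm \<Omega> (\<lambda>x. mesh_size \<T> x powr s *
            (\<Sum>\<nu>\<in>free_vertices \<gamma> \<T>. c \<nu> * theta \<Omega> \<T> (red \<T>) \<nu> x)))\<^sup>2
        \<le> C * (\<Sum>\<nu>\<in>free_vertices \<gamma> \<T>. \<bar>c \<nu>\<bar>\<^sup>2 *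
            (l2_norm \<Omega> (\<lambda>x. mesh_size \<T> x powr s * theta \<Omega> \<T> (red \<T>) \<nu> x))\<^sup>2)) \<and>
     (2 \<le> DIM('a) \<longrightarrow>
       (\<exists>C. \<forall>\<T>\<in>\<TT>. \<forall>c :: 'a \<Rightarrow> real.
          (\<Sum>\<nu>\<in>free_vertices \<gamma> \<T>. \<bar>c \<nu>\<bar>\<^sup>2 *
            (l2_norm \<Omega> (\<lambda>x. mesh_size \<T> x powr s * theta \<Omega> \<T> (red \<T>) \<nu> x))\<^sup>2)
          \<le> C * (l2_norm \<Omega> (\<lambda>x. mesh_size \<T> x powr s *
            (\<Sum>\<nu>\<in>free_vertices \<gamma> \<T>. c \<nu> * theta \<Omega> \<T> (red \<T>) \<nu> x)))\<^sup>2) \<and>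
       (\<forall>\<T>\<in>\<TT>. \<forall>c :: 'a \<Rightarrow> real.
          ae_eq \<Omega> (\<lambda>x. \<Sum>\<nu>\<in>free_vertices \<gamma> \<T>. c \<nu> * theta \<Omega> \<T> (red \<T>) \<nu> x) (\<lambda>x. 0) \<longrightarrow>
          (\<forall>\<nu>\<in>free_vertices \<gamma> \<T>. c \<nu> = 0)))"
proof -
  have o: "open \<Omega>" using assms(1) by (simp add: polytopal_domain_def)
  have rp: "red_partition \<Omega> \<T> (red \<T>)" if "\<T> \<in> \<TT>" for \<T>
    by unfold_locales (use o assms(2) assms(8)[OF that] assms(12)[OF that] in auto)
  have p: "partition \<Omega> \<T>" if "\<T> \<in> \<TT>" for \<T> using rp[OF that] by (simp add: red_partition_def)
  obtain \<kappa> where \<kappa>: "\<And>\<T> T. \<T> \<in> \<TT> \<Longrightarrow> T \<in> \<T> \<Longrightarrow> shape_regular \<kappa> T"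
    using assms(9) unfolding uniformly_shape_regular_def shape_regular_def by blast
  obtain \<kappa>' where \<kappa>': "\<And>\<T> S. \<T> \<in> \<TT> \<Longrightarrow> S \<in> red \<T> \<Longrightarrow> shape_regular \<kappa>' S"
    using assms(13) unfolding uniformly_shape_regular_def shape_regular_def by blast
  obtain R where R: "0 < R" "\<forall>x\<in>\<Omega>. norm x \<le> R" using assms(2) unfolding bounded_pos by blast
  then have R\<Omega>: "\<Omega> \<subseteq> cball 0 R" by auto
  \<comment> \<open>The constants involve only the dimension, the shape constants of the partitions
    and of their refinements, and the radius \<open>R\<close> of a ball containing the domain; none
    depends on \<open>\<T>\<close>.\<close>
  let ?C1 = "sqrt (\<bar>\<kappa>\<bar> ^ (DIM('a) + 2) / (ball_size TYPE('a))\<^sup>2)"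
  let ?C3 = "(32 * \<kappa>'\<^sup>2 * (ball_size TYPE('a))\<^sup>2 * (4 * \<bar>\<kappa>'\<bar>) ^ DIM('a)) * sqrt ((R\<^sup>2 + 16 * real DIM('a)) / (ball_size TYPE('a))\<^sup>2)"
  have W: "\<forall>\<T>\<in>\<TT>. W_space \<Omega> \<gamma> \<T> (red \<T>) \<subseteq> Z_space \<Omega> \<gamma> \<T> (red \<T>)"
    using red_partition.W_subset_Z[OF rp] by blast
  have dual: "\<forall>\<T>\<in>\<TT>. l2_to_dual_bounded \<Omega> \<gamma> 1 (Q \<Omega> \<T>)"
  proof
    fix \<T> assume "\<T> \<in> \<TT>"
    then interpret partition \<Omega> \<T> by (rule p)
    \<comment> \<open>The constant 1: an orthogonal projector is a contraction of L_2, and the dual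
      norm is at most the L_2 norm.\<close>
    have "dual_norm \<Omega> \<gamma> (Q \<Omega> \<T> f) \<le> 1 * l2_norm \<Omega> f" if "f \<in> L2 \<Omega>" for f
      using dual_norm_le_l2_norm[OF o assms(2) Q_L2[OF that], of \<gamma>] Q_contraction[OF that] by linarith
    then show "l2_to_dual_bounded \<Omega> \<gamma> 1 (Q \<Omega> \<T>)"
      unfolding l2_to_dual_bounded_def using Q_ae_cong Q_linear Q_L2 by blast
  qed
  have idem: "\<forall>\<T>\<in>\<TT>. \<forall>f\<in>L2 \<Omega>. ae_eq \<Omega> (Q \<Omega> \<T> (Q \<Omega> \<T> f)) (Q \<Omega> \<T> f)"
    using partition.Q_idem[OF p] by blast
  have ran: "\<forall>\<T>\<in>\<TT>. U_space \<Omega> \<T> \<subseteq> l2_ran \<Omega> (Q \<Omega> \<T>) \<and>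
        B_space \<Omega> \<gamma> \<T> (red \<T>) \<subseteq> l2_ran \<Omega> (\<lambda>f x. f x - Q \<Omega> \<T> f x) \<and>
        l2_subspace \<Omega> (U_space \<Omega> \<T>) \<and> l2_subspace \<Omega> (B_space \<Omega> \<gamma> \<T> (red \<T>)) \<and>
        l2_subspace \<Omega> (l2_ran \<Omega> (Q \<Omega> \<T>)) \<and>
        l2_subspace \<Omega> (l2_ran \<Omega> (\<lambda>f x. f x - Q \<Omega> \<T> f x))"
  proof
    fix \<T> assume T: "\<T> \<in> \<TT>"
    interpret red_partition \<Omega> \<T> "red \<T>" \<gamma> using T by (rule rp)
    have "ae_eq \<Omega> (\<lambda>x. (a * f x + b * g x) - Q \<Omega> \<T> (\<lambda>x. a * f x + b * g x) x)
        (\<lambda>x. a * (f x - Q \<Omega> \<T> f x) + b * (g x - Q \<Omega> \<T> g x))" if "f \<in> L2 \<Omega>" "g \<in> L2 \<Omega>" for f g a b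
      using Q_linear[OF that, of a b] by eventually_elim (simp add: algebra_simps)
    then have "l2_subspace \<Omega> (l2_ran \<Omega> (\<lambda>f x. f x - Q \<Omega> \<T> f x))"
      by (rule l2_subspace_ran)
    moreover have "l2_subspace \<Omega> (l2_ran \<Omega> (Q \<Omega> \<T>))" by (rule l2_subspace_ran[OF Q_linear])
    ultimately show "U_space \<Omega> \<T> \<subseteq> l2_ran \<Omega> (Q \<Omega> \<T>) \<and>
        B_space \<Omega> \<gamma> \<T> (red \<T>) \<subseteq> l2_ran \<Omega> (\<lambda>f x. f x - Q \<Omega> \<T> f x) \<and>
        l2_subspace \<Omega> (U_space \<Omega> \<T>) \<and> l2_subspace \<Omega> (B_space \<Omega> \<gamma> \<T> (red \<T>)) \<and>
        l2_subspace \<Omega> (l2_ran \<Omega> (Q \<Omega> \<T>)) \<and>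
        l2_subspace \<Omega> (l2_ran \<Omega> (\<lambda>f x. f x - Q \<Omega> \<T> f x))"
      using U_subset_ran B_subset_ran U_space_subspace l2_subspace_span[of \<Omega>]
      unfolding B_space_def by blast
  qed
  have error: "\<forall>\<T>\<in>\<TT>. \<forall>w\<in>H1_0 \<Omega> \<gamma>.
        (\<lambda>x. inverse (mesh_size \<T> x) * (w x - dual_adjoint \<Omega> (Q \<Omega> \<T>) w x)) \<in> L2 \<Omega> \<and>
        l2_norm \<Omega> (\<lambda>x. inverse (mesh_size \<T> x) * (w x - dual_adjoint \<Omega> (Q \<Omega> \<T>) w x))
          \<le> ?C1 * h1_norm \<Omega> w"
  proof (intro ballI)
    fix \<T> w assume T: "\<T> \<in> \<TT>" and "w \<in> H1_0 \<Omega> \<gamma>"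
    then have w: "w \<in> H1 \<Omega>" by (simp add: H1_0_def)
    interpret partition \<Omega> \<T> using T by (rule p)
    show "(\<lambda>x. inverse (mesh_size \<T> x) * (w x - dual_adjoint \<Omega> (Q \<Omega> \<T>) w x)) \<in> L2 \<Omega> \<and>
        l2_norm \<Omega> (\<lambda>x. inverse (mesh_size \<T> x) * (w x - dual_adjoint \<Omega> (Q \<Omega> \<T>) w x))
          \<le> ?C1 * h1_norm \<Omega> w"
      using projection_error[OF \<kappa>[OF T] w] by blast
  qed
  have bnd: "\<forall>\<T>\<in>\<TT>. \<forall>z\<in>Z_space \<Omega> \<gamma> \<T> (red \<T>). l2_norm \<Omega> (Q \<Omega> \<T> z) \<le> 1 * l2_norm \<Omega> z"
    using partition.Q_contraction[OF p] by (auto simp: Z_space_def l2_sum_def)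
  have inv: "\<forall>\<T>\<in>\<TT>. \<forall>z\<in>Z_space \<Omega> \<gamma> \<T> (red \<T>).
        l2_norm \<Omega> (\<lambda>x. mesh_size \<T> x * z x) \<le> ?C3 * dual_norm \<Omega> \<gamma> z"
  proof (intro ballI)
    fix \<T> z assume T: "\<T> \<in> \<TT>" and z: "z \<in> Z_space \<Omega> \<gamma> \<T> (red \<T>)"
    interpret red_partition \<Omega> \<T> "red \<T>" \<gamma> using T by (rule rp)
    obtain a where a: "z \<in> L2 \<Omega>" "ae_eq \<Omega> z (pc (red \<T>) a)" by (rule Z_space_pc[OF z]) (rule that)
    show "l2_norm \<Omega> (\<lambda>x. mesh_size \<T> x * z x) \<le> ?C3 * dual_norm \<Omega> \<gamma> z"
      by (rule inverse_inequality_pc[OF assms(3) _ R(1) R\<Omega> a]) (rule \<kappa>'[OF T])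
  qed
  have Qpsi: "\<forall>\<T>\<in>\<TT>. \<forall>\<nu>\<in>free_vertices \<gamma> \<T>. ae_eq \<Omega> (Q \<Omega> \<T> (psi \<T> (red \<T>) \<nu>)) (indicator (patch \<T> \<nu>))"
    using red_partition.Q_psi[OF rp] by blast
  have B: "\<forall>\<T>\<in>\<TT>. B_space \<Omega> \<gamma> \<T> (red \<T>) = l2_span \<Omega> (free_vertices \<gamma> \<T>) (theta \<Omega> \<T> (red \<T>))"
    by (simp add: B_space_def)
  note upper = red_partition.theta_upper[OF rp] and lower = red_partition.theta_lower[OF rp]
    and independent = red_partition.theta_independent[OF rp]
  show ?thesis
    \<comment> \<open>Each \<open>exI\<close> takes its constant by unification with the fact that
      follows: 1, \<open>?C1\<close>, 1 and \<open>?C3\<close>, then 2 and \<open>2 ^ d - 1\<close>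
      for the two halves of (c).\<close>
    by (rule conjI, rule W, rule conjI, rule exI, rule dual, rule conjI, rule idem, rule conjI, rule ran,
      rule conjI, rule exI, rule error, rule conjI, rule exI, rule bnd, rule conjI, rule exI, rule inv,
      rule conjI, rule Qpsi, rule conjI, rule B, rule conjI, rule exI, intro ballI allI, erule upper,
      rule impI, rule conjI, rule exI, intro ballI allI, erule lower, assumption,
      intro ballI allI impI, erule independent, assumption+)
qed

end
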